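(* Let $Q\subset\mathbb{R}^2$ be a compact convex polygon, centrally symmetric about the origin with nonempty interior, $L=\partial Q$, and consider the CC metric $d_{CC}$ on $H(\mathbb{R})$ induced by $\|\cdot\|_L$. For every $r>0$, if $B_r$ is the CC ball of radius $r$ about ${\sf 0}$, then $$\frac{\vol\bigl(\{{\sf x}\in B_r:\ \text{there is exactly one CC geodesic from }{\sf 0}\text{ to }{\sf x}\}\bigr)}{\vol(B_r)}=\frac{V_{\rm reg}}{V}.$$ In particular the asymptotic density of points reached by a unique geodesic from ${\sf 0}$ equals $V_{\rm reg}/V$.
   Context: Exponential coordinates on $H(\mathbb{R})$: $(x,y,z)(x',y',z')=(x+x',y+y',z+z'+\tfrac12(xy'-yx'))$, ${\sf 0}=(0,0,0)$, $\pi(x,y,z)=(x,y)$, $\delta_t(x,y,z)=(tx,ty,t^2z)$; vol is Lebesgue measure on $\mathbb{R}^3$. $\|\cdot\|_L$ is the norm with unit ball $Q$; $d_{CC}$ is the infimum over admissible curves ($\gamma_3'=\tfrac12(\gamma_1\gamma_2'-\gamma_2\gamma_1')$) of the $\|\cdot\|_L$-length of their projection; a CC geodesic is an admissible curve realizing the distance. $\mathcal S$ is the CC unit sphere about ${\sf 0}$, $V=\vol(B_1)$, and $V_{\rm reg}=\vol\{\delta_t{\sf p}:{\sf p}\in\mathcal S,\ \pi({\sf p})\in Q^\circ,\ 0\le t\le1\}$ where $Q^\circ$ is the interior of $Q$. *)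

theory Defs
  imports "HOL-Analysis.Analysis"
begin

type_synonym heis = "real \<times> real \<times> real"

definition hzero :: heis where "hzero = (0, 0, 0)"

definition hproj :: "heis \<Rightarrow> real \<times> real" where
  "hproj p = (fst p, fst (snd p))"

definition hdil :: "real \<Rightarrow> heis \<Rightarrow> heis" where
  "hdil t p = (t * fst p, t * fst (snd p), t\<^sup>2 * snd (snd p))"

definition sym_polygon :: "(real \<times> real) set \<Rightarrow> bool" where
  "sym_polygon Q \<longleftrightarrow> (\<exists>S. finite S \<and> Q = convex hull S)
     \<and> (\<forall>v\<in>Q. - v \<in> Q) \<and> interior Q \<noteq> {}"

definition Lnorm :: "(real \<times> real) set \<Rightarrow> real \<times> real \<Rightarrow> real" where
  "Lnorm Q v = Inf {t. t > 0 \<and> v \<in> (\<lambda>w. t *\<^sub>R w) ` Q}"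

definition admissible :: "(real \<Rightarrow> heis) \<Rightarrow> bool" where
  "admissible \<gamma> \<longleftrightarrow> (\<exists>C. C-lipschitz_on {0..1} \<gamma>) \<and>
     (AE t in lborel. t \<in> {0..1} \<longrightarrow>
        (\<gamma> differentiable at t \<and>
         snd (snd (vector_derivative \<gamma> (at t))) =
           1/2 * (fst (\<gamma> t) * fst (snd (vector_derivative \<gamma> (at t)))
                  - fst (snd (\<gamma> t)) * fst (vector_derivative \<gamma> (at t)))))"

definition cc_length :: "(real \<times> real) set \<Rightarrow> (real \<Rightarrow> heis) \<Rightarrow> real" where
  "cc_length Q \<gamma> = integral {0..1} (\<lambda>t. Lnorm Q (hproj (vector_derivative \<gamma> (at t))))"

definition dCC :: "(real \<times> real) set \<Rightarrow> heis \<Rightarrow> heis \<Rightarrow> real" where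
  "dCC Q p q = Inf {cc_length Q \<gamma> | \<gamma>. admissible \<gamma> \<and> \<gamma> 0 = p \<and> \<gamma> 1 = q}"

text \<open>CC geodesic from p to q: admissible curve realizing the distance,
  parametrized proportionally to arc length on [0,1] (to identify reparametrizations).\<close>
definition cc_geodesic :: "(real \<times> real) set \<Rightarrow> heis \<Rightarrow> heis \<Rightarrow> (real \<Rightarrow> heis) \<Rightarrow> bool" where
  "cc_geodesic Q p q \<gamma> \<longleftrightarrow> admissible \<gamma> \<and> \<gamma> 0 = p \<and> \<gamma> 1 = q
     \<and> cc_length Q \<gamma> = dCC Q p q
     \<and> (AE t in lborel. t \<in> {0..1} \<longrightarrow>
          Lnorm Q (hproj (vector_derivative \<gamma> (at t))) = dCC Q p q)"

definition unique_geodesic :: "(real \<times> real) set \<Rightarrow> heis \<Rightarrow> heis \<Rightarrow> bool" where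
  "unique_geodesic Q p q \<longleftrightarrow> (\<exists>\<gamma>. cc_geodesic Q p q \<gamma> \<and>
      (\<forall>\<eta>. cc_geodesic Q p q \<eta> \<longrightarrow> (\<forall>t\<in>{0..1}. \<eta> t = \<gamma> t)))"

definition cc_ball :: "(real \<times> real) set \<Rightarrow> real \<Rightarrow> heis set" where
  "cc_ball Q r = {x. dCC Q hzero x \<le> r}"

definition cc_sphere :: "(real \<times> real) set \<Rightarrow> heis set" where
  "cc_sphere Q = {p. dCC Q hzero p = 1}"

definition Vtot :: "(real \<times> real) set \<Rightarrow> real" where
  "Vtot Q = measure lebesgue (cc_ball Q 1)"

definition Vreg :: "(real \<times> real) set \<Rightarrow> real" where
  "Vreg Q = measure lebesgue
     {hdil t p | t p. p \<in> cc_sphere Q \<and> hproj p \<in> interior Q \<and> 0 \<le> t \<and> t \<le> 1}"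

definition uniq_ratio :: "(real \<times> real) set \<Rightarrow> real \<Rightarrow> real" where
  "uniq_ratio Q r = measure lebesgue {x \<in> cc_ball Q r. unique_geodesic Q hzero x}
                    / measure lebesgue (cc_ball Q r)"

end

theory Submission
  imports Defs
begin

text \<open>Fix a point \<open>(p, z)\<close> with \<open>p\<close> not parallel to a vertex of \<open>Q\<close>, and choose linear coordinates with
  \<open>p = (0, 1)\<close> and \<open>z \<ge> 0\<close>; the horizontal lift turns \<open>z\<close> into the area cut off by the projected curve
  and the chord from \<open>0\<close> to \<open>p\<close>. Let \<open>A\<close> be half the area of the parallelogram with diagonal \<open>p\<close> spanned
  by the two vertices of \<open>Q\<close> adjacent to the direction of \<open>p\<close>. If \<open>z < A\<close>, there are two different
  three-segment curves of length \<open>\<parallel>p\<parallel>\<close> with area \<open>z\<close>, so the distance is \<open>\<parallel>p\<parallel>\<close> and the geodesic is not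
  unique. If \<open>z > A\<close>, an intermediate value argument gives an arc of a multiple of the isoperimetrix
  (the rotated polar dual of \<open>Q\<close>) with chord \<open>p\<close> and area \<open>z\<close>. Schmidt's projection argument,
  applied to open curves, shows that this arc is strictly longer than \<open>\<parallel>p\<parallel>\<close>, that it is shortest, and that
  it is the only shortest curve. The set \<open>z = A\<close> and the excluded directions are null sets, so up to a null set
  the points with a unique geodesic are those with \<open>\<parallel>p\<parallel> < d(0, (p, z))\<close>, a set invariant under dilations
  whose part in the unit ball is the set defining \<open>Vreg\<close> (up to the origin).\<close>

section \<open>Lipschitz functions of one variable that are differentiable almost everywhere\<close>

text \<open>It is then bounded by two graphs over an interval of the \<open>x\<close>-axis, a curve
  can be paired with the boundary point of the same abscissa, and the graph terms integrate to exact
  differences. The scale \<open>\<mu>\<close> of the comparison body is dictated by the horizontal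
  extent of the curve, not by its area; the resulting inequality is quadratic in
  \<open>\<mu>\<close>. Completing the square removes \<open>\<mu>\<close>, and equality forces
  \<open>\<mu> = 1\<close>. An open curve contributes the extra term \<open>h * P\<close>, with
  \<open>h\<close> the abscissa of the chord in the comparison body and \<open>P\<close> the length
  of the chord along the \<open>y\<close>-axis. The threshold \<open>A\<close> comes from the
  extreme corner of the isoperimetrix: vertical cuts near it leave similar triangles, so area
  divided by the square of the chord is constant there. Curves are merely Lipschitz, so uniqueness
  is extracted from a nonnegative defect of integral zero, which is known to vanish only almost
  everywhere.\<close>

definition lip_deriv :: "(real \<Rightarrow> real) \<Rightarrow> (real \<Rightarrow> real) \<Rightarrow> bool" where
  "lip_deriv f f' \<longleftrightarrow> (\<exists>C. C-lipschitz_on {0..1} f) \<and>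
     (AE t in lborel. t \<in> {0..1} \<longrightarrow> (f has_real_derivative f' t) (at t))"

text \<open>Bridge between the two languages in use: curves are described by \<open>AE\<close>,
  while changing an integrand under the gauge integral asks for \<open>negligible\<close>.\<close>

lemma AE_lborel_iff_negligible:
  fixes P :: "'a::euclidean_space \<Rightarrow> bool"
  shows "(AE t in lborel. P t) \<longleftrightarrow> negligible {t. \<not> P t}"
proof -
  have "(AE t in lborel. P t) \<longleftrightarrow> (AE t in lebesgue. P t)"
    by (simp add: AE_completion_iff)
  also have "\<dots> \<longleftrightarrow> negligible {t. \<not> P t}"
    unfolding eventually_ae_filter_negligible by (auto intro: negligible_subset)
  finally show ?thesis .
qed

lemma real_antiderivative:
  fixes f :: "real \<Rightarrow> real"
  assumes "continuous_on UNIV f"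
  obtains F where "\<And>x. (F has_real_derivative f x) (at x)"
proof -
  have "\<exists>F. \<forall>x. (-\<infinity>::ereal) < ereal x \<longrightarrow> ereal x < \<infinity> \<longrightarrow> (F has_vector_derivative f x) (at x)"
    by (rule einterval_antiderivative)
       (use assms in \<open>auto simp: continuous_on_eq_continuous_at\<close>)
  then show ?thesis using that
    by (auto simp: has_real_derivative_iff_has_vector_derivative)
qed

text \<open>The difference quotients of \<open>f\<close> are bounded by the Lipschitz constant and
  tend to \<open>f'\<close> almost everywhere. Their integrals are differences of difference
  quotients of an antiderivative \<open>G\<close>, which tend to values of \<open>f\<close>;
  dominated convergence identifies the two limits.\<close>

lemma lip_deriv_FTC:
  assumes f: "lip_deriv f f'" and uv: "0 \<le> u" "u \<le> v" "v \<le> 1"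
  shows "(f' has_integral (f v - f u)) {u..v}"
proof -
  obtain C where C: "C-lipschitz_on {0..1} f" using f by (auto simp: lip_deriv_def)
  \<comment> \<open>Freezing \<open>f\<close> outside the unit interval keeps the Lipschitz constant
    and makes forward quotients available at the right end.\<close>
  define g where "g t = f (max 0 (min 1 t))" for t
  have C0: "C \<ge> 0" using C by (rule lipschitz_on_nonneg)
  have g: "\<bar>g s - g t\<bar> \<le> C * \<bar>s - t\<bar>" for s t
  proof -
    have "\<bar>g s - g t\<bar> \<le> C * \<bar>max 0 (min 1 s) - max 0 (min 1 t)\<bar>"
      using lipschitz_onD[OF C, of "max 0 (min 1 s)" "max 0 (min 1 t)"] by (auto simp: g_def dist_real_def)
    also have "\<dots> \<le> C * \<bar>s - t\<bar>" by (intro mult_left_mono C0) auto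
    finally show ?thesis .
  qed
  have "C-lipschitz_on UNIV g"
    by (rule lipschitz_onI) (use g C0 in \<open>auto simp: dist_real_def\<close>)
  then have contg: "continuous_on UNIV g" by (rule lipschitz_on_continuous_on)
  obtain G where G: "\<And>x. (G has_real_derivative g x) (at x)"
    using real_antiderivative[OF contg] by blast
  define h where "h n t = real (Suc n) * (g (t + 1 / real (Suc n)) - g t)" for n t
  define H where "H n t = real (Suc n) * (G (t + 1 / real (Suc n)) - G t)" for n t
  have Hh: "(h n has_integral (H n v - H n u)) {u..v}" for n
  proof (rule fundamental_theorem_of_calculus[OF uv(2)])
    fix x
    have "(H n has_real_derivative h n x) (at x)"
      unfolding H_def h_def
      by (rule DERIV_cmult, rule DERIV_diff)
         (use G[of x] DERIV_shift[of G _ x "1 / real (Suc n)"] G[of "x + 1 / real (Suc n)"] in \<open>auto simp: \<close>)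
    then show "(H n has_vector_derivative h n x) (at x within {u..v})"
      by (meson has_real_derivative_iff_has_vector_derivative has_vector_derivative_at_within)
  qed
  have quot: "(\<lambda>n. real (Suc n) * (F (x + 1 / real (Suc n)) - F x)) \<longlonglongrightarrow> D"
    if "(F has_real_derivative D) (at x)" for F :: "real \<Rightarrow> real" and D x
  proof -
    have "((\<lambda>h. (F (x + h) - F x) / h) \<longlongrightarrow> D) (at 0)" using that by (simp add: DERIV_def)
    moreover have "filterlim (\<lambda>n. 1 / real (Suc n)) (at 0) sequentially"
      unfolding filterlim_at using LIMSEQ_Suc[OF lim_1_over_n] by auto
    ultimately have "((\<lambda>n. (F (x + 1 / real (Suc n)) - F x) / (1 / real (Suc n))) \<longlonglongrightarrow> D)"
      by (rule filterlim_compose)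
    then show ?thesis by (simp add: mult.commute)
  qed
  define N where "N = insert 0 (insert 1 {t. \<not> (t \<in> {0..1} \<longrightarrow> (f has_real_derivative f' t) (at t))})"
  have N: "negligible N" unfolding N_def negligible_insert
    using f by (simp add: AE_lborel_iff_negligible lip_deriv_def)
  have lim: "(\<lambda>n. h n t) \<longlonglongrightarrow> f' t" if t: "t \<in> {u..v} - N" for t
  proof -
    have t01: "0 < t" "t < 1" using t uv unfolding N_def by force+
    have d: "(f has_real_derivative f' t) (at t)" using t t01 by (auto simp: N_def)
    have "(g has_real_derivative f' t) (at t)"
      by (rule has_field_derivative_transform_within_open[OF d, of "{0<..<1}"]) (use t01 in \<open>auto simp: g_def\<close>)
    from quot[OF this] show ?thesis by (simp add: h_def)
  qed
  have hb: "\<bar>h n t\<bar> \<le> C" for n t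
  proof -
    have "\<bar>h n t\<bar> \<le> real (Suc n) * (C * \<bar>1 / real (Suc n)\<bar>)"
      unfolding h_def abs_mult using g[of "t + 1 / real (Suc n)" t]
      by (intro mult_mono) auto
    then show ?thesis by simp
  qed
  \<comment> \<open>Dominated convergence is applied with convergence at every point, so everything
    is set to 0 on the null set \<open>N\<close>.\<close>
  let ?h = "\<lambda>n t. if t \<in> N then 0 else h n t" and ?f = "\<lambda>t. if t \<in> N then 0 else f' t"
  have hs: "(?h n has_integral (H n v - H n u)) {u..v}" for n
    by (rule has_integral_spike[OF N _ Hh]) auto
  have 1: "?h k integrable_on {u..v}" for k using hs by (auto simp: integrable_on_def)
  have 2: "(\<lambda>_. C) integrable_on {u..v}" by (rule integrable_const_ivl)
  have 3: "norm (?h k t) \<le> C" if "t \<in> {u..v}" for k t using hb C0 by auto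
  have 4: "(\<lambda>k. ?h k t) \<longlonglongrightarrow> ?f t" if "t \<in> {u..v}" for t
    using lim[of t] that by (cases "t \<in> N") auto
  note * = dominated_convergence[of ?h "{u..v}" "\<lambda>_. C" ?f, OF 1 2 3 4]
  have "(\<lambda>k. integral {u..v} (?h k)) = (\<lambda>k. H k v - H k u)"
    using hs by (auto simp: integral_unique)
  moreover have "(\<lambda>k. H k v - H k u) \<longlonglongrightarrow> g v - g u"
    unfolding H_def by (intro tendsto_diff quot G)
  ultimately have "integral {u..v} ?f = g v - g u"
    using LIMSEQ_unique[OF *(2)] by simp
  then have I: "(?f has_integral (g v - g u)) {u..v}" using integrable_integral[OF *(1)] by simp
  have "(f' has_integral (g v - g u)) {u..v}"
    by (rule has_integral_spike[OF N _ I]) simp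
  moreover have "g v - g u = f v - f u" using uv by (simp add: g_def max_absorb2 min_absorb2)
  ultimately show ?thesis by simp
qed

lemma deriv_le_lipschitz:
  assumes "C-lipschitz_on {0..1} f" "(f has_real_derivative D) (at t)" "0 < t" "t < 1"
  shows "\<bar>D\<bar> \<le> C"
proof -
  have "((\<lambda>y. (f y - f t) / (y - t)) \<longlongrightarrow> D) (at t)"
    using assms(2) by (simp add: has_field_derivative_iff)
  then have "((\<lambda>y. \<bar>(f y - f t) / (y - t)\<bar>) \<longlongrightarrow> \<bar>D\<bar>) (at t)" by (rule tendsto_rabs)
  moreover have "\<forall>\<^sub>F y in at t. \<bar>(f y - f t) / (y - t)\<bar> \<le> C"
  proof -
    have "\<forall>\<^sub>F y in at t. y \<in> {0<..<1}"
      using assms by (intro eventually_at_in_open') auto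
    moreover have "\<forall>\<^sub>F y in at t. y \<noteq> t" by (simp add: eventually_at_filter)
    ultimately show ?thesis
    proof eventually_elim
      case (elim y)
      then show ?case
        using lipschitz_onD[OF assms(1), of y t] assms(3,4)
        by (auto simp: dist_real_def abs_divide divide_le_eq)
    qed
  qed
  ultimately show ?thesis by (rule tendsto_upperbound) simp
qed

lemma lip_deriv_AE:
  assumes "lip_deriv f f'"
  shows "AE t in lborel. t \<in> {0..1} \<longrightarrow> (f has_real_derivative f' t) (at t)"
  using assms by (simp add: lip_deriv_def)

lemma AE_interior_01: "AE t in lborel. t \<noteq> (0::real) \<and> t \<noteq> 1"
  by (simp add: AE_lborel_singleton)

lemma lip_deriv_absolutely_integrable:
  assumes f: "lip_deriv f f'"
  shows "f' absolutely_integrable_on {0..1}"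
proof -
  obtain C where C: "C-lipschitz_on {0..1} f" using f by (auto simp: lip_deriv_def)
  define N where "N = insert 0 (insert 1 {t. \<not> (t \<in> {0..1} \<longrightarrow> (f has_real_derivative f' t) (at t))})"
  have N: "negligible N" unfolding N_def negligible_insert
    using f by (simp add: AE_lborel_iff_negligible lip_deriv_def)
  let ?f = "\<lambda>t. if t \<in> N then 0 else f' t"
  have "?f absolutely_integrable_on {0..1}"
  proof (rule absolutely_integrable_integrable_bound)
    show "?f integrable_on {0..1}"
      using has_integral_spike[OF N _ lip_deriv_FTC[OF f, of 0 1], of ?f] by (auto simp: integrable_on_def)
    show "(\<lambda>_. C) integrable_on {0..1::real}" by (rule integrable_const_ivl)
    show "norm (?f t) \<le> C" if "t \<in> {0..1}" for t
      using deriv_le_lipschitz[OF C, of "f' t" t] lipschitz_on_nonneg[OF C] that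
      by (auto simp: N_def)
  qed
  then show ?thesis
    by (rule absolutely_integrable_spike[OF _ N]) auto
qed

lemma lip_deriv_continuous:
  assumes "lip_deriv f f'" shows "continuous_on {0..1} f"
  using assms lipschitz_on_continuous_on by (auto simp: lip_deriv_def)

lemma lip_deriv_const: "lip_deriv (\<lambda>_. c) (\<lambda>_. 0)"
  unfolding lip_deriv_def by (auto intro!: exI[of _ 0] lipschitz_intros)

lemma lip_deriv_add:
  assumes "lip_deriv f f'" "lip_deriv g g'"
  shows "lip_deriv (\<lambda>t. f t + g t) (\<lambda>t. f' t + g' t)"
proof -
  have "\<exists>C. C-lipschitz_on {0..1} (\<lambda>t. f t + g t)"
    using assms lipschitz_on_add unfolding lip_deriv_def by blast
  moreover have "AE t in lborel. t \<in> {0..1} \<longrightarrow> ((\<lambda>t. f t + g t) has_real_derivative f' t + g' t) (at t)"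
    using assms[THEN lip_deriv_AE] by eventually_elim (auto intro: DERIV_add)
  ultimately show ?thesis by (simp add: lip_deriv_def)
qed

lemma lip_deriv_cmult:
  assumes "lip_deriv f f'"
  shows "lip_deriv (\<lambda>t. c * f t) (\<lambda>t. c * f' t)"
proof -
  have "\<exists>C. C-lipschitz_on {0..1} (\<lambda>t. c * f t)"
    using assms lipschitz_on_cmult_real unfolding lip_deriv_def by blast
  moreover have "AE t in lborel. t \<in> {0..1} \<longrightarrow> ((\<lambda>t. c * f t) has_real_derivative c * f' t) (at t)"
    using assms[THEN lip_deriv_AE] by eventually_elim (auto intro: DERIV_cmult)
  ultimately show ?thesis by (simp add: lip_deriv_def)
qed

lemma lip_deriv_diff:
  assumes "lip_deriv f f'" "lip_deriv g g'"
  shows "lip_deriv (\<lambda>t. f t - g t) (\<lambda>t. f' t - g' t)"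
  using lip_deriv_add[OF assms(1) lip_deriv_cmult[OF assms(2), of "-1"]] by simp

lemma lip_deriv_mult:
  assumes f: "lip_deriv f f'" and g: "lip_deriv g g'"
  shows "lip_deriv (\<lambda>t. f t * g t) (\<lambda>t. f t * g' t + f' t * g t)"
proof -
  obtain C where C: "C-lipschitz_on {0..1} f" using f by (auto simp: lip_deriv_def)
  obtain D where D: "D-lipschitz_on {0..1} g" using g by (auto simp: lip_deriv_def)
  have bd: "\<exists>A. \<forall>t\<in>{0..1}. \<bar>h t\<bar> \<le> A" if "continuous_on {0..1} h" for h :: "real \<Rightarrow> real"
    using compact_imp_bounded[OF compact_continuous_image[OF that compact_Icc]] by (simp add: bounded_iff)
  obtain A B where "\<forall>t\<in>{0..1}. \<bar>f t\<bar> \<le> A" "\<forall>t\<in>{0..1}. \<bar>g t\<bar> \<le> B"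
    using bd[OF lip_deriv_continuous[OF f]] bd[OF lip_deriv_continuous[OF g]] by blast
  then have A: "\<bar>f t\<bar> \<le> A" and B: "\<bar>g t\<bar> \<le> B" if "t \<in> {0..1}" for t
    using that by blast+
  have A0: "A \<ge> 0" "B \<ge> 0" using A[of 0] B[of 0] by auto
  have "(A * D + C * B)-lipschitz_on {0..1} (\<lambda>t. f t * g t)"
  proof (rule lipschitz_onI)
    fix s t :: real assume st: "s \<in> {0..1}" "t \<in> {0..1}"
    have "f s * g s - f t * g t = f s * (g s - g t) + (f s - f t) * g t" by (simp add: algebra_simps)
    then have "\<bar>f s * g s - f t * g t\<bar> \<le> \<bar>f s\<bar> * \<bar>g s - g t\<bar> + \<bar>f s - f t\<bar> * \<bar>g t\<bar>"
      by (metis abs_mult abs_triangle_ineq)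
    also have "\<dots> \<le> A * (D * \<bar>s - t\<bar>) + (C * \<bar>s - t\<bar>) * B"
      using A[OF st(1)] B[OF st(2)] lipschitz_onD[OF C st] lipschitz_onD[OF D st] A0
        lipschitz_on_nonneg[OF C] lipschitz_on_nonneg[OF D]
      by (intro add_mono mult_mono) (auto simp: dist_real_def)
    finally show "dist (f s * g s) (f t * g t) \<le> (A * D + C * B) * dist s t"
      by (simp add: dist_real_def algebra_simps)
  qed (use A0 lipschitz_on_nonneg[OF C] lipschitz_on_nonneg[OF D] in auto)
  moreover have "AE t in lborel. t \<in> {0..1} \<longrightarrow> ((\<lambda>t. f t * g t) has_real_derivative f t * g' t + f' t * g t) (at t)"
    using f[THEN lip_deriv_AE] g[THEN lip_deriv_AE]
    by eventually_elim (auto intro: DERIV_mult')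
  ultimately show ?thesis unfolding lip_deriv_def by (intro conjI exI)
qed

text \<open>Where the derivative exists and is nonzero it is injective, and preimages of null sets
  under such maps are null.\<close>

lemma lip_deriv_level_set:
  assumes X: "lip_deriv X X'" and K: "finite K"
  shows "AE t in lborel. t \<in> {0..1} \<and> X t \<in> K \<longrightarrow> X' t = 0"
proof -
  let ?S = "{t. t \<in> {0..1} \<and> (X has_real_derivative X' t) (at t) \<and> X' t \<noteq> 0}"
  have "negligible {t \<in> ?S. X t \<in> K}"
  proof (rule negligible_differentiable_vimage[where f' = "\<lambda>t u. X' t * u"])
    show "negligible K" using K by (rule negligible_finite)
    show "inj (\<lambda>u. X' t * u)" if "t \<in> ?S" for t using that by (auto simp: inj_on_def)
    show "(X has_derivative (\<lambda>u. X' t * u)) (at t within ?S)" if "t \<in> ?S" for t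
      using that by (auto simp: has_field_derivative_def intro: has_derivative_at_withinI)
  qed
  then have "AE t in lborel. \<not> (t \<in> ?S \<and> X t \<in> K)"
    unfolding AE_lborel_iff_negligible by (rule negligible_subset) auto
  with lip_deriv_AE[OF X] show ?thesis by eventually_elim auto
qed

text \<open>The exceptional set \<open>K\<close> costs nothing: almost everywhere on \<open>{t. X t \<in> K}\<close> both sides vanish,
  so the values of \<open>\<psi>\<close> on \<open>K\<close> are irrelevant.\<close>
lemma lip_deriv_chain:
  assumes X: "lip_deriv X X'" and K: "finite K"
    and XI: "\<And>t. t \<in> {0..1} \<Longrightarrow> X t \<in> I"
    and lip: "M-lipschitz_on I \<Psi>"
    and der: "\<And>x. x \<in> I \<Longrightarrow> x \<notin> K \<Longrightarrow> (\<Psi> has_real_derivative \<psi> x) (at x)"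
  shows "lip_deriv (\<lambda>t. \<Psi> (X t)) (\<lambda>t. \<psi> (X t) * X' t)"
proof -
  obtain C where C: "C-lipschitz_on {0..1} X" using X by (auto simp: lip_deriv_def)
  have "(M * C)-lipschitz_on {0..1} (\<lambda>t. \<Psi> (X t))"
    by (rule lipschitz_on_compose2[OF C]) (rule lipschitz_on_subset[OF lip], use XI in auto)
  moreover have "AE t in lborel. t \<in> {0..1} \<longrightarrow> ((\<lambda>t. \<Psi> (X t)) has_real_derivative \<psi> (X t) * X' t) (at t)"
    using lip_deriv_AE[OF X] lip_deriv_level_set[OF X K] AE_interior_01
  proof eventually_elim
    case (elim t)
    show ?case
    proof
      assume t: "t \<in> {0..1}"
      with elim have dX: "(X has_real_derivative X' t) (at t)" by auto
      show "((\<lambda>t. \<Psi> (X t)) has_real_derivative \<psi> (X t) * X' t) (at t)"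
      proof (cases "X t \<in> K")
        case False
        then show ?thesis using DERIV_chain2[OF der dX] XI[OF t] by simp
      next
        case True
        then have 0: "X' t = 0" using elim t by auto
        have M0: "M \<ge> 0" using lip by (rule lipschitz_on_nonneg)
        have "((\<lambda>y. (X y - X t) / (y - t)) \<longlongrightarrow> 0) (at t)"
          using dX 0 by (simp add: has_field_derivative_iff)
        then have "((\<lambda>y. M * \<bar>(X y - X t) / (y - t)\<bar>) \<longlongrightarrow> M * \<bar>0\<bar>) (at t)"
          by (intro tendsto_mult tendsto_const tendsto_rabs)
        then have lim: "((\<lambda>y. M * \<bar>(X y - X t) / (y - t)\<bar>) \<longlongrightarrow> 0) (at t)"
          by simp
        have ev: "\<forall>\<^sub>F y in at t. norm ((\<Psi> (X y) - \<Psi> (X t)) / (y - t)) \<le> M * \<bar>(X y - X t) / (y - t)\<bar>"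
        proof -
          have "\<forall>\<^sub>F y in at t. y \<in> {0<..<1}"
            using t elim by (intro eventually_at_in_open') auto
          then show ?thesis
          proof eventually_elim
            case (elim y)
            then have "\<bar>\<Psi> (X y) - \<Psi> (X t)\<bar> \<le> M * \<bar>X y - X t\<bar>"
              using lipschitz_onD[OF lip, of "X y" "X t"] XI t by (auto simp: dist_real_def)
            then show ?case
              by (simp add: abs_divide divide_right_mono)
          qed
        qed
        have "((\<lambda>y. (\<Psi> (X y) - \<Psi> (X t)) / (y - t)) \<longlongrightarrow> 0) (at t)"
          using ev lim by (rule Lim_null_comparison)
        then show ?thesis using 0 by (simp add: has_field_derivative_iff)
      qed
    qed
  qed
  ultimately show ?thesis unfolding lip_deriv_def by (intro conjI exI)
qed

lemma lip_deriv_zero_const: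
  assumes f: "lip_deriv f f'" and uv: "0 \<le> u" "u \<le> v" "v \<le> 1"
    and 0: "AE t in lborel. t \<in> {u..v} \<longrightarrow> f' t = 0"
  shows "f v = f u"
proof -
  have "((\<lambda>_. 0::real) has_integral (f v - f u)) {u..v}"
    by (rule has_integral_spike[OF _ _ lip_deriv_FTC[OF f uv], of "{t. \<not> (t \<in> {u..v} \<longrightarrow> f' t = 0)}"])
       (use 0 in \<open>simp_all add: AE_lborel_iff_negligible\<close>)
  then have "f v - f u = 0" by (rule has_integral_unique) (rule has_integral_0)
  then show ?thesis by simp
qed

lemma lip_deriv_times_continuous:
  assumes X: "continuous_on {0..1} X" and y: "lip_deriv y y'"
  shows "(\<lambda>t. X t * y' t) absolutely_integrable_on {0..1}"
proof (rule absolutely_integrable_bounded_measurable_product_real)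
  show "X \<in> borel_measurable (lebesgue_on {0..1})"
    using X by (intro continuous_imp_measurable_on_sets_lebesgue) auto
  show "bounded (X ` {0..1})" using X by (auto intro!: compact_imp_bounded compact_continuous_image)
  show "y' absolutely_integrable_on {0..1}" using y by (rule lip_deriv_absolutely_integrable)
qed auto

section \<open>The norm with unit ball Q\<close>

lemma sym_polygonD:
  assumes "sym_polygon Q"
  shows "compact Q" "convex Q" "0 \<in> interior Q" "\<And>v. v \<in> Q \<Longrightarrow> - v \<in> Q"
proof -
  obtain S where S: "finite S" "Q = convex hull S" using assms by (auto simp: sym_polygon_def)
  show "compact Q" using S by (simp add: finite_imp_compact_convex_hull)
  show cv: "convex Q" using S by simp
  show sym: "\<And>v. v \<in> Q \<Longrightarrow> - v \<in> Q" using assms by (auto simp: sym_polygon_def)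
  obtain x where x: "x \<in> interior Q" using assms by (auto simp: sym_polygon_def)
  have "uminus ` Q = Q" using sym by (force simp: image_iff)
  then have "- x \<in> interior Q"
    using interior_negations[of Q] x by auto
  then have "(1/2) *\<^sub>R x + (1/2) *\<^sub>R (- x) \<in> interior Q"
    using x by (intro convexD[OF convex_interior[OF cv]]) auto
  then show "0 \<in> interior Q" by simp
qed

lemma Lnorm_set:
  assumes "t > 0"
  shows "v \<in> (\<lambda>w. t *\<^sub>R w) ` Q \<longleftrightarrow> v /\<^sub>R t \<in> (Q :: (real \<times> real) set)"
proof
  assume "v \<in> (\<lambda>w. t *\<^sub>R w) ` Q" then show "v /\<^sub>R t \<in> Q" using assms by (elim imageE) simp
next
  assume "v /\<^sub>R t \<in> Q" then show "v \<in> (\<lambda>w. t *\<^sub>R w) ` Q"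
    using assms by (intro image_eqI[of _ _ "v /\<^sub>R t"]) auto
qed

lemma Lnorm_bdd_below: "bdd_below {t. t > 0 \<and> v \<in> (\<lambda>w. t *\<^sub>R w) ` Q}"
  by (rule bdd_belowI[of _ 0]) auto

lemma Lnorm_le:
  assumes "t > 0" "v /\<^sub>R t \<in> Q" shows "Lnorm Q v \<le> t"
  unfolding Lnorm_def by (rule cInf_lower[OF _ Lnorm_bdd_below]) (use assms in \<open>simp add: Lnorm_set\<close>)

lemma scaled_mem_gauge:
  assumes "sym_polygon Q" "w \<in> Q" "0 \<le> c" "c \<le> 1" shows "c *\<^sub>R w \<in> Q"
proof -
  have "0 \<in> Q" using sym_polygonD(3)[OF assms(1)] interior_subset by blast
  then show ?thesis using convexD[OF sym_polygonD(2)[OF assms(1)], of w 0 c "1 - c"] assms by simp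
qed

lemma scaled_mem_if_norm_le:
  assumes Q: "sym_polygon Q"
  shows "\<exists>B>0. \<forall>v. \<forall>t>0. norm v \<le> B * t \<longrightarrow> v /\<^sub>R t \<in> Q"
proof -
  obtain B where B: "B > 0" "cball 0 B \<subseteq> Q"
    using sym_polygonD(3)[OF Q] by (auto simp: mem_interior_cball)
  have "v /\<^sub>R t \<in> Q" if "t > 0" "norm v \<le> B * t" for t v
    using that B(2) by (auto intro!: subsetD[OF B(2)] simp: field_simps)
  then show ?thesis using B(1) by blast
qed

text \<open>All \<open>v /\<^sub>R (L + e)\<close> with \<open>e > 0\<close> lie in
  \<open>Q\<close>, and closedness passes to \<open>e = 0\<close>. If the infimum is 0, boundedness
  of \<open>Q\<close> forces \<open>v = 0\<close>.\<close>

lemma Lnorm_attained: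
  assumes Q: "sym_polygon Q"
  shows "0 \<le> Lnorm Q v" "\<exists>w\<in>Q. v = Lnorm Q v *\<^sub>R w"
proof -
  let ?A = "{t. t > 0 \<and> v \<in> (\<lambda>w. t *\<^sub>R w) ` Q}"
  let ?L = "Lnorm Q v"
  obtain B where B: "B > 0" "\<And>v t. t > 0 \<Longrightarrow> norm v \<le> B * t \<Longrightarrow> v /\<^sub>R t \<in> Q"
    using scaled_mem_if_norm_le[OF Q] by blast
  have "(norm v + 1) / B \<in> ?A"
    using B(1) B(2)[of "(norm v + 1) / B" v] Lnorm_set[of "(norm v + 1) / B" v Q] norm_ge_zero[of v]
    by (auto simp: add_nonneg_pos)
  then have ne: "?A \<noteq> {}" by blast
  show L0: "0 \<le> ?L" unfolding Lnorm_def by (rule cInf_greatest[OF ne]) auto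
  have mem: "v /\<^sub>R (?L + e) \<in> Q" if e: "e > 0" for e
  proof -
    have "Inf ?A < ?L + e" unfolding Lnorm_def using e by simp
    then obtain t where t: "t \<in> ?A" "t < ?L + e" using cInf_lessD[OF ne] by blast
    then have tp: "t > 0" and tQ: "v /\<^sub>R t \<in> Q" using Lnorm_set[of t v Q] by simp_all
    have "(t / (?L + e)) *\<^sub>R (v /\<^sub>R t) \<in> Q"
      using tp t(2) by (intro scaled_mem_gauge[OF Q tQ]) simp_all
    moreover have "t * inverse (?L + e) * inverse t = inverse (?L + e)" using tp by simp
    ultimately show ?thesis by (simp add: divide_inverse)
  qed
  show "\<exists>w\<in>Q. v = ?L *\<^sub>R w"
  proof (cases "?L = 0")
    case True
    obtain C where C: "\<And>w. w \<in> Q \<Longrightarrow> norm w \<le> C"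
      using compact_imp_bounded[OF sym_polygonD(1)[OF Q]] by (auto simp: bounded_iff)
    have C0: "C \<ge> 0" using order_trans[OF norm_ge_zero C[OF mem[of 1]]] by simp
    have "norm v \<le> 0 + e" if e: "e > 0" for e
    proof -
      have "e / (C + 1) > 0" using e C0 by simp
      then have "norm (v /\<^sub>R (e / (C + 1))) \<le> C"
        using C[OF mem[of "e / (C + 1)"]] True by simp
      then have "norm v * ((C + 1) / e) \<le> C" using e C0 by (simp add: mult.commute)
      then have "norm v \<le> e * (C / (C + 1))" using e C0 by (simp add: field_simps)
      also have "\<dots> \<le> e * 1" using e C0 by (intro mult_left_mono) (auto simp: field_simps)
      finally show ?thesis by simp
    qed
    then have "v = 0" using field_le_epsilon[of "norm v" 0] by simp
    moreover have "0 \<in> Q" using sym_polygonD(3)[OF Q] interior_subset by blast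
    ultimately show ?thesis using True by (intro bexI[of _ 0]) simp_all
  next
    case False
    then have Lp: "?L > 0" using L0 by simp
    have "(\<lambda>n. v /\<^sub>R (?L + 1 / real (Suc n))) \<longlonglongrightarrow> v /\<^sub>R (?L + 0)"
      using Lp by (intro tendsto_intros LIMSEQ_Suc[OF lim_1_over_n]) auto
    then have lim: "(\<lambda>n. v /\<^sub>R (?L + 1 / real (Suc n))) \<longlonglongrightarrow> v /\<^sub>R ?L" by (simp only: add_0_right)
    have "v /\<^sub>R ?L \<in> Q"
      by (rule closed_sequentially[OF compact_imp_closed[OF sym_polygonD(1)[OF Q]] _ lim])
         (rule mem, simp)
    then show ?thesis using Lp by (intro bexI[of _ "v /\<^sub>R ?L"]) simp_all
  qed
qed

lemma Lnorm_scaleR_le: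
  assumes Q: "sym_polygon Q" "w \<in> Q" "t \<ge> 0" shows "Lnorm Q (t *\<^sub>R w) \<le> t"
proof -
  have "Lnorm Q (t *\<^sub>R w) \<le> t + e" if "e > 0" for e
  proof (rule Lnorm_le)
    show "(t *\<^sub>R w) /\<^sub>R (t + e) \<in> Q"
      using scaled_mem_gauge[OF Q(1,2), of "t / (t + e)"] that Q(3) by (simp add: field_simps)
  qed (use that Q(3) in auto)
  then show ?thesis by (rule field_le_epsilon)
qed

lemma Lnorm_scale_le:
  assumes Q: "sym_polygon Q" and "c \<ge> 0"
  shows "Lnorm Q (c *\<^sub>R v) \<le> c * Lnorm Q v"
proof -
  obtain w where w: "w \<in> Q" "v = Lnorm Q v *\<^sub>R w" using Lnorm_attained[OF Q] by blast
  have "Lnorm Q ((c * Lnorm Q v) *\<^sub>R w) \<le> c * Lnorm Q v"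
    using assms Lnorm_attained(1)[OF Q] by (intro Lnorm_scaleR_le w) auto
  then show ?thesis using w(2) by (metis scaleR_scaleR)
qed

lemma Lnorm_zero: assumes Q: "sym_polygon Q" shows "Lnorm Q 0 = 0"
  using Lnorm_scale_le[OF Q, of 0 0] Lnorm_attained(1)[OF Q, of 0] by simp

lemma Lnorm_scale:
  assumes Q: "sym_polygon Q" and c: "c \<ge> 0"
  shows "Lnorm Q (c *\<^sub>R v) = c * Lnorm Q v"
proof (cases "c = 0")
  case True then show ?thesis using Lnorm_zero[OF Q] by simp
next
  case False
  then have "Lnorm Q v \<le> (1 / c) * Lnorm Q (c *\<^sub>R v)"
    using Lnorm_scale_le[OF Q, of "1 / c" "c *\<^sub>R v"] c by simp
  then have "c * Lnorm Q v \<le> Lnorm Q (c *\<^sub>R v)" using False c by (simp add: field_simps)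
  then show ?thesis using Lnorm_scale_le[OF Q c] by (metis order_antisym)
qed

lemma Lnorm_minus:
  assumes Q: "sym_polygon Q" shows "Lnorm Q (- v) = Lnorm Q v"
proof -
  have *: "Lnorm Q (- v) \<le> Lnorm Q v" for v
  proof -
    obtain w where w: "w \<in> Q" "v = Lnorm Q v *\<^sub>R w" using Lnorm_attained[OF Q] by blast
    have "Lnorm Q (Lnorm Q v *\<^sub>R (- w)) \<le> Lnorm Q v"
      by (intro Lnorm_scaleR_le Q sym_polygonD(4)[OF Q] w Lnorm_attained)
    then show ?thesis using w(2) by (metis scaleR_minus_right)
  qed
  show ?thesis using *[of v] *[of "- v"] by simp
qed

lemma Lnorm_triangle:
  assumes Q: "sym_polygon Q" shows "Lnorm Q (u + v) \<le> Lnorm Q u + Lnorm Q v"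
proof -
  obtain w where w: "w \<in> Q" "u = Lnorm Q u *\<^sub>R w" using Lnorm_attained[OF Q] by blast
  obtain x where x: "x \<in> Q" "v = Lnorm Q v *\<^sub>R x" using Lnorm_attained[OF Q] by blast
  let ?a = "Lnorm Q u" and ?b = "Lnorm Q v"
  have ab: "?a \<ge> 0" "?b \<ge> 0" using Lnorm_attained(1)[OF Q] by auto
  show ?thesis
  proof (cases "?a + ?b = 0")
    case True
    then have "?a = 0" "?b = 0" using ab by auto
    then show ?thesis using w x Lnorm_zero[OF Q] by simp
  next
    case False
    have "(?a / (?a + ?b)) *\<^sub>R w + (?b / (?a + ?b)) *\<^sub>R x \<in> Q"
      using False ab by (intro convexD[OF sym_polygonD(2)[OF Q]] w x) (auto simp: add_divide_distrib[symmetric])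
    then have "Lnorm Q ((?a + ?b) *\<^sub>R ((?a / (?a + ?b)) *\<^sub>R w + (?b / (?a + ?b)) *\<^sub>R x)) \<le> ?a + ?b"
      using ab by (intro Lnorm_scaleR_le Q) auto
    also have "(?a + ?b) *\<^sub>R ((?a / (?a + ?b)) *\<^sub>R w + (?b / (?a + ?b)) *\<^sub>R x) = ?a *\<^sub>R w + ?b *\<^sub>R x"
      using False by (simp add: scaleR_add_right)
    finally show ?thesis using w(2) x(2) by simp
  qed
qed

lemma Lnorm_continuous:
  assumes Q: "sym_polygon Q" shows "continuous_on UNIV (Lnorm Q)"
proof -
  obtain B where B: "B > 0" "\<And>v t. t > 0 \<Longrightarrow> norm v \<le> B * t \<Longrightarrow> v /\<^sub>R t \<in> Q"
    using scaled_mem_if_norm_le[OF Q] by blast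
  have le: "Lnorm Q v \<le> (1 / B) * norm v" for v
  proof (cases "v = 0")
    case False
    then show ?thesis using B(1) B(2)[of "1 / B * norm v" v] by (intro Lnorm_le) simp_all
  qed (simp add: Lnorm_zero[OF Q])
  have "Lnorm Q u - Lnorm Q v \<le> (1 / B) * norm (u - v)" for u v
    using Lnorm_triangle[OF Q, of "u - v" v] le[of "u - v"] by simp
  then have "\<bar>Lnorm Q u - Lnorm Q v\<bar> \<le> (1 / B) * norm (u - v)" for u v
    by (smt (verit) norm_minus_commute)
  then have "(1 / B)-lipschitz_on UNIV (Lnorm Q)"
    using B(1) by (intro lipschitz_onI) (auto simp: dist_norm)
  then show ?thesis by (rule lipschitz_on_continuous_on)
qed

text \<open>The open sublevel set lies in \<open>Q\<close>; conversely an interior point stays in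
  \<open>Q\<close> after stretching by some factor above 1.\<close>

lemma Lnorm_less_1_iff:
  assumes Q: "sym_polygon Q" shows "Lnorm Q v < 1 \<longleftrightarrow> v \<in> interior Q"
proof
  assume L: "Lnorm Q v < 1"
  have "Lnorm Q -` {..<1} \<subseteq> Q"
  proof
    fix u assume u: "u \<in> Lnorm Q -` {..<1}"
    obtain w where w: "w \<in> Q" "u = Lnorm Q u *\<^sub>R w" using Lnorm_attained[OF Q] by blast
    have "Lnorm Q u *\<^sub>R w \<in> Q"
      using u Lnorm_attained(1)[OF Q] by (intro scaled_mem_gauge[OF Q w(1)]) auto
    then show "u \<in> Q" using w(2) by simp
  qed
  moreover have "open (Lnorm Q -` {..<1})"
    by (rule open_vimage[OF open_lessThan Lnorm_continuous[OF Q]])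
  ultimately show "v \<in> interior Q" using L by (auto intro: interiorI)
next
  assume "v \<in> interior Q"
  then obtain e where e: "e > 0" "cball v e \<subseteq> Q" by (auto simp: mem_interior_cball)
  show "Lnorm Q v < 1"
  proof (cases "v = 0")
    case False
    let ?t = "1 + e / norm v"
    have t: "?t > 1" using e False by simp
    have "?t *\<^sub>R v \<in> cball v e" using False e
      by (simp add: dist_norm scaleR_left_distrib)
    then have "?t *\<^sub>R v \<in> Q" using e by blast
    then have "Lnorm Q (1 *\<^sub>R (?t *\<^sub>R v)) \<le> 1" by (intro Lnorm_scaleR_le Q) auto
    then have "?t * Lnorm Q v \<le> 1" using Lnorm_scale[OF Q, of ?t v] t by simp
    then have "Lnorm Q v \<le> 1 / ?t" using t by (simp add: field_simps)
    also have "1 / ?t < 1" using t by simp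
    finally show ?thesis .
  qed (simp add: Lnorm_zero[OF Q])
qed

lemma Lnorm_ge_linear:
  assumes Q: "sym_polygon Q" and l: "linear l" and le: "\<And>w. w \<in> Q \<Longrightarrow> l w \<le> (1::real)"
  shows "l v \<le> Lnorm Q v"
proof -
  obtain w where w: "w \<in> Q" "v = Lnorm Q v *\<^sub>R w" using Lnorm_attained[OF Q] by blast
  have "l v = Lnorm Q v * l w"
    using arg_cong[OF w(2), of l] by (simp only: linear_scale[OF l] real_scaleR_def)
  also have "\<dots> \<le> Lnorm Q v * 1" using le[OF w(1)] Lnorm_attained(1)[OF Q] by (intro mult_left_mono) auto
  finally show ?thesis by simp
qed

lemma Lnorm_linear_image:
  assumes "linear T" "inj T" shows "Lnorm (T ` Q) (T v) = Lnorm Q v"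
proof -
  have "T v \<in> (\<lambda>w. t *\<^sub>R w) ` (T ` Q) \<longleftrightarrow> v \<in> (\<lambda>w. t *\<^sub>R w) ` Q" for t
  proof -
    have "(\<lambda>w. t *\<^sub>R w) ` (T ` Q) = T ` ((\<lambda>w. t *\<^sub>R w) ` Q)"
      by (simp only: image_image linear_scale[OF assms(1)])
    then show ?thesis by (simp only: inj_image_mem_iff[OF assms(2)])
  qed
  then show ?thesis by (simp only: Lnorm_def)
qed

lemma sym_polygon_linear_image:
  assumes "linear T" "inj T" "sym_polygon Q" shows "sym_polygon (T ` Q)"
proof -
  obtain S where S: "finite S" "Q = convex hull S" using assms by (auto simp: sym_polygon_def)
  have "T ` Q = convex hull (T ` S)" using S convex_hull_linear_image[OF assms(1), of S] by simp
  moreover have "interior (T ` Q) \<noteq> {}"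
    using interior_injective_linear_image[OF assms(1,2), of Q] assms(3) by (simp add: sym_polygon_def)
  moreover have "\<forall>v\<in>T ` Q. - v \<in> T ` Q"
    using sym_polygonD(4)[OF assms(3)] linear_neg[OF assms(1)] by (metis (no_types, lifting) image_iff)
  ultimately show ?thesis using S(1) unfolding sym_polygon_def by blast
qed

section \<open>Curves in the Heisenberg group and linear automorphisms\<close>

text \<open>\<open>hlin a b c d\<close> lifts the plane map with matrix \<open>((a, b), (c, d))\<close> to an automorphism.\<close>
definition hlin :: "real \<Rightarrow> real \<Rightarrow> real \<Rightarrow> real \<Rightarrow> heis \<Rightarrow> heis" where
  "hlin a b c d p = (a * fst p + b * fst (snd p), c * fst p + d * fst (snd p),
     (a * d - b * c) * snd (snd p))"

definition plin :: "real \<Rightarrow> real \<Rightarrow> real \<Rightarrow> real \<Rightarrow> real \<times> real \<Rightarrow> real \<times> real" where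
  "plin a b c d v = (a * fst v + b * snd v, c * fst v + d * snd v)"

lemma bounded_linear_hlin: "bounded_linear (hlin a b c d)"
  by (rule linear_conv_bounded_linear[THEN iffD1])
     (rule linearI; simp add: hlin_def algebra_simps)

lemma linear_plin: "linear (plin a b c d)"
  by (rule linearI; simp add: plin_def algebra_simps)

lemma plin_inverse:
  assumes "a * d - b * c = D" "D \<noteq> 0"
  shows "plin (d / D) (- b / D) (- c / D) (a / D) (plin a b c d v) = v"
    and "plin a b c d (plin (d / D) (- b / D) (- c / D) (a / D) v) = v"
  using assms by (cases v; simp add: plin_def field_simps; algebra)+

lemma det_inverse:
  fixes a b c d D :: real
  assumes "a * d - b * c = D" "D \<noteq> 0"
  shows "(d / D) * (a / D) - (- b / D) * (- c / D) = 1 / D"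
proof -
  have "(d / D) * (a / D) - (- b / D) * (- c / D) = (a * d - b * c) / (D * D)"
    by (simp add: diff_divide_distrib mult.commute)
  then show ?thesis using assms by simp
qed

lemma hlin_inverse:
  assumes "a * d - b * c = D" "D \<noteq> 0"
  shows "hlin (d / D) (- b / D) (- c / D) (a / D) (hlin a b c d p) = p"
    and "hlin a b c d (hlin (d / D) (- b / D) (- c / D) (a / D) p) = p"
proof -
  note E = det_inverse[OF assms]
  obtain x y z where p: "p = (x, y, z)" by (cases p)
  have 1: "((d / D) * (a / D) - (- b / D) * (- c / D)) * ((a * d - b * c) * z) = z"
    and 2: "(a * d - b * c) * (((d / D) * (a / D) - (- b / D) * (- c / D)) * z) = z"
    unfolding E assms(1) using assms(2) by simp_all
  show "hlin (d / D) (- b / D) (- c / D) (a / D) (hlin a b c d p) = p"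
    using plin_inverse(1)[OF assms, of "(x, y)"]
    by (simp only: p hlin_def plin_def fst_conv snd_conv prod.inject 1 simp_thms)
  show "hlin a b c d (hlin (d / D) (- b / D) (- c / D) (a / D) p) = p"
    using plin_inverse(2)[OF assms, of "(x, y)"]
    by (simp only: p hlin_def plin_def fst_conv snd_conv prod.inject 2 simp_thms)
qed

lemma hproj_hlin: "hproj (hlin a b c d p) = plin a b c d (hproj p)"
  by (simp add: hproj_def hlin_def plin_def)

definition horizontal_at :: "(real \<Rightarrow> heis) \<Rightarrow> real \<Rightarrow> bool" where
  "horizontal_at \<gamma> t \<longleftrightarrow> \<gamma> differentiable at t \<and>
         snd (snd (vector_derivative \<gamma> (at t))) =
           1/2 * (fst (\<gamma> t) * fst (snd (vector_derivative \<gamma> (at t)))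
                  - fst (snd (\<gamma> t)) * fst (vector_derivative \<gamma> (at t)))"

lemma admissible_iff:
  "admissible \<gamma> \<longleftrightarrow> (\<exists>C. C-lipschitz_on {0..1} \<gamma>) \<and> (AE t in lborel. t \<in> {0..1} \<longrightarrow> horizontal_at \<gamma> t)"
  by (simp add: admissible_def horizontal_at_def)

lemma vector_derivative_hlin:
  assumes "\<gamma> differentiable at t"
  shows "vector_derivative (\<lambda>t. hlin a b c d (\<gamma> t)) (at t) = hlin a b c d (vector_derivative \<gamma> (at t))"
    and "(\<lambda>t. hlin a b c d (\<gamma> t)) differentiable at t"
proof -
  have "(\<gamma> has_vector_derivative vector_derivative \<gamma> (at t)) (at t)"
    using assms by (rule vector_derivative_works[THEN iffD1])
  then have *: "((\<lambda>t. hlin a b c d (\<gamma> t)) has_vector_derivative hlin a b c d (vector_derivative \<gamma> (at t))) (at t)"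
    by (rule bounded_linear.has_vector_derivative[OF bounded_linear_hlin])
  show "vector_derivative (\<lambda>t. hlin a b c d (\<gamma> t)) (at t) = hlin a b c d (vector_derivative \<gamma> (at t))"
    using * by (rule vector_derivative_at)
  show "(\<lambda>t. hlin a b c d (\<gamma> t)) differentiable at t"
    using * by (rule differentiableI_vector)
qed

lemma admissible_hlin:
  assumes "admissible \<gamma>" shows "admissible (\<lambda>t. hlin a b c d (\<gamma> t))"
  unfolding admissible_iff
proof
  obtain C where C: "C-lipschitz_on {0..1} \<gamma>" using assms by (auto simp: admissible_iff)
  obtain B where B: "B-lipschitz_on (\<gamma> ` {0..1}) (hlin a b c d)"
    using bounded_linear.lipschitz_boundE[OF bounded_linear_hlin] by blast
  show "\<exists>C. C-lipschitz_on {0..1} (\<lambda>t. hlin a b c d (\<gamma> t))"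
    using lipschitz_on_compose2[OF C B] by blast
  have "AE t in lborel. t \<in> {0..1} \<longrightarrow> horizontal_at \<gamma> t" using assms by (simp add: admissible_iff)
  then show "AE t in lborel. t \<in> {0..1} \<longrightarrow> horizontal_at (\<lambda>t. hlin a b c d (\<gamma> t)) t"
  proof eventually_elim
    case (elim t)
    show ?case
    proof
      assume "t \<in> {0..1}"
      then have h: "horizontal_at \<gamma> t" using elim by blast
      then have df: "\<gamma> differentiable at t" by (simp add: horizontal_at_def)
      obtain x y z where g: "\<gamma> t = (x, y, z)" by (cases "\<gamma> t")
      obtain x' y' z' where v: "vector_derivative \<gamma> (at t) = (x', y', z')"
        by (cases "vector_derivative \<gamma> (at t)")
      have z: "z' = 1/2 * (x * y' - y * x')" using h g v by (simp add: horizontal_at_def)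
      have "(a * d - b * c) * z' =
          1/2 * ((a * x + b * y) * (c * x' + d * y') - (c * x + d * y) * (a * x' + b * y'))"
        unfolding z by (simp add: field_simps)
      then show "horizontal_at (\<lambda>t. hlin a b c d (\<gamma> t)) t"
        unfolding horizontal_at_def vector_derivative_hlin(1)[OF df] v g
        using vector_derivative_hlin(2)[OF df] by (simp add: hlin_def)
    qed
  qed
qed

lemma admissible_differentiable:
  assumes "admissible \<gamma>" shows "AE t in lborel. t \<in> {0..1} \<longrightarrow> \<gamma> differentiable at t"
proof -
  have "AE t in lborel. t \<in> {0..1} \<longrightarrow> horizontal_at \<gamma> t" using assms by (simp add: admissible_iff)
  then show ?thesis by eventually_elim (simp add: horizontal_at_def)
qed

lemma Lnorm_velocity_hlin:
  assumes "admissible \<gamma>" and N: "\<And>v. Lnorm Q' (plin a b c d v) = k * Lnorm Q v"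
  shows "AE t in lborel. t \<in> {0..1} \<longrightarrow>
    Lnorm Q' (hproj (vector_derivative (\<lambda>t. hlin a b c d (\<gamma> t)) (at t)))
      = k * Lnorm Q (hproj (vector_derivative \<gamma> (at t)))"
  using admissible_differentiable[OF assms(1)]
  by eventually_elim (simp add: vector_derivative_hlin hproj_hlin N)

lemma cc_length_hlin:
  assumes "admissible \<gamma>" and N: "\<And>v. Lnorm Q' (plin a b c d v) = k * Lnorm Q v"
  shows "cc_length Q' (\<lambda>t. hlin a b c d (\<gamma> t)) = k * cc_length Q \<gamma>"
proof -
  let ?P = "\<lambda>t. t \<in> {0..1} \<longrightarrow>
    Lnorm Q' (hproj (vector_derivative (\<lambda>t. hlin a b c d (\<gamma> t)) (at t)))
      = k * Lnorm Q (hproj (vector_derivative \<gamma> (at t)))"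
  have "negligible {t. \<not> ?P t}"
    using Lnorm_velocity_hlin[OF assms] by (simp only: AE_lborel_iff_negligible)
  then have "cc_length Q' (\<lambda>t. hlin a b c d (\<gamma> t))
      = integral {0..1} (\<lambda>t. k * Lnorm Q (hproj (vector_derivative \<gamma> (at t))))"
    unfolding cc_length_def by (rule integral_spike) simp
  then show ?thesis unfolding cc_length_def by (simp only: integral_mult_right)
qed

section \<open>Three-segment curves, existence of admissible curves, bounds for the distance\<close>

definition cross2 :: "real \<times> real \<Rightarrow> real \<times> real \<Rightarrow> real" where
  "cross2 u v = fst u * snd v - snd u * fst v"

definition three_seg :: "real \<Rightarrow> real \<Rightarrow> heis \<Rightarrow> heis \<Rightarrow> heis \<Rightarrow> real \<Rightarrow> heis" where
  "three_seg t1 t2 V1 V2 V3 t =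
     min t t1 *\<^sub>R V1 + (max t1 (min t t2) - t1) *\<^sub>R V2 + (max t t2 - t2) *\<^sub>R V3"

lemma three_seg_deriv:
  assumes "t1 \<le> t2" "t \<noteq> t1" "t \<noteq> t2"
  shows "(three_seg t1 t2 V1 V2 V3 has_vector_derivative
           (if t < t1 then V1 else if t < t2 then V2 else V3)) (at t)"
proof -
  consider "t < t1" | "t1 < t" "t < t2" | "t2 < t" using assms by linarith
  then show ?thesis
  proof cases
    case 1
    have "((\<lambda>s. s *\<^sub>R V1) has_vector_derivative V1) (at t)" by (auto intro!: derivative_eq_intros)
    then have "(three_seg t1 t2 V1 V2 V3 has_vector_derivative V1) (at t)"
      by (rule has_vector_derivative_transform_within_open[of _ _ _ "{..<t1}"])
         (use 1 assms in \<open>auto simp: three_seg_def max_absorb1 max_absorb2 min_absorb1\<close>)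
    then show ?thesis using 1 by simp
  next
    case 2
    have "((\<lambda>s. t1 *\<^sub>R V1 + (s - t1) *\<^sub>R V2) has_vector_derivative V2) (at t)"
      by (auto intro!: derivative_eq_intros)
    then have "(three_seg t1 t2 V1 V2 V3 has_vector_derivative V2) (at t)"
      by (rule has_vector_derivative_transform_within_open[of _ _ _ "{t1<..<t2}"])
         (use 2 assms in \<open>auto simp: three_seg_def\<close>)
    then show ?thesis using 2 by simp
  next
    case 3
    have "((\<lambda>s. t1 *\<^sub>R V1 + (t2 - t1) *\<^sub>R V2 + (s - t2) *\<^sub>R V3) has_vector_derivative V3) (at t)"
      by (auto intro!: derivative_eq_intros)
    then have "(three_seg t1 t2 V1 V2 V3 has_vector_derivative V3) (at t)"
      by (rule has_vector_derivative_transform_within_open[of _ _ _ "{t2<..}"])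
         (use 3 assms in \<open>auto simp: three_seg_def\<close>)
    then show ?thesis using 3 assms by simp
  qed
qed

lemma AE_neq2: "AE t in lborel. t \<noteq> (t1::real) \<and> t \<noteq> t2"
  by (simp add: AE_lborel_singleton)

lemma three_seg_lipschitz: "\<exists>C. C-lipschitz_on {0..1} (three_seg t1 t2 V1 V2 V3)"
proof -
  have 1: "1-lipschitz_on {0..1} (\<lambda>t::real. min t t1)"
   and 2: "1-lipschitz_on {0..1} (\<lambda>t::real. max t1 (min t t2) - t1)"
   and 3: "1-lipschitz_on {0..1} (\<lambda>t::real. max t t2 - t2)"
    by (rule lipschitz_onI; simp add: dist_real_def; linarith)+
  have s: "(norm V * 1)-lipschitz_on {0..1} (\<lambda>t. r t *\<^sub>R V)" if "1-lipschitz_on {0..1} r" for r :: "real \<Rightarrow> real" and V :: heis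
  proof (rule lipschitz_onI)
    fix x y :: real assume "x \<in> {0..1}" "y \<in> {0..1}"
    then have "\<bar>r x - r y\<bar> \<le> \<bar>x - y\<bar>" using lipschitz_onD[OF that, of x y] by (simp add: dist_real_def)
    then have "norm V * \<bar>r x - r y\<bar> \<le> norm V * \<bar>x - y\<bar>" by (intro mult_left_mono) auto
    then show "dist (r x *\<^sub>R V) (r y *\<^sub>R V) \<le> norm V * 1 * dist x y"
      by (simp add: dist_norm dist_real_def scaleR_left_diff_distrib[symmetric] mult.commute del: scaleR_left_diff_distrib)
  qed simp
  show ?thesis unfolding three_seg_def
    using lipschitz_on_add[OF lipschitz_on_add[OF s[OF 1] s[OF 2]] s[OF 3]] by blast
qed

text \<open>Along a straight planar segment the height grows at the constant rate of half the cross
  product of the starting point with the velocity, so the lift of a polygonal path is polygonal. The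
  starting points of the later segments are \<open>t1 u\<close> and
  \<open>t1 u + (t2 - t1) v\<close>.\<close>

lemma three_seg_admissible:
  assumes t: "0 \<le> t1" "t1 \<le> t2"
    and V1: "V1 = (fst u, snd u, 0)"
    and V2: "V2 = (fst v, snd v, t1 / 2 * cross2 u v)"
    and V3: "V3 = (fst w, snd w, t1 / 2 * cross2 u w + (t2 - t1) / 2 * cross2 v w)"
  shows "admissible (three_seg t1 t2 V1 V2 V3)"
  unfolding admissible_iff
proof
  show "AE t in lborel. t \<in> {0..1} \<longrightarrow> horizontal_at (three_seg t1 t2 V1 V2 V3) t"
    using AE_neq2[of t1 t2]
  proof eventually_elim
    case (elim x)
    then have d: "(three_seg t1 t2 V1 V2 V3 has_vector_derivative
           (if x < t1 then V1 else if x < t2 then V2 else V3)) (at x)"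
      using three_seg_deriv t by blast
    consider "x < t1" | "t1 < x" "x < t2" | "t2 < x" using elim by linarith
    then show ?case
      unfolding horizontal_at_def vector_derivative_at[OF d]
      using differentiableI_vector[OF d] t
      by cases (auto simp: three_seg_def V1 V2 V3 cross2_def field_simps max_absorb1 max_absorb2 min_absorb1 min_absorb2)
  qed
qed (rule three_seg_lipschitz)

lemma three_seg_speed:
  assumes t: "t1 \<le> t2" and "Lnorm Q (hproj V1) = l" "Lnorm Q (hproj V2) = l" "Lnorm Q (hproj V3) = l"
  shows "AE t in lborel. t \<in> {0..1} \<longrightarrow>
      Lnorm Q (hproj (vector_derivative (three_seg t1 t2 V1 V2 V3) (at t))) = l"
  using AE_neq2[of t1 t2]
proof eventually_elim
  case (elim x)
  then have d: "(three_seg t1 t2 V1 V2 V3 has_vector_derivative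
         (if x < t1 then V1 else if x < t2 then V2 else V3)) (at x)"
    using three_seg_deriv t by blast
  show ?case unfolding vector_derivative_at[OF d] using assms by auto
qed

lemma cc_length_const_speed:
  assumes "AE t in lborel. t \<in> {0..1} \<longrightarrow> Lnorm Q (hproj (vector_derivative \<gamma> (at t))) = l"
  shows "cc_length Q \<gamma> = l"
proof -
  let ?P = "\<lambda>t. t \<in> {0..1} \<longrightarrow> Lnorm Q (hproj (vector_derivative \<gamma> (at t))) = l"
  have "negligible {t. \<not> ?P t}" using assms by (simp only: AE_lborel_iff_negligible)
  then have "cc_length Q \<gamma> = integral {0..1::real} (\<lambda>t. l)"
    unfolding cc_length_def by (rule integral_spike) simp
  then show ?thesis by simp
qed

text \<open>Lower bounds for the lengths of all curves pass to the infimum \<open>dCC\<close>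
  because the set of lengths is nonempty.\<close>

lemma admissible_curve_exists:
  "\<exists>\<gamma>. admissible \<gamma> \<and> \<gamma> 0 = hzero \<and> \<gamma> 1 = x"
proof -
  obtain p q z where x: "x = (p, q, z)" by (cases x)
  \<comment> \<open>The path runs through \<open>(s, 0)\<close> and \<open>(s, 1 - q)\<close> to
    \<open>(p, q)\<close>. The ordinate \<open>1 - q\<close> makes twice the final height equal to
    \<open>s - (1 - q) * p\<close>, which is solvable in \<open>s\<close> for every target.\<close>
  define s where "s = 2 * z + (1 - q) * p"
  let ?u = "(3 * s, 0)" and ?v = "(0, 3 * (1 - q))" and ?w = "(3 * (p - s), 3 * (2 * q - 1))"
  let ?V1 = "(3 * s, 0, 0) :: heis"
    and ?V2 = "(0, 3 * (1 - q), (1/3) / 2 * cross2 ?u ?v) :: heis"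
    and ?V3 = "(3 * (p - s), 3 * (2 * q - 1), (1/3) / 2 * cross2 ?u ?w + (2/3 - 1/3) / 2 * cross2 ?v ?w) :: heis"
  have "admissible (three_seg (1/3) (2/3) ?V1 ?V2 ?V3)"
    by (rule three_seg_admissible[of _ _ _ ?u _ ?v _ ?w]) auto
  moreover have "three_seg (1/3) (2/3) ?V1 ?V2 ?V3 0 = hzero"
    by (simp add: three_seg_def hzero_def)
  moreover have "three_seg (1/3) (2/3) ?V1 ?V2 ?V3 1 = x"
    by (simp add: three_seg_def x cross2_def s_def field_simps)
  ultimately show ?thesis by blast
qed

lemma cc_length_nonneg:
  assumes "sym_polygon Q" shows "0 \<le> cc_length Q \<gamma>"
proof (cases "(\<lambda>t. Lnorm Q (hproj (vector_derivative \<gamma> (at t)))) integrable_on {0..1}")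
  case True
  then show ?thesis unfolding cc_length_def
    by (rule integral_nonneg) (rule Lnorm_attained(1)[OF assms])
next
  case False then show ?thesis unfolding cc_length_def by (simp add: not_integrable_integral)
qed

lemma dCC_le:
  assumes "sym_polygon Q" "admissible \<gamma>" "\<gamma> 0 = p" "\<gamma> 1 = q"
  shows "dCC Q p q \<le> cc_length Q \<gamma>"
  unfolding dCC_def
  by (rule cInf_lower) (use assms cc_length_nonneg[OF assms(1)] in \<open>auto intro!: bdd_belowI[of _ 0]\<close>)

lemma dCC_ge:
  assumes "\<And>\<gamma>. admissible \<gamma> \<Longrightarrow> \<gamma> 0 = hzero \<Longrightarrow> \<gamma> 1 = x \<Longrightarrow> l \<le> cc_length Q \<gamma>"
  shows "l \<le> dCC Q hzero x"
  unfolding dCC_def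
  by (rule cInf_greatest) (use admissible_curve_exists[of x] assms in auto)

section \<open>Transport of distance and geodesics along automorphisms\<close>

lemma hlin_zero: "hlin a b c d hzero = hzero"
  by (simp add: hlin_def hzero_def)

text \<open>\<open>Q' = T ` Q\<close> with \<open>k = 1\<close> gives changes of coordinates, \<open>Q' = Q\<close> with \<open>T v = k *\<^sub>R v\<close> gives dilations.\<close>
locale heis_equiv =
  fixes a b c d k :: real and Q Q' :: "(real \<times> real) set"
  assumes det: "a * d - b * c \<noteq> 0" and k: "k > 0" and Q: "sym_polygon Q" and Q': "sym_polygon Q'"
    and N: "\<And>v. Lnorm Q' (plin a b c d v) = k * Lnorm Q v"
begin

abbreviation (input) "ja \<equiv> d / (a * d - b * c)"
abbreviation (input) "jb \<equiv> - b / (a * d - b * c)"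
abbreviation (input) "jc \<equiv> - c / (a * d - b * c)"
abbreviation (input) "jd \<equiv> a / (a * d - b * c)"

lemma inverse_equiv: "heis_equiv ja jb jc jd (1 / k) Q' Q"
proof
  let ?D = "a * d - b * c"
  have "ja * jd - jb * jc = 1 / ?D" using det_inverse[OF refl det] .
  then show "ja * jd - jb * jc \<noteq> 0" using det by simp
  show "Lnorm Q (plin ja jb jc jd v) = 1 / k * Lnorm Q' v" for v
    using N[of "plin ja jb jc jd v"] k
    unfolding plin_inverse(2)[OF refl det] by (simp add: field_simps)
qed (use k Q Q' in simp_all)

lemma dCC_le_scaled: "dCC Q' hzero (hlin a b c d x) \<le> k * dCC Q hzero x"
proof -
  have "dCC Q' hzero (hlin a b c d x) / k \<le> cc_length Q \<gamma>"
    if g: "admissible \<gamma>" "\<gamma> 0 = hzero" "\<gamma> 1 = x" for \<gamma>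
  proof -
    have "dCC Q' hzero (hlin a b c d x) \<le> cc_length Q' (\<lambda>t. hlin a b c d (\<gamma> t))"
      by (rule dCC_le[OF Q' admissible_hlin[OF g(1)]]) (simp_all add: g hlin_zero)
    then show ?thesis unfolding cc_length_hlin[OF g(1) N] using k by (simp add: field_simps)
  qed
  then have "dCC Q' hzero (hlin a b c d x) / k \<le> dCC Q hzero x" by (rule dCC_ge)
  then show ?thesis using k by (simp add: field_simps)
qed

end

context heis_equiv begin

interpretation inv: heis_equiv ja jb jc jd "1 / k" Q' Q by (rule inverse_equiv)

text \<open>The missing inequality is \<open>dCC_le_scaled\<close> for the inverse automorphism, an
  instance of the same locale with factor \<open>1 / k\<close>.\<close>

lemma dCC_equiv: "dCC Q' hzero (hlin a b c d x) = k * dCC Q hzero x"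
proof (rule antisym[OF dCC_le_scaled])
  show "k * dCC Q hzero x \<le> dCC Q' hzero (hlin a b c d x)"
    using inv.dCC_le_scaled[of "hlin a b c d x"] k
    unfolding hlin_inverse(1)[OF refl det] by (simp add: field_simps)
qed

lemma cc_geodesic_hlin:
  assumes "cc_geodesic Q hzero x \<gamma>"
  shows "cc_geodesic Q' hzero (hlin a b c d x) (\<lambda>t. hlin a b c d (\<gamma> t))"
proof -
  have g: "admissible \<gamma>" "\<gamma> 0 = hzero" "\<gamma> 1 = x" "cc_length Q \<gamma> = dCC Q hzero x"
    and sp: "AE t in lborel. t \<in> {0..1} \<longrightarrow> Lnorm Q (hproj (vector_derivative \<gamma> (at t))) = dCC Q hzero x"
    using assms by (auto simp: cc_geodesic_def)
  have "AE t in lborel. t \<in> {0..1} \<longrightarrow>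
     Lnorm Q' (hproj (vector_derivative (\<lambda>t. hlin a b c d (\<gamma> t)) (at t))) = dCC Q' hzero (hlin a b c d x)"
    using sp Lnorm_velocity_hlin[OF g(1) N] by eventually_elim (simp add: dCC_equiv)
  then show ?thesis unfolding cc_geodesic_def
    using g admissible_hlin[OF g(1)] cc_length_hlin[OF g(1) N] by (simp add: dCC_equiv hlin_zero)
qed

end

context heis_equiv begin

interpretation inv: heis_equiv ja jb jc jd "1 / k" Q' Q by (rule inverse_equiv)

lemma unique_geodesic_hlin:
  assumes "unique_geodesic Q hzero x"
  shows "unique_geodesic Q' hzero (hlin a b c d x)"
proof -
  obtain \<gamma> where g: "cc_geodesic Q hzero x \<gamma>"
    and u: "\<And>\<eta>. cc_geodesic Q hzero x \<eta> \<Longrightarrow> \<forall>t\<in>{0..1}. \<eta> t = \<gamma> t"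
    using assms by (auto simp: unique_geodesic_def)
  show ?thesis unfolding unique_geodesic_def
  proof (intro exI conjI allI impI)
    show "cc_geodesic Q' hzero (hlin a b c d x) (\<lambda>t. hlin a b c d (\<gamma> t))"
      using g by (rule cc_geodesic_hlin)
    fix \<eta> assume "cc_geodesic Q' hzero (hlin a b c d x) \<eta>"
    then have "cc_geodesic Q hzero x (\<lambda>t. hlin ja jb jc jd (\<eta> t))"
      using inv.cc_geodesic_hlin[of "hlin a b c d x" \<eta>] unfolding hlin_inverse(1)[OF refl det] by blast
    then have "\<forall>t\<in>{0..1}. hlin ja jb jc jd (\<eta> t) = \<gamma> t" by (rule u)
    then show "\<forall>t\<in>{0..1}. \<eta> t = hlin a b c d (\<gamma> t)"
      using hlin_inverse(2)[OF refl det] by metis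
  qed
qed

end

context heis_equiv begin

interpretation inv: heis_equiv ja jb jc jd "1 / k" Q' Q by (rule inverse_equiv)

lemma unique_geodesic_equiv:
  "unique_geodesic Q' hzero (hlin a b c d x) \<longleftrightarrow> unique_geodesic Q hzero x"
  using unique_geodesic_hlin[of x] inv.unique_geodesic_hlin[of "hlin a b c d x"]
  unfolding hlin_inverse(1)[OF refl det] by blast

end

lemma heis_equiv_dilation:
  assumes Q: "sym_polygon Q" and t: "t > 0" shows "heis_equiv t 0 0 t t Q Q"
proof
  show "Lnorm Q (plin t 0 0 t v) = t * Lnorm Q v" for v
    using Lnorm_scale[OF Q, of t v] t by (simp add: plin_def scaleR_prod_def)
qed (use assms in auto)

section \<open>The boundary of the isoperimetrix as a graph over a line\<close>

text \<open>\<open>S\<close> is a symmetric generating set that may contain 0 and points that are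
  not vertices, hence the exception for \<open>s = 0\<close>. The last assumption keeps the edges of
  the isoperimetrix from being vertical.\<close>

locale vertical_polygon =
  fixes S Q :: "(real \<times> real) set"
  assumes finS: "finite S" and QS: "Q = convex hull S" and Q: "sym_polygon Q"
    and Ssym: "\<And>s. s \<in> S \<Longrightarrow> - s \<in> S" and Snonvert: "\<And>s. s \<in> S \<Longrightarrow> s \<noteq> 0 \<Longrightarrow> fst s \<noteq> 0"
begin

abbreviation N where "N \<equiv> Lnorm Q"

text \<open>The isoperimetrix is \<open>{w. cross2 w v \<le> 1 for all v \<in> Q}\<close>. Over the \<open>x\<close>-interval \<open>{- a..a}\<close> it lies between the
  graph of \<open>f\<close> and, by symmetry, that of \<open>\<lambda>x. - f (- x)\<close>; \<open>w\<close> is its vertical width. The edges of the graph of \<open>f\<close>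
  are parallel to the vertices \<open>s\<close> of \<open>Q\<close> with \<open>fst s > 0\<close>. Further below, \<open>Phi\<close> is an arc length parameter on the
  graph of \<open>f\<close> and \<open>area h\<close> is the area of the part of the isoperimetrix to the right of \<open>x = h\<close>.\<close>
definition "Sp = {s \<in> S. fst s > 0}"
definition "line s x = (x * snd s - 1) / (fst s :: real)" for s :: "real \<times> real"
definition "f x = Max ((\<lambda>s. line s x) ` Sp)"

lemma finSp: "finite Sp" using finS by (simp add: Sp_def)

lemma hull_le:
  assumes "linear l" "\<And>s. s \<in> S \<Longrightarrow> l s \<le> (c::real)" "v \<in> Q" shows "l v \<le> c"
proof -
  have "convex (l -` {..c})" by (rule convex_linear_vimage[OF assms(1)]) simp
  then have "convex hull S \<subseteq> l -` {..c}" using assms(2) by (intro hull_minimal) auto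
  then show ?thesis using assms(3) QS by auto
qed

lemma S_subset: "s \<in> S \<Longrightarrow> s \<in> Q"
  using QS hull_inc by auto

lemma cball_in_Q: obtains e where "e > 0" "cball 0 e \<subseteq> Q"
  using sym_polygonD(3)[OF Q] by (auto simp: mem_interior_cball)

text \<open>A functional that is nonpositive on all generators is nonpositive on \<open>Q\<close>,
  hence on a ball about 0, hence everywhere.\<close>

lemma linear_not_le_0:
  assumes "linear l" "l v > (0::real)" shows "\<exists>s\<in>S. l s > 0"
proof (rule ccontr)
  assume "\<not> ?thesis"
  then have le: "\<And>w. w \<in> Q \<Longrightarrow> l w \<le> 0" using hull_le[OF assms(1)] by (meson not_le)
  obtain e where e: "e > 0" "cball 0 e \<subseteq> Q" by (rule cball_in_Q)
  have v0: "v \<noteq> 0" using assms linear_0 by force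
  have "(e / norm v) *\<^sub>R v \<in> cball 0 e" using e v0 by simp
  then have "l ((e / norm v) *\<^sub>R v) \<le> 0" using le e(2) by blast
  moreover have "l ((e / norm v) *\<^sub>R v) = (e / norm v) * l v" using linear_scale[OF assms(1)] by simp
  moreover have "(e / norm v) * l v > 0" using e v0 assms(2) by simp
  ultimately show False by linarith
qed

lemma Sp_nonempty: "Sp \<noteq> {}"
proof -
  have "linear (\<lambda>v::real\<times>real. fst v)" by (rule linearI) auto
  from linear_not_le_0[OF this, of "(1,0)"] show ?thesis by (auto simp: Sp_def)
qed

lemma f_ge: "s \<in> Sp \<Longrightarrow> line s x \<le> f x"
  unfolding f_def using finSp by (intro Max_ge) auto

lemma f_attained: "\<exists>s\<in>Sp. f x = line s x"
proof -
  have "f x \<in> (\<lambda>s. line s x) ` Sp" unfolding f_def using finSp Sp_nonempty by (intro Max_in) auto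
  then show ?thesis by auto
qed

text \<open>The generator of \<open>Q\<close> dual to the edge of the isoperimetrix over
  \<open>x\<close>; where several lines attain the maximum the choice is arbitrary.\<close>

definition "act x = (SOME s. s \<in> Sp \<and> f x = line s x)"

lemma act: "act x \<in> Sp" "f x = line (act x) x"
proof -
  have "\<exists>s. s \<in> Sp \<and> f x = line s x" using f_attained by blast
  from someI_ex[OF this] show "act x \<in> Sp" "f x = line (act x) x" by (auto simp: act_def)
qed

lemma Sp_pos: "s \<in> Sp \<Longrightarrow> fst s > 0" by (simp add: Sp_def)
lemma Sp_S: "s \<in> Sp \<Longrightarrow> s \<in> S" by (simp add: Sp_def)

lemma S_cases:
  assumes "s \<in> S" obtains "s = 0" | "s \<in> Sp" | "- s \<in> Sp"
proof (cases "s = 0")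
  case False
  then consider "fst s > 0" | "fst s < 0" using Snonvert[OF assms] by linarith
  then show ?thesis using that assms Ssym[OF assms] by cases (auto simp: Sp_def)
qed (use that in blast)

lemma f_lipschitz: "\<exists>C. C-lipschitz_on UNIV f"
proof -
  define C where "C = Max ((\<lambda>s. \<bar>snd s / fst s\<bar>) ` Sp)"
  have C: "\<bar>snd s / fst s\<bar> \<le> C" if "s \<in> Sp" for s
    unfolding C_def using that finSp by (intro Max_ge) auto
  have C0: "C \<ge> 0" using C[OF act(1)[of 0]] by linarith
  have *: "f x - f y \<le> C * \<bar>x - y\<bar>" for x y
  proof -
    have "f x - f y \<le> line (act x) x - line (act x) y"
      using act(2)[of x] f_ge[OF act(1)[of x], of y] by linarith
    also have "\<dots> = (snd (act x) / fst (act x)) * (x - y)"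
      using Sp_pos[OF act(1)[of x]] by (simp add: line_def field_simps)
    also have "\<dots> \<le> \<bar>snd (act x) / fst (act x)\<bar> * \<bar>x - y\<bar>" by (metis abs_ge_self abs_mult)
    also have "\<dots> \<le> C * \<bar>x - y\<bar>" by (intro mult_right_mono C act) auto
    finally show ?thesis .
  qed
  have "\<bar>f x - f y\<bar> \<le> C * \<bar>x - y\<bar>" for x y
    using *[of x y] *[of y x] by (simp add: abs_le_iff abs_minus_commute)
  then have "C-lipschitz_on UNIV f" using C0 by (intro lipschitz_onI) (simp_all add: dist_real_def)
  then show ?thesis by blast
qed

lemma f_continuous: "continuous_on A f"
  using f_lipschitz lipschitz_on_continuous_on continuous_on_subset by blast

lemma line_affine:
  assumes "s \<in> Sp" shows "line s (u * x + (1 - u) * y) = u * line s x + (1 - u) * line s y"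
  using Sp_pos[OF assms] by (simp add: line_def field_simps)

lemma f_convex:
  assumes "0 \<le> u" "u \<le> 1" shows "f (u * x + (1 - u) * y) \<le> u * f x + (1 - u) * f y"
proof -
  let ?z = "u * x + (1 - u) * y"
  have "f ?z = u * line (act ?z) x + (1 - u) * line (act ?z) y"
    using act(2)[of ?z] line_affine[OF act(1)[of ?z]] by simp
  also have "\<dots> \<le> u * f x + (1 - u) * f y"
    using assms by (intro add_mono mult_left_mono f_ge act) auto
  finally show ?thesis .
qed

definition "w x = - f x - f (- x)"

lemma w_even: "w (- x) = w x" by (simp add: w_def)

lemma w_continuous: "continuous_on A w"
  unfolding w_def
  by (intro continuous_intros f_continuous continuous_on_compose2[OF f_continuous[of UNIV]]) auto

lemma f0_neg: "f 0 < 0"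
  using act(2)[of 0] Sp_pos[OF act(1)[of 0]] by (simp add: line_def)

text \<open>With a single slope all generators would lie on one line through 0, and \<open>Q\<close>
  would have no interior.\<close>

lemma two_slopes: "\<exists>s\<in>Sp. \<exists>s'\<in>Sp. snd s / fst s > snd s' / fst s'"
proof (rule ccontr)
  assume H: "\<not> ?thesis"
  define m where "m = snd (act 0) / fst (act 0)"
  have m: "snd s / fst s = m" if "s \<in> Sp" for s
    using H that act(1)[of 0] unfolding m_def by (meson linorder_neqE_linordered_idom)
  then have sm: "snd s = m * fst s" if "s \<in> Sp" for s
    using m[OF that] Sp_pos[OF that] by (simp add: field_simps)
  have z: "snd s - m * fst s = 0" if "s \<in> S" for s
    using that sm[of s] sm[of "- s"] by (cases rule: S_cases) auto
  have "linear (\<lambda>v::real\<times>real. snd v - m * fst v)" by (rule linearI) (auto simp: algebra_simps)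
  from linear_not_le_0[OF this, of "(0,1)"] z show False by auto
qed

lemma a_exists: "\<exists>a>0. w a = 0"
proof -
  obtain s s' where s: "s \<in> Sp" "s' \<in> Sp" "snd s / fst s > snd s' / fst s'" using two_slopes by blast
  \<comment> \<open>The zero of \<open>- line s x - line s' (- x)\<close>, an affine upper bound of
    \<open>w\<close> with negative slope.\<close>
  define X where "X = (1 / fst s + 1 / fst s') / (snd s / fst s - snd s' / fst s')"
  have X0: "X > 0" using s Sp_pos[OF s(1)] Sp_pos[OF s(2)] by (simp add: X_def add_pos_pos)
  have eq: "X * (snd s / fst s - snd s' / fst s') = 1 / fst s + 1 / fst s'"
    using s(3) by (simp add: X_def)
  have "w X \<le> - line s X - line s' (- X)"
    using f_ge[OF s(1), of X] f_ge[OF s(2), of "- X"] by (simp add: w_def)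
  also have "\<dots> = 1 / fst s + 1 / fst s' - X * (snd s / fst s - snd s' / fst s')"
    by (simp add: line_def diff_divide_distrib add_divide_distrib algebra_simps)
  also have "\<dots> = 0" using eq by simp
  finally have "w X \<le> 0" .
  moreover have w0: "w 0 > 0" using f0_neg by (simp add: w_def)
  ultimately obtain y where "0 \<le> y" "y \<le> X" "w y = 0"
    using IVT2'[of w X 0 0] X0 w_continuous by fastforce
  then show ?thesis using w0 by (intro exI[of _ y]) (cases "y = 0"; simp)
qed

definition "a = (SOME a. a > 0 \<and> w a = 0)"

lemma a: "a > 0" "w a = 0" "w (- a) = 0"
  using someI_ex[OF a_exists[simplified]] w_even[of a] by (auto simp: a_def)

lemma f_neg_a: "f (- a) = - f a" using a(2) by (simp add: w_def)

text \<open>\<open>w\<close> is even and concave, positive at 0 and zero at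
  \<open>a\<close>.\<close>

lemma w_pos:
  assumes "- a < x" "x < a" shows "w x > 0"
proof -
  define u where "u = \<bar>x\<bar> / a"
  have u: "0 \<le> u" "u < 1" "\<bar>x\<bar> = u * a" using assms a(1) by (auto simp: u_def field_simps)
  have "f (u * a) \<le> u * f a + (1 - u) * f 0" "f (- (u * a)) \<le> u * f (- a) + (1 - u) * f 0"
    using f_convex[of u a 0] f_convex[of u "- a" 0] u by auto
  then have "- w (u * a) \<le> u * (f a + f (- a)) + 2 * ((1 - u) * f 0)"
    by (simp add: w_def algebra_simps)
  also have "\<dots> < 0" using u f0_neg by (simp add: f_neg_a mult_pos_neg)
  finally have "w \<bar>x\<bar> > 0" using u(3) by simp
  then show ?thesis using w_even[of x] by (cases "x \<ge> 0") auto
qed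

lemma w_nonneg: "- a \<le> x \<Longrightarrow> x \<le> a \<Longrightarrow> w x \<ge> 0"
  using w_pos[of x] a by (cases "x = a \<or> x = - a") (auto intro: less_imp_le)

text \<open>A finite set containing the corners of both graphs: crossings below the maximum are
  included too. It is symmetric because the upper graph is the point reflection of the lower one,
  and it contains \<open>a\<close> and \<open>- a\<close> so that a point of the closed interval off
  \<open>kinks\<close> is interior.\<close>

definition "kinks = (let K = insert a {x. \<exists>s\<in>Sp. \<exists>s'\<in>Sp. s \<noteq> s' \<and> line s x = line s' x} in K \<union> uminus ` K)"

lemma finite_crossings: "finite {x. \<exists>s\<in>Sp. \<exists>s'\<in>Sp. s \<noteq> s' \<and> line s x = line s' x}"
proof -
  have "{x. \<exists>s\<in>Sp. \<exists>s'\<in>Sp. s \<noteq> s' \<and> line s x = line s' x} \<subseteq>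
     (\<Union>s\<in>Sp. \<Union>s'\<in>Sp. {(1 / fst s - 1 / fst s') / (snd s / fst s - snd s' / fst s')})"
  proof (rule subsetI, elim CollectE bexE conjE)
    fix x and s s' :: "real \<times> real"
    assume s: "s \<in> Sp" "s' \<in> Sp" "s \<noteq> s'" and eq: "line s x = line s' x"
    have p: "fst s > 0" "fst s' > 0" using Sp_pos s by auto
    have e: "x * (snd s / fst s - snd s' / fst s') = 1 / fst s - 1 / fst s'"
      using eq by (simp add: line_def diff_divide_distrib algebra_simps)
    have "snd s / fst s - snd s' / fst s' \<noteq> 0"
    proof
      assume z: "snd s / fst s - snd s' / fst s' = 0"
      then have "fst s = fst s'" using e p by (simp add: field_simps)
      then show False using z s(3) p by (simp add: prod_eq_iff)
    qed
    then have "x = (1 / fst s - 1 / fst s') / (snd s / fst s - snd s' / fst s')"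
      using e by (simp add: eq_divide_eq)
    then show "x \<in> (\<Union>s\<in>Sp. \<Union>s'\<in>Sp. {(1 / fst s - 1 / fst s') / (snd s / fst s - snd s' / fst s')})"
      using s by blast
  qed
  then show ?thesis by (rule finite_subset) (use finSp in auto)
qed

lemma kinks: "finite kinks" "a \<in> kinks" "- a \<in> kinks" "- x \<in> kinks \<longleftrightarrow> x \<in> kinks"
proof -
  have "- x \<in> K \<union> uminus ` K \<longleftrightarrow> x \<in> K \<union> uminus ` K" for K :: "real set"
    by (metis (no_types, lifting) Un_iff image_iff minus_minus)
  then show "- x \<in> kinks \<longleftrightarrow> x \<in> kinks" unfolding kinks_def Let_def .
qed (use finite_crossings in \<open>auto simp: kinks_def Let_def\<close>)

lemma not_kink_less:
  assumes "x \<notin> kinks" "s \<in> Sp" "s \<noteq> act x" shows "line s x < f x"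
proof -
  have "line s x \<noteq> line (act x) x" using assms act(1)[of x] by (auto simp: kinks_def Let_def)
  then show ?thesis using f_ge[OF assms(2), of x] act(2)[of x] by simp
qed

definition "slope x = snd (act x) / fst (act x)"

lemma f_deriv:
  assumes "x \<notin> kinks" shows "(f has_real_derivative slope x) (at x)"
proof -
  let ?s = "act x"
  have "\<forall>\<^sub>F y in nhds x. \<forall>s\<in>Sp - {?s}. line s y < line ?s y"
  proof (subst eventually_ball_finite_distrib)
    show "finite (Sp - {?s})" using finSp by simp
    show "\<forall>s\<in>Sp - {?s}. \<forall>\<^sub>F y in nhds x. line s y < line ?s y"
    proof
      fix s assume s: "s \<in> Sp - {?s}"
      have "isCont (\<lambda>y. line ?s y - line s y) x"
        using Sp_pos[of s] Sp_pos[OF act(1)[of x]] s unfolding line_def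
        by (intro continuous_intros) auto
      moreover have "0 < line ?s x - line s x" using not_kink_less[OF assms, of s] s act(2)[of x] by simp
      ultimately have "\<forall>\<^sub>F y in at x. 0 < line ?s y - line s y"
        unfolding isCont_def by (rule order_tendstoD)
      then show "\<forall>\<^sub>F y in nhds x. line s y < line ?s y"
        using \<open>0 < line ?s x - line s x\<close> by (simp add: eventually_nhds_conv_at)
    qed
  qed
  then have ev: "\<forall>\<^sub>F y in nhds x. f y = line ?s y"
  proof eventually_elim
    case (elim y)
    show ?case
    proof (rule ccontr)
      assume "f y \<noteq> line ?s y"
      then have "act y \<in> Sp - {?s}" using act[of y] by auto
      then have "line (act y) y < line ?s y" using elim by blast
      then show False using act(2)[of y] f_ge[OF act(1)[of x], of y] by simp
    qed
  qed
  have "(line ?s has_real_derivative slope x) (at x)"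
    unfolding line_def slope_def using Sp_pos[OF act(1)[of x]]
    by (auto intro!: derivative_eq_intros)
  then show ?thesis using DERIV_cong_ev[OF refl ev refl] by simp
qed

definition "F = (SOME F. \<forall>x. (F has_real_derivative f x) (at x))"

lemma F_deriv: "(F has_real_derivative f x) (at x)"
proof -
  have "\<exists>F. \<forall>x. (F has_real_derivative f x) (at x)"
    using real_antiderivative[OF f_continuous] by metis
  from someI_ex[OF this] show ?thesis by (simp add: F_def)
qed

lemma F_continuous: "continuous_on A F"
  using F_deriv DERIV_isCont continuous_at_imp_continuous_on by blast

text \<open>Its differential is \<open>x df - f dx\<close>, twice the area swept out from the
  origin. On an edge parallel to \<open>s\<close> this is \<open>dx / fst s\<close>, the length of
  the edge element when \<open>s\<close> has norm 1.\<close>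

definition "Phi x = x * f x - 2 * F x"

lemma Phi_deriv:
  assumes "x \<notin> kinks" shows "(Phi has_real_derivative 1 / fst (act x)) (at x)"
proof -
  have "(Phi has_real_derivative (x * slope x + 1 * f x - 2 * f x)) (at x)"
    unfolding Phi_def by (intro DERIV_diff DERIV_mult' DERIV_ident f_deriv assms DERIV_cmult F_deriv)
  moreover have "x * slope x + 1 * f x - 2 * f x = 1 / fst (act x)"
    using act(2)[of x] by (simp add: slope_def line_def diff_divide_distrib)
  ultimately show ?thesis by simp
qed

lemma Phi_continuous: "continuous_on A Phi"
  unfolding Phi_def by (intro continuous_intros f_continuous F_continuous)

lemma Phi_bounds:
  obtains m M where "m > 0" "\<And>x y. x \<le> y \<Longrightarrow> m * (y - x) \<le> Phi y - Phi x"
    "\<And>x y. x \<le> y \<Longrightarrow> Phi y - Phi x \<le> M * (y - x)"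
proof -
  define m where "m = Min ((\<lambda>s. 1 / fst s) ` Sp)"
  define M where "M = Max ((\<lambda>s. 1 / fst s) ` Sp)"
  have m: "m \<le> 1 / fst s" "1 / fst s \<le> M" if "s \<in> Sp" for s
    unfolding m_def M_def using that finSp by (auto intro: Min_le Max_ge)
  have "m \<in> (\<lambda>s. 1 / fst s) ` Sp" unfolding m_def using finSp Sp_nonempty by (intro Min_in) auto
  then have m0: "m > 0" using Sp_pos by auto
  have I: "((\<lambda>x. 1 / fst (act x)) has_integral (Phi y - Phi x)) {x..y}" if "x \<le> y" for x y
    by (rule fundamental_theorem_of_calculus_interior_strong[OF kinks(1) that _ Phi_continuous])
       (use Phi_deriv in \<open>simp add: has_real_derivative_iff_has_vector_derivative\<close>)
  have C: "((\<lambda>_. c) has_integral (c * (y - x))) {x..y}" if "x \<le> y" for x y c :: real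
    using has_integral_const_real[of c x y] that by (simp add: mult.commute)
  show ?thesis
  proof
    show "m > 0" by (rule m0)
    show "m * (y - x) \<le> Phi y - Phi x" if "x \<le> y" for x y
      by (rule has_integral_le[OF C[OF that] I[OF that]]) (rule m(1)[OF act(1)])
    show "Phi y - Phi x \<le> M * (y - x)" if "x \<le> y" for x y
      by (rule has_integral_le[OF I[OF that] C[OF that]]) (rule m(2)[OF act(1)])
  qed
qed

section \<open>Calibration of the norm by boundary points of the isoperimetrix\<close>

lemma cal_S:
  assumes "- a \<le> x" "x \<le> a" "s \<in> S" shows "x * snd s - f x * fst s \<le> 1"
  using assms(3)
proof (cases rule: S_cases)
  case 2
  then show ?thesis using f_ge[OF 2, of x] Sp_pos[OF 2] by (simp add: line_def divide_le_eq algebra_simps)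
next
  case 3
  have p: "fst (- s) > 0" by (rule Sp_pos[OF 3])
  have "(- x * snd (- s) - 1) \<le> f (- x) * fst (- s)"
    using f_ge[OF 3, of "- x"] by (simp only: line_def pos_divide_le_eq[OF p])
  moreover have "f x * fst (- s) \<le> - f (- x) * fst (- s)"
    using w_nonneg[OF assms(1,2)] p by (intro mult_right_mono) (auto simp: w_def)
  ultimately show ?thesis by simp
qed simp

lemma linear_cal: "linear (\<lambda>v::real\<times>real. x * snd v - y * fst v)"
  by (rule linearI) (auto simp: algebra_simps)

text \<open>Points of the boundary belong to the dual body, so pairing with them never exceeds the
  norm. These functionals, with \<open>x\<close> varying along the curve, are the calibrations
  behind all length estimates.\<close>

lemma cal_lower:
  assumes "- a \<le> x" "x \<le> a" shows "x * snd v - f x * fst v \<le> N v"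
  by (rule Lnorm_ge_linear[OF Q linear_cal]) (rule hull_le[OF linear_cal cal_S[OF assms]])

lemma cal_upper:
  assumes "- a \<le> x" "x \<le> a" shows "x * snd v + f (- x) * fst v \<le> N v"
  using cal_lower[of "- x" "- v"] assms by (simp add: Lnorm_minus[OF Q])

lemma N_act:
  assumes "- a \<le> x" "x \<le> a" shows "N (act x) = 1"
proof -
  have "x * snd (act x) - f x * fst (act x) = 1"
    using act(2)[of x] Sp_pos[OF act(1)[of x]] by (simp add: line_def)
  then have "1 \<le> N (act x)" using cal_lower[OF assms, of "act x"] by simp
  moreover have "N (1 *\<^sub>R act x) \<le> 1" by (intro Lnorm_scaleR_le Q S_subset Sp_S act) simp
  ultimately show ?thesis by simp
qed

lemma cal_S_strict:
  assumes "- a < x" "x < a" "x \<notin> kinks" "s \<in> S" "s \<noteq> act x" shows "x * snd s - f x * fst s < 1"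
  using assms(4)
proof (cases rule: S_cases)
  case 2
  then show ?thesis using not_kink_less[OF assms(3) 2 assms(5)] Sp_pos[OF 2]
    by (simp add: line_def divide_less_eq algebra_simps)
next
  case 3
  have p: "fst (- s) > 0" by (rule Sp_pos[OF 3])
  have "(- x * snd (- s) - 1) \<le> f (- x) * fst (- s)"
    using f_ge[OF 3, of "- x"] by (simp only: line_def pos_divide_le_eq[OF p])
  moreover have "f x * fst (- s) < - f (- x) * fst (- s)"
    using w_pos[OF assms(1,2)] p by (intro mult_strict_right_mono) (auto simp: w_def)
  ultimately show ?thesis by simp
qed simp

text \<open>Off the kinks the functional attains its maximum 1 over the generators only at
  \<open>act x\<close>. Splitting the unit vector into a part along \<open>act x\<close> and a part
  in the hull of the remaining generators, equality leaves no room for the second part.\<close>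

lemma cal_equality:
  assumes x: "- a < x" "x < a" "x \<notin> kinks" and v: "N v > 0" "x * snd v - f x * fst v = N v"
  shows "v = N v *\<^sub>R act x"
proof -
  let ?l = "\<lambda>v::real\<times>real. x * snd v - f x * fst v"
  obtain q where q: "q \<in> Q" "v = N v *\<^sub>R q" using Lnorm_attained[OF Q] by blast
  have "?l v = N v * ?l q" using arg_cong[OF q(2), of ?l] by (simp add: algebra_simps)
  then have lq: "?l q = 1" using v by simp
  let ?s = "act x"
  have s: "?s \<in> S" by (intro Sp_S act)
  have ne: "S - {?s} \<noteq> {}"
  proof -
    have "- ?s \<noteq> ?s" using Sp_pos[OF act(1)[of x]] by (metis fst_uminus less_minus_iff neg_0_less_iff_less order_less_asym)
    then show ?thesis using Ssym[OF s] by blast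
  qed
  have "q \<in> convex hull (insert ?s (S - {?s}))" using q(1) QS s by (simp add: insert_absorb)
  then obtain u t b where ut: "0 \<le> u" "0 \<le> t" "u + t = 1" "b \<in> convex hull (S - {?s})" "q = u *\<^sub>R ?s + t *\<^sub>R b"
    unfolding convex_hull_insert[OF ne] by blast
  have "convex (?l -` {..<1})" by (rule convex_linear_vimage[OF linear_cal]) simp
  then have "convex hull (S - {?s}) \<subseteq> ?l -` {..<1}"
    using cal_S_strict[OF x] by (intro hull_minimal) auto
  then have lb: "?l b < 1" using ut(4) by auto
  have ls: "?l ?s = 1" using act(2)[of x] Sp_pos[OF act(1)[of x]] by (simp add: line_def)
  have "?l q = u * ?l ?s + t * ?l b" unfolding ut(5) by (simp add: algebra_simps)
  then have "t * (1 - ?l b) = 0" using lq ls ut(3) by (simp add: algebra_simps)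
  then have "t = 0" using lb by simp
  then have "q = ?s" using ut(3,5) by simp
  then show ?thesis using q(2) by simp
qed

lemma cal_equality_upper:
  assumes x: "- a < x" "x < a" "x \<notin> kinks" and v: "N v > 0" "x * snd v + f (- x) * fst v = N v"
  shows "v = - N v *\<^sub>R act (- x)"
  using cal_equality[of "- x" "- v"] assms
  by (simp add: Lnorm_minus[OF Q] kinks) (metis minus_minus)

definition "area h = F (- a) - F (- h) - F a + F h"

lemma area_deriv: "(area has_real_derivative - w h) (at h)"
proof -
  have "((\<lambda>h. F (- h)) has_real_derivative f (- h) * (- 1)) (at h)"
    by (rule DERIV_chain2[OF F_deriv]) (auto intro!: derivative_eq_intros)
  then have "(area has_real_derivative (0 - f (- h) * (- 1) - 0 + f h)) (at h)"
    unfolding area_def by (intro DERIV_add DERIV_diff DERIV_const F_deriv)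
  then show ?thesis by (simp add: w_def)
qed

lemma area_a: "area a = 0" by (simp add: area_def)

lemma area_strict:
  assumes "- a \<le> x" "x < y" "y \<le> a" shows "area y < area x"
proof -
  have "\<exists>z. x < z \<and> z < y \<and> area y - area x = (y - x) * (- w z)"
    by (rule MVT2[OF assms(2)]) (rule area_deriv)
  then obtain z where z: "x < z" "z < y" "area y - area x = (y - x) * (- w z)" by blast
  have "w z > 0" using z assms by (intro w_pos) auto
  then have "(y - x) * (- w z) < 0" using assms by (simp add: mult_pos_neg)
  then show ?thesis using z(3) by simp
qed

lemma area_pos: "- a \<le> x \<Longrightarrow> x < a \<Longrightarrow> area x > 0"
  using area_strict[of x a] area_a by simp

lemma area_continuous: "continuous_on A area"
  using area_deriv DERIV_isCont continuous_at_imp_continuous_on by blast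

text \<open>If another line took over somewhere in the interval, the difference of the two lines
  would vanish in between, at a kink.\<close>

lemma f_affine_between:
  assumes uv: "u < v" and nk: "\<And>x. u < x \<Longrightarrow> x < v \<Longrightarrow> x \<notin> kinks"
  shows "\<exists>s\<in>Sp. \<forall>x\<in>{u..v}. f x = line s x"
proof -
  define m where "m = (u + v) / 2"
  have m: "u < m" "m < v" using uv by (auto simp: m_def)
  let ?s = "act m"
  have inner: "f x = line ?s x" if x: "x \<in> {u<..<v}" for x
  proof (rule ccontr)
    assume ne: "f x \<noteq> line ?s x"
    let ?t = "act x"
    have ts: "?t \<noteq> ?s" using ne act(2)[of x] by auto
    let ?g = "\<lambda>y. line ?t y - line ?s y"
    have gx: "?g x > 0" using ne act(2)[of x] f_ge[OF act(1)[of m], of x] by simp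
    have gm: "?g m < 0" using not_kink_less[OF nk[OF m] act(1)[of x] ts] act(2)[of m] by simp
    have cont: "continuous_on A ?g" for A
      using Sp_pos[OF act(1)[of x]] Sp_pos[OF act(1)[of m]] unfolding line_def
      by (intro continuous_intros) auto
    have "\<exists>y. min x m \<le> y \<and> y \<le> max x m \<and> ?g y = 0"
    proof (cases "x \<le> m")
      case True
      then show ?thesis using IVT2'[of ?g m 0 x] gx gm cont by (auto simp: min_def max_def)
    next
      case False
      then show ?thesis using IVT'[of ?g m 0 x] gx gm cont by (auto simp: min_def max_def)
    qed
    then obtain y where y: "min x m \<le> y" "y \<le> max x m" "?g y = 0" by blast
    then have "u < y" "y < v" using x m by (auto simp: min_def max_def split: if_splits)
    moreover have "y \<in> kinks" using y(3) ts act(1) by (auto simp: kinks_def Let_def)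
    ultimately show False using nk by blast
  qed
  have "f x - line ?s x = 0" if "x \<in> closure {u<..<v}" for x
    by (rule continuous_constant_on_closure[of "{u<..<v}" "\<lambda>x. f x - line ?s x"])
       (use that inner Sp_pos[OF act(1)[of m]] in \<open>auto simp: line_def intro!: continuous_intros f_continuous\<close>)
  then show ?thesis using uv act(1) by (intro bexI[of _ ?s]) auto
qed

lemma extreme_pieces:
  obtains h1 s1 s2 where "0 \<le> h1" "h1 < a" "s1 \<in> Sp" "s2 \<in> Sp"
    "\<And>x. h1 \<le> x \<Longrightarrow> x \<le> a \<Longrightarrow> f x = line s1 x" "\<And>x. - a \<le> x \<Longrightarrow> x \<le> - h1 \<Longrightarrow> f x = line s2 x"
proof -
  \<comment> \<open>The last kink before \<open>a\<close>; inserting 0 makes the set nonempty and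
    gives \<open>0 \<le> h1\<close>.\<close>
  define h1 where "h1 = Max (insert 0 (kinks \<inter> {..<a}))"
  have fin: "finite (insert 0 (kinks \<inter> {..<a}))" using kinks(1) by simp
  have h1: "0 \<le> h1" "h1 < a" unfolding h1_def using fin a(1) by auto
  have nk: "x \<notin> kinks" if "h1 < x" "x < a" for x
  proof
    assume "x \<in> kinks"
    then have "x \<le> h1" unfolding h1_def using fin that by (intro Max_ge) auto
    then show False using that by simp
  qed
  obtain s1 where s1: "s1 \<in> Sp" "\<forall>x\<in>{h1..a}. f x = line s1 x"
    using f_affine_between[OF h1(2) nk] by blast
  have "\<exists>s\<in>Sp. \<forall>x\<in>{- a..- h1}. f x = line s x"
    by (rule f_affine_between) (use h1 nk[of "- x" for x] kinks(4) in force)+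
  then obtain s2 where s2: "s2 \<in> Sp" "\<forall>x\<in>{- a..- h1}. f x = line s2 x" by blast
  show ?thesis by (rule that[OF h1 s1(1) s2(1)]) (use s1(2) s2(2) in auto)
qed

end

section \<open>The isoperimetric inequality\<close>

text \<open>Replacing \<open>g\<close> by its positive part makes it nonnegative everywhere, hence
  absolutely integrable; the Lebesgue integral then yields vanishing almost everywhere.\<close>

lemma nonneg_has_integral_0_AE:
  fixes g :: "real \<Rightarrow> real"
  assumes I: "(g has_integral 0) {u..v}" and nn: "AE t in lborel. t \<in> {u..v} \<longrightarrow> 0 \<le> g t"
  shows "AE t in lborel. t \<in> {u..v} \<longrightarrow> g t = 0"
proof -
  let ?h = "\<lambda>t. max 0 (g t)"
  have "(?h has_integral 0) {u..v}"
    by (rule has_integral_spike[OF _ _ I, of "{t. \<not> (t \<in> {u..v} \<longrightarrow> 0 \<le> g t)}"])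
       (use nn in \<open>auto simp: AE_lborel_iff_negligible\<close>)
  then have int: "?h integrable_on {u..v}" and int0: "integral {u..v} ?h = 0"
    by (auto simp: integrable_on_def integral_unique)
  have abs: "?h absolutely_integrable_on {u..v}"
    by (rule nonnegative_absolutely_integrable_1[OF int]) simp
  have "integral\<^sup>L lebesgue (\<lambda>t. indicator {u..v} t *\<^sub>R ?h t) = 0"
    using set_lebesgue_integral_eq_integral(2)[OF abs] int0 by (simp add: set_lebesgue_integral_def)
  moreover have "integrable lebesgue (\<lambda>t. indicator {u..v} t *\<^sub>R ?h t)"
    using abs by (simp add: set_integrable_def)
  ultimately have "AE t in lebesgue. indicator {u..v} t *\<^sub>R ?h t = 0"
    by (subst (asm) integral_nonneg_eq_0_iff_AE) auto
  then have "AE t in lborel. indicator {u..v} t *\<^sub>R ?h t = 0" by (simp only: AE_completion_iff)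
  then show ?thesis using nn
    by eventually_elim (auto simp: indicator_def max_def split: if_splits)
qed

lemma C1_lipschitz_on_Icc:
  fixes G :: "real \<Rightarrow> real"
  assumes "\<And>x. (G has_real_derivative g x) (at x)" "continuous_on UNIV g"
  shows "\<exists>M. M-lipschitz_on {p..q} G"
proof -
  have "compact (g ` {p..q})" using assms(2) by (intro compact_continuous_image) (auto intro: continuous_on_subset)
  then have "bounded (g ` {p..q})" by (rule compact_imp_bounded)
  then obtain B where "\<forall>y\<in>g ` {p..q}. norm y \<le> B" unfolding bounded_iff by (elim exE)
  then have B: "\<bar>g x\<bar> \<le> B" if "x \<in> {p..q}" for x using that by auto
  have "(max B 0)-lipschitz_on {p..q} G"
  proof (rule bounded_derivative_imp_lipschitz)
    show "(G has_derivative (*) (g x)) (at x within {p..q})" for x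
      using assms(1)[of x] by (simp add: has_field_derivative_def has_derivative_at_withinI)
    show "onorm ((*) (g x)) \<le> max B 0" if "x \<in> {p..q}" for x
    proof (rule onorm_le)
      fix y have "\<bar>g x\<bar> * \<bar>y\<bar> \<le> max B 0 * \<bar>y\<bar>" using B[OF that] by (intro mult_right_mono) auto
      then show "norm (g x * y) \<le> max B 0 * norm y" by (simp add: abs_mult)
    qed
  qed auto
  then show ?thesis by blast
qed

context vertical_polygon begin

lemma speed_integrable:
  assumes x: "lip_deriv x x'" and y: "lip_deriv y y'"
  shows "(\<lambda>t. N (x' t, y' t)) integrable_on {0..1}"
proof (rule measurable_bounded_by_integrable_imp_integrable)
  have ax: "x' absolutely_integrable_on {0..1}" and ay: "y' absolutely_integrable_on {0..1}"
    using x y by (auto intro: lip_deriv_absolutely_integrable)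
  have "x' \<in> borel_measurable (lebesgue_on {0..1})" "y' \<in> borel_measurable (lebesgue_on {0..1})"
    using ax ay by (auto intro: absolutely_integrable_imp_borel_measurable)
  then have "(\<lambda>t. (x' t, y' t)) \<in> borel_measurable (lebesgue_on {0..1})" by (rule borel_measurable_Pair)
  then show "(\<lambda>t. N (x' t, y' t)) \<in> borel_measurable (lebesgue_on {0..1})"
    by (rule borel_measurable_continuous_on[OF Lnorm_continuous[OF Q]])
  have "(\<lambda>t. \<bar>x' t\<bar> * N (1, 0)) integrable_on {0..1}" "(\<lambda>t. \<bar>y' t\<bar> * N (0, 1)) integrable_on {0..1}"
    using ax ay by (auto simp: absolutely_integrable_on_def intro: integrable_on_mult_left)
  then show "(\<lambda>t. \<bar>x' t\<bar> * N (1, 0) + \<bar>y' t\<bar> * N (0, 1)) integrable_on {0..1}"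
    by (rule integrable_add)
  have abs: "N (c *\<^sub>R v) = \<bar>c\<bar> * N v" for c v
    using Lnorm_scale[OF Q, of "\<bar>c\<bar>" v] Lnorm_minus[OF Q, of "\<bar>c\<bar> *\<^sub>R v"] by (cases "c \<ge> 0") auto
  show "norm (N (x' t, y' t)) \<le> \<bar>x' t\<bar> * N (1, 0) + \<bar>y' t\<bar> * N (0, 1)" for t
    using Lnorm_triangle[OF Q, of "x' t *\<^sub>R (1, 0)" "y' t *\<^sub>R (0, 1)"]
      Lnorm_attained(1)[OF Q, of "(x' t, y' t)"]
    unfolding abs by simp
qed simp

text \<open>Integral of the calibration defect over a time interval. Since \<open>x'\<close> is
  \<open>\<mu>\<close> times the derivative of \<open>X\<close>, the last summand is an exact
  derivative. With \<open>B\<close> the lower or the upper graph the integrand is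
  nonnegative.\<close>

lemma piece:
  assumes x: "lip_deriv x x'" and y: "lip_deriv y y'" and mu: "\<mu> > 0"
    and X: "\<And>t. X t = x t / \<mu> + h" and Xa: "\<And>t. t \<in> {0..1} \<Longrightarrow> X t \<in> {- a..a}"
    and BF: "\<And>x. (BF has_real_derivative B x) (at x)" and B: "continuous_on UNIV B"
    and uv: "0 \<le> u" "u \<le> v" "v \<le> 1"
  shows "((\<lambda>t. N (x' t, y' t) - X t * y' t + B (X t) * x' t) has_integral
     (integral {u..v} (\<lambda>t. N (x' t, y' t)) - integral {u..v} (\<lambda>t. X t * y' t)
        + \<mu> * (BF (X v) - BF (X u)))) {u..v}"
proof -
  have sub: "{u..v} \<subseteq> {0..1}" using uv by auto
  have dX: "lip_deriv X (\<lambda>t. 1 / \<mu> * x' t)"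
  proof -
    have "X = (\<lambda>t. 1 / \<mu> * x t + h)" using X by auto
    then show ?thesis
      using lip_deriv_add[OF lip_deriv_cmult[OF x, of "1 / \<mu>"] lip_deriv_const[of h]] by simp
  qed
  obtain M where M: "M-lipschitz_on {- a..a} BF" using C1_lipschitz_on_Icc[OF BF B] by blast
  have "lip_deriv (\<lambda>t. BF (X t)) (\<lambda>t. B (X t) * (1 / \<mu> * x' t))"
    by (rule lip_deriv_chain[OF dX _ Xa M, of "{}"]) (use BF in auto)
  from lip_deriv_FTC[OF lip_deriv_cmult[OF this, of \<mu>] uv]
  have 3: "((\<lambda>t. B (X t) * x' t) has_integral \<mu> * (BF (X v) - BF (X u))) {u..v}"
    using mu by (simp add: right_diff_distrib)
  have 1: "((\<lambda>t. N (x' t, y' t)) has_integral integral {u..v} (\<lambda>t. N (x' t, y' t))) {u..v}"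
    using integrable_on_subinterval[OF speed_integrable[OF x y] sub] by (rule integrable_integral)
  have "(\<lambda>t. X t * y' t) absolutely_integrable_on {0..1}"
    by (rule lip_deriv_times_continuous[OF lip_deriv_continuous[OF dX] y])
  then have "(\<lambda>t. X t * y' t) integrable_on {u..v}"
    using integrable_on_subinterval[OF _ sub] set_lebesgue_integral_eq_integral(1) by blast
  then have 2: "((\<lambda>t. X t * y' t) has_integral integral {u..v} (\<lambda>t. X t * y' t)) {u..v}"
    by (rule integrable_integral)
  show ?thesis by (intro has_integral_add has_integral_diff 1 2 3)
qed

definition "upper_f x = - f (- x)"

lemma upper_deriv: "((\<lambda>x. F (- x)) has_real_derivative upper_f x) (at x)"
proof -
  have "((\<lambda>h. F (- h)) has_real_derivative f (- x) * (- 1)) (at x)"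
    by (rule DERIV_chain2[OF F_deriv]) (auto intro!: derivative_eq_intros)
  then show ?thesis by (simp add: upper_f_def)
qed

lemma upper_continuous: "continuous_on UNIV upper_f"
  unfolding upper_f_def
  by (intro continuous_intros continuous_on_compose2[OF f_continuous[of UNIV]]) auto

lemma upper_cal: "X \<in> {- a..a} \<Longrightarrow> 0 \<le> N (p, q) - X * q + upper_f X * p"
  using cal_upper[of X "(p, q)"] by (simp add: upper_f_def)

lemma lower_cal: "X \<in> {- a..a} \<Longrightarrow> 0 \<le> N (p, q) - X * q + f X * p"
  using cal_lower[of X "(p, q)"] by simp

end

locale planar_curve = vertical_polygon +
  fixes x x' y y' :: "real \<Rightarrow> real" and P :: real
  assumes x: "lip_deriv x x'" and y: "lip_deriv y y'"
    and ends: "x 0 = 0" "x 1 = 0" "y 0 = 0" "y 1 = P"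
begin

definition "len = integral {0..1} (\<lambda>t. N (x' t, y' t))"
text \<open>The chord lies on the axis \<open>x = 0\<close> and contributes nothing to the integral
  of \<open>x dy\<close>, so this is the signed area of the curve closed by its chord.\<close>

definition "ar = integral {0..1} (\<lambda>t. x t * y' t)"

lemma Xy_integrable: "(\<lambda>t. (x t / \<mu> + h) * y' t) integrable_on {0..1}"
proof -
  have "continuous_on {0..1} (\<lambda>t. x t / \<mu> + h)"
    unfolding divide_inverse by (intro continuous_intros lip_deriv_continuous[OF x])
  from lip_deriv_times_continuous[OF this y] show ?thesis
    by (simp add: set_lebesgue_integral_eq_integral(1))
qed

lemma Xy_integral: "integral {0..1} (\<lambda>t. (x t / \<mu> + h) * y' t) = ar / \<mu> + h * P"
proof -
  have 1: "((\<lambda>t. x t * y' t) has_integral ar) {0..1}"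
    unfolding ar_def using Xy_integrable[of 1 0] by (simp add: integrable_integral)
  have 2: "(y' has_integral P) {0..1}" using lip_deriv_FTC[OF y, of 0 1] ends by simp
  have "((\<lambda>t. 1 / \<mu> * (x t * y' t) + h * y' t) has_integral 1 / \<mu> * ar + h * P) {0..1}"
    by (intro has_integral_add has_integral_mult_right 1 2)
  then show ?thesis by (simp add: integral_unique distrib_right)
qed

lemma len_split:
  assumes "0 \<le> u" "u \<le> 1"
  shows "integral {0..u} (\<lambda>t. N (x' t, y' t)) + integral {u..1} (\<lambda>t. N (x' t, y' t)) = len"
  unfolding len_def by (rule Henstock_Kurzweil_Integration.integral_combine[OF assms speed_integrable[OF x y]])

lemma Xy_split:
  assumes "0 \<le> u" "u \<le> 1"
  shows "integral {0..u} (\<lambda>t. (x t / \<mu> + h) * y' t) + integral {u..1} (\<lambda>t. (x t / \<mu> + h) * y' t) = ar / \<mu> + h * P"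
  unfolding Xy_integral[symmetric] by (rule Henstock_Kurzweil_Integration.integral_combine[OF assms Xy_integrable])

text \<open>Schmidt's argument: compare the curve with the point of the boundary of the (scaled and
  translated) isoperimetrix having the same first coordinate.\<close>
lemma schmidt_one:
  assumes mu: "\<mu> > 0" and Xa: "\<And>t. t \<in> {0..1} \<Longrightarrow> x t / \<mu> + h \<in> {- a..a}"
    and t2: "t2 \<in> {0..1}" "x t2 / \<mu> + h = a"
  shows "ar / \<mu> + h * P + \<mu> * area h \<le> len"
    and "ar / \<mu> + h * P + \<mu> * area h = len \<Longrightarrow>
      AE t in lborel. (t \<in> {0..t2} \<longrightarrow> N (x' t, y' t) - (x t / \<mu> + h) * y' t + f (x t / \<mu> + h) * x' t = 0)
        \<and> (t \<in> {t2..1} \<longrightarrow> N (x' t, y' t) - (x t / \<mu> + h) * y' t + upper_f (x t / \<mu> + h) * x' t = 0)"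
proof -
  define X where "X t = x t / \<mu> + h" for t
  have Xa': "X t \<in> {- a..a}" if "t \<in> {0..1}" for t using Xa[OF that] by (simp add: X_def)
  have X01: "X 0 = h" "X 1 = h" "X t2 = a" using ends t2 by (auto simp: X_def)
  have t: "0 \<le> t2" "t2 \<le> 1" using t2 by auto
  \<comment> \<open>Up to the instant \<open>t2\<close> of touching the right end the curve is
    compared with the lower graph, afterwards with the upper one. The \<open>F\<close> terms of
    \<open>I\<close> and \<open>J\<close> add up to \<open>- \<mu> * area h\<close>.\<close>
  define I where "I = integral {0..t2} (\<lambda>t. N (x' t, y' t)) - integral {0..t2} (\<lambda>t. X t * y' t) + \<mu> * (F a - F h)"
  define J where "J = integral {t2..1} (\<lambda>t. N (x' t, y' t)) - integral {t2..1} (\<lambda>t. X t * y' t) + \<mu> * (F (- h) - F (- a))"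
  have I: "((\<lambda>t. N (x' t, y' t) - X t * y' t + f (X t) * x' t) has_integral I) {0..t2}"
    using piece[OF x y mu X_def Xa' F_deriv f_continuous order_refl t] X01 by (simp add: I_def)
  have J: "((\<lambda>t. N (x' t, y' t) - X t * y' t + upper_f (X t) * x' t) has_integral J) {t2..1}"
    using piece[OF x y mu X_def Xa' upper_deriv upper_continuous t order_refl] X01 by (simp add: J_def)
  have I0: "0 \<le> I" by (rule has_integral_nonneg[OF I]) (use lower_cal Xa' t in auto)
  have J0: "0 \<le> J" by (rule has_integral_nonneg[OF J]) (use upper_cal Xa' t in auto)
  have sum: "I + J = len - (ar / \<mu> + h * P) - \<mu> * area h"
    using len_split[OF t] Xy_split[OF t, of \<mu> h]
    unfolding I_def J_def X_def area_def by (simp add: algebra_simps)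
  show "ar / \<mu> + h * P + \<mu> * area h \<le> len" using I0 J0 sum by simp
  assume "ar / \<mu> + h * P + \<mu> * area h = len"
  then have "I = 0" "J = 0" using I0 J0 sum by auto
  have "AE t in lborel. t \<in> {0..t2} \<longrightarrow> N (x' t, y' t) - X t * y' t + f (X t) * x' t = 0"
    by (rule nonneg_has_integral_0_AE) (use I \<open>I = 0\<close> lower_cal Xa' t in auto)
  moreover have "AE t in lborel. t \<in> {t2..1} \<longrightarrow> N (x' t, y' t) - X t * y' t + upper_f (X t) * x' t = 0"
    by (rule nonneg_has_integral_0_AE) (use J \<open>J = 0\<close> upper_cal Xa' t in auto)
  ultimately show "AE t in lborel. (t \<in> {0..t2} \<longrightarrow> N (x' t, y' t) - (x t / \<mu> + h) * y' t + f (x t / \<mu> + h) * x' t = 0)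
        \<and> (t \<in> {t2..1} \<longrightarrow> N (x' t, y' t) - (x t / \<mu> + h) * y' t + upper_f (x t / \<mu> + h) * x' t = 0)"
    unfolding X_def by eventually_elim blast
qed

text \<open>Switching graphs at both ends of the \<open>x\<close>-interval collects the area of the
  whole isoperimetrix, whichever end is reached earlier.\<close>

lemma schmidt_both:
  assumes mu: "\<mu> > 0" and Xa: "\<And>t. t \<in> {0..1} \<Longrightarrow> x t / \<mu> + h \<in> {- a..a}"
    and t1: "t1 \<in> {0..1}" "x t1 / \<mu> + h = - a" and t2: "t2 \<in> {0..1}" "x t2 / \<mu> + h = a"
  shows "ar / \<mu> + h * P + \<mu> * area (- a) \<le> len"
proof -
  define X where "X t = x t / \<mu> + h" for t
  define n where "n t = N (x' t, y' t)" for t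
  define m where "m t = X t * y' t" for t
  have Xa': "X t \<in> {- a..a}" if "t \<in> {0..1}" for t using Xa[OF that] by (simp add: X_def)
  have X01: "X 0 = h" "X 1 = h" "X t2 = a" "X t1 = - a" using ends t1 t2 by (auto simp: X_def)
  have lower: "0 \<le> integral {u..v} n - integral {u..v} m + \<mu> * (F (X v) - F (X u))"
    if "0 \<le> u" "u \<le> v" "v \<le> 1" for u v unfolding n_def m_def
    by (rule has_integral_nonneg[OF piece[OF x y mu X_def Xa' F_deriv f_continuous that]])
       (use lower_cal Xa' that in auto)
  have upper: "0 \<le> integral {u..v} n - integral {u..v} m + \<mu> * (F (- X v) - F (- X u))"
    if "0 \<le> u" "u \<le> v" "v \<le> 1" for u v unfolding n_def m_def
    by (rule has_integral_nonneg[OF piece[OF x y mu X_def Xa' upper_deriv upper_continuous that]])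
       (use upper_cal Xa' that in auto)
  have split: "integral {0..p} g + integral {p..q} g + integral {q..1} g = integral {0..1} g"
    if "0 \<le> p" "p \<le> q" "q \<le> 1" and g: "g integrable_on {0..1}" for p q and g :: "real \<Rightarrow> real"
  proof -
    have "integral {0..p} g + integral {p..q} g = integral {0..q} g"
      by (rule Henstock_Kurzweil_Integration.integral_combine)
         (use that integrable_on_subinterval[OF g, of 0 q] in auto)
    moreover have "integral {0..q} g + integral {q..1} g = integral {0..1} g"
      by (rule Henstock_Kurzweil_Integration.integral_combine) (use that in auto)
    ultimately show ?thesis by simp
  qed
  have n: "n integrable_on {0..1}" "integral {0..1} n = len"
    using speed_integrable[OF x y] by (simp_all add: n_def[abs_def] len_def)
  have m: "m integrable_on {0..1}" "integral {0..1} m = ar / \<mu> + h * P"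
    using Xy_integrable[of \<mu> h] Xy_integral[of \<mu> h] by (simp_all add: m_def[abs_def] X_def)
  have ar: "\<mu> * area (- a) = 2 * \<mu> * F (- a) - 2 * \<mu> * F a" by (simp add: area_def algebra_simps)
  show ?thesis
  proof (cases "t1 \<le> t2")
    case True
    then have t: "0 \<le> t1" "t1 \<le> t2" "t2 \<le> 1" using t1 t2 by auto
    have "0 \<le> len - (ar / \<mu> + h * P) + \<mu> * (F (- X t1) - F (- X 0)) + \<mu> * (F (X t2) - F (X t1)) + \<mu> * (F (- X 1) - F (- X t2))"
      using upper[of 0 t1] lower[of t1 t2] upper[of t2 1] t split[OF t n(1)] split[OF t m(1)] n(2) m(2) by linarith
    then show ?thesis unfolding X01 ar by (simp add: algebra_simps)
  next
    case False
    then have t: "0 \<le> t2" "t2 \<le> t1" "t1 \<le> 1" using t1 t2 by auto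
    have "0 \<le> len - (ar / \<mu> + h * P) + \<mu> * (F (X t2) - F (X 0)) + \<mu> * (F (- X t1) - F (- X t2)) + \<mu> * (F (X 1) - F (X t1))"
      using lower[of 0 t2] upper[of t2 t1] lower[of t1 1] t split[OF t n(1)] split[OF t m(1)] n(2) m(2) by linarith
    then show ?thesis unfolding X01 ar by (simp add: algebra_simps)
  qed
qed

text \<open>If the right extent of the curve dictates the larger scale, the scaled body can be
  placed with its cut at \<open>h\<close> and is touched on the right. Otherwise the body is scaled
  to the full width of the curve; its cut is then at some \<open>g \<ge> h\<close>, and the whole
  area replaces the smaller \<open>area h\<close>, which makes the inequality strict. The second
  disjunct keeps what the equality case needs.\<close>

lemma isoperimetric:
  assumes h: "- a < h" "h < a" and P: "0 \<le> P" and ar0: "ar > 0"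
  obtains \<mu> where "\<mu> > 0"
    "ar + \<mu>\<^sup>2 * area h < \<mu> * (len - h * P) \<or>
     (ar + \<mu>\<^sup>2 * area h \<le> \<mu> * (len - h * P) \<and>
      (\<forall>t\<in>{0..1}. x t / \<mu> + h \<in> {- a..a}) \<and> (\<exists>t2\<in>{0..1}. x t2 / \<mu> + h = a))"
proof -
  obtain t1 where t1: "t1 \<in> {0..1}" "\<And>t. t \<in> {0..1} \<Longrightarrow> x t1 \<le> x t"
    using continuous_attains_inf[OF compact_Icc _ lip_deriv_continuous[OF x]] by auto
  obtain t2 where t2: "t2 \<in> {0..1}" "\<And>t. t \<in> {0..1} \<Longrightarrow> x t \<le> x t2"
    using continuous_attains_sup[OF compact_Icc _ lip_deriv_continuous[OF x]] by auto
  have m: "x t1 \<le> 0" "0 \<le> x t2" using t1(2)[of 0] t2(2)[of 0] ends by auto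
  have not0: "\<not> (x t1 = 0 \<and> x t2 = 0)"
  proof
    assume "x t1 = 0 \<and> x t2 = 0"
    then have "x t = 0" if "t \<in> {0..1}" for t using t1(2)[OF that] t2(2)[OF that] by simp
    then have "ar = integral {0..1::real} (\<lambda>t. 0)" unfolding ar_def by (intro integral_cong) simp
    then show False using ar0 by simp
  qed
  show ?thesis
  \<comment> \<open>Cross-multiplied comparison of the scales \<open>x t2 / (a - h)\<close> and
    \<open>- x t1 / (a + h)\<close> required on the two sides.\<close>
  proof (cases "x t2 * (a + h) \<ge> - x t1 * (a - h)")
    case True
    have x2: "x t2 > 0"
    proof (rule ccontr)
      assume "\<not> 0 < x t2"
      then have z: "x t2 = 0" using m by simp
      then have "0 \<le> x t1 * (a - h)" using True by simp
      then have "x t1 \<ge> 0" using h by (simp add: zero_le_mult_iff)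
      then show False using z m not0 by simp
    qed
    define \<mu> where "\<mu> = x t2 / (a - h)"
    have mu: "\<mu> > 0" using x2 h by (simp add: \<mu>_def)
    have e2: "x t2 / \<mu> + h = a" using x2 h by (simp add: \<mu>_def)
    have "- (a + h) \<le> x t1 / \<mu>"
      using True x2 h by (simp add: \<mu>_def le_divide_eq algebra_simps)
    then have r1: "x t / \<mu> + h \<in> {- a..a}" if "t \<in> {0..1}" for t
      using divide_right_mono[OF t1(2)[OF that], of \<mu>] divide_right_mono[OF t2(2)[OF that], of \<mu>] mu e2 by auto
    then have r: "\<forall>t\<in>{0..1}. x t / \<mu> + h \<in> {- a..a}" by blast
    have "ar / \<mu> + h * P + \<mu> * area h \<le> len"
      by (rule schmidt_one(1)[OF mu _ t2(1) e2]) (use r in auto)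
    then have "\<mu> * (ar / \<mu> + h * P + \<mu> * area h) \<le> \<mu> * len" using mu by (intro mult_left_mono) auto
    then have "ar + \<mu>\<^sup>2 * area h \<le> \<mu> * (len - h * P)" using mu by (simp add: algebra_simps power2_eq_square)
    then show ?thesis using r e2 t2(1) mu by (intro that[of \<mu>]) auto
  next
    case False
    define \<mu> where "\<mu> = (x t2 - x t1) / (2 * a)"
    have mu: "\<mu> > 0" using not0 m a(1) by (auto simp: \<mu>_def)
    define g where "g = a - x t2 / \<mu>"
    have am: "2 * a * \<mu> = x t2 - x t1" using a(1) by (simp add: \<mu>_def)
    have e2: "x t2 / \<mu> + g = a" by (simp add: g_def)
    have "x t1 = x t2 - 2 * a * \<mu>" using am by simp
    then have e1: "x t1 / \<mu> + g = - a" using mu by (simp add: g_def diff_divide_distrib)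
    have r: "x t / \<mu> + g \<in> {- a..a}" if "t \<in> {0..1}" for t
      using divide_right_mono[OF t1(2)[OF that], of \<mu>] divide_right_mono[OF t2(2)[OF that], of \<mu>] mu e1 e2 by auto
    have "2 * a * x t2 \<le> (a - h) * (x t2 - x t1)" using False by (simp add: algebra_simps)
    then have "2 * a * x t2 \<le> 2 * a * ((a - h) * \<mu>)" unfolding am[symmetric] by (simp add: mult_ac)
    then have "x t2 \<le> (a - h) * \<mu>" using a(1) by simp
    then have "x t2 / \<mu> \<le> a - h" using mu by (simp add: pos_divide_le_eq)
    then have gh: "h \<le> g" by (simp add: g_def)
    have "ar / \<mu> + g * P + \<mu> * area (- a) \<le> len"
      by (rule schmidt_both[OF mu r t1(1) e1 t2(1) e2])
    then have "\<mu> * (ar / \<mu> + g * P + \<mu> * area (- a)) \<le> \<mu> * len" using mu by (intro mult_left_mono) auto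
    then have 1: "ar + \<mu>\<^sup>2 * area (- a) \<le> \<mu> * (len - g * P)" using mu by (simp add: algebra_simps power2_eq_square)
    have 2: "\<mu> * (len - g * P) \<le> \<mu> * (len - h * P)" using gh P mu by (intro mult_left_mono diff_left_mono mult_right_mono) auto
    have "\<mu>\<^sup>2 * area h < \<mu>\<^sup>2 * area (- a)" using area_strict[of "- a" h] h mu by (intro mult_strict_left_mono) auto
    then have "ar + \<mu>\<^sup>2 * area h < \<mu> * (len - h * P)" using 1 2 by linarith
    then show ?thesis by (intro that[OF mu] disjI1)
  qed
qed

end

section \<open>The equality case\<close>

context vertical_polygon begin

text \<open>Twice the area of the sector seen from the origin: the cap \<open>area h\<close>
  together with the signed triangle of area \<open>h * w h / 2\<close> over the chord. On the
  isoperimetrix this doubled area is length.\<close>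

definition "arc_len h = 2 * area h + h * w h"

lemma arc_len_eq: "arc_len h = (Phi a - Phi h) + (Phi (- h) - Phi (- a))"
  by (simp add: arc_len_def area_def Phi_def w_def f_neg_a algebra_simps)

lemma Phi_less: "x < y \<Longrightarrow> Phi x < Phi y"
proof -
  assume xy: "x < y"
  obtain m M where m: "m > 0" "\<And>x y. x \<le> y \<Longrightarrow> m * (y - x) \<le> Phi y - Phi x" by (rule Phi_bounds) blast
  have "0 < m * (y - x)" using m(1) xy by simp
  then show ?thesis using m(2)[of x y] xy by linarith
qed

lemma Phi_inj: "Phi x = Phi y \<longleftrightarrow> x = y"
  using Phi_less by (metis linorder_neqE_linordered_idom less_irrefl)

lemma Phi_le_iff: "Phi x \<le> Phi y \<longleftrightarrow> x \<le> y"
  using Phi_less by (metis less_eq_real_def not_le)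

lemma arc_len_pos: "- a < h \<Longrightarrow> h < a \<Longrightarrow> arc_len h > 0"
  using Phi_less[of h a] Phi_less[of "- a" "- h"] by (simp add: arc_len_eq)

lemma Phi_lipschitz: "\<exists>M. M-lipschitz_on UNIV Phi"
proof -
  obtain m M where m: "m > 0" "\<And>x y. x \<le> y \<Longrightarrow> m * (y - x) \<le> Phi y - Phi x"
    and M: "\<And>x y. x \<le> y \<Longrightarrow> Phi y - Phi x \<le> M * (y - x)" by (rule Phi_bounds) blast
  have "0 \<le> M" using M[of 0 1] Phi_less[of 0 1] by simp
  have "M-lipschitz_on UNIV Phi"
  proof (rule lipschitz_on_leI[OF _ \<open>0 \<le> M\<close>])
    fix x y :: real assume "x \<le> y"
    then show "dist (Phi x) (Phi y) \<le> M * dist x y"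
      using M[of x y] Phi_le_iff[of x y] by (simp add: dist_real_def)
  qed
  then show ?thesis by blast
qed

end

context planar_curve begin

text \<open>In the equality case \<open>Phi\<close> grows with speed at most \<open>len\<close> along the curve, and on the whole
  it grows by exactly \<open>len\<close>; hence almost everywhere with speed \<open>len\<close>, away from the kinks.\<close>
lemma tight_structure:
  assumes h: "- a < h" "h < a" and P: "P = w h" and ar: "ar = area h"
    and sp: "AE t in lborel. t \<in> {0..1} \<longrightarrow> N (x' t, y' t) = arc_len h"
  defines "L \<equiv> arc_len h"
  defines "t2 \<equiv> (Phi a - Phi h) / L"
  shows "0 \<le> t2" "t2 \<le> 1"
    and "t \<in> {0..t2} \<Longrightarrow> Phi (x t + h) = Phi h + L * t \<and> y t = f (x t + h) - f h"
    and "t \<in> {t2..1} \<Longrightarrow> Phi (- x t - h) = Phi (- a) + L * (t - t2) \<and> y t = - f (- x t - h) - f h"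
proof -
  have L0: "L > 0" unfolding L_def by (rule arc_len_pos[OF h])
  have w0: "w h > 0" by (rule w_pos[OF h])
  have ar0: "area h > 0" using area_pos h by simp
  have len: "len = L"
  proof -
    have "len = integral {0..1::real} (\<lambda>t. L)" unfolding len_def
      by (rule integral_spike[of "{t. \<not> (t \<in> {0..1} \<longrightarrow> N (x' t, y' t) = L)}"])
         (use sp in \<open>simp_all add: AE_lborel_iff_negligible L_def\<close>)
    then show ?thesis by simp
  qed
  have LP: "len - h * P = 2 * area h" using len P by (simp add: L_def arc_len_def)
  obtain \<mu> where mu: "\<mu> > 0" and iso:
    "ar + \<mu>\<^sup>2 * area h < \<mu> * (len - h * P) \<or>
     (ar + \<mu>\<^sup>2 * area h \<le> \<mu> * (len - h * P) \<and>
      (\<forall>t\<in>{0..1}. x t / \<mu> + h \<in> {- a..a}) \<and> (\<exists>t2\<in>{0..1}. x t2 / \<mu> + h = a))"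
    by (rule isoperimetric[OF h]) (use P ar w0 ar0 in auto)
  \<comment> \<open>The gap in the isoperimetric inequality is a square in \<open>\<mu>\<close>.
    Hence the strict alternative is impossible and the remaining one forces
    \<open>\<mu> = 1\<close>.\<close>
  have sq: "ar + \<mu>\<^sup>2 * area h - \<mu> * (len - h * P) = area h * (1 - \<mu>)\<^sup>2"
    unfolding LP ar by (simp add: power2_eq_square algebra_simps)
  have "area h * (1 - \<mu>)\<^sup>2 \<ge> 0" using ar0 by simp
  then have c1: "ar + \<mu>\<^sup>2 * area h \<le> \<mu> * (len - h * P)"
    "\<forall>t\<in>{0..1}. x t / \<mu> + h \<in> {- a..a}" "\<exists>t2\<in>{0..1}. x t2 / \<mu> + h = a"
    using iso sq by auto
  then have "area h * (1 - \<mu>)\<^sup>2 = 0" using sq \<open>area h * (1 - \<mu>)\<^sup>2 \<ge> 0\<close> by linarith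
  then have mu1: "\<mu> = 1" using ar0 by simp
  define X where "X t = x t + h" for t
  have Xa: "X t \<in> {- a..a}" if "t \<in> {0..1}" for t using c1(2) that by (simp add: mu1 X_def)
  obtain tm where tm: "tm \<in> {0..1}" "X tm = a" using c1(3) by (auto simp: mu1 X_def)
  have tm01: "0 \<le> tm" "tm \<le> 1" using tm by auto
  have X01: "X 0 = h" "X 1 = h" using ends by (auto simp: X_def)
  have dX: "lip_deriv X x'" using lip_deriv_add[OF x lip_deriv_const[of h]] by (simp add: X_def[abs_def])
  have dmX: "lip_deriv (\<lambda>t. - X t) (\<lambda>t. - x' t)" using lip_deriv_cmult[OF dX, of "-1"] by simp
  have eqAE: "AE t in lborel. (t \<in> {0..tm} \<longrightarrow> N (x' t, y' t) - X t * y' t + f (X t) * x' t = 0)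
        \<and> (t \<in> {tm..1} \<longrightarrow> N (x' t, y' t) - X t * y' t + upper_f (X t) * x' t = 0)"
  proof -
    have "ar / 1 + h * P + 1 * area h = len" using LP ar by simp
    from schmidt_one(2)[of 1 h tm, OF _ _ _ _ this] Xa tm show ?thesis by (simp add: X_def)
  qed
  obtain MP where MP: "MP-lipschitz_on UNIV Phi" using Phi_lipschitz by blast
  obtain Mf where Mf: "Mf-lipschitz_on UNIV f" using f_lipschitz by blast
  have dPhi: "lip_deriv (\<lambda>t. Phi (X t)) (\<lambda>t. 1 / fst (act (X t)) * x' t)"
    by (rule lip_deriv_chain[OF dX kinks(1) _ MP]) (auto intro: Phi_deriv)
  have dPhi': "lip_deriv (\<lambda>t. Phi (- X t)) (\<lambda>t. 1 / fst (act (- X t)) * (- x' t))"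
    by (rule lip_deriv_chain[OF dmX kinks(1) _ MP]) (auto intro: Phi_deriv)
  have df: "lip_deriv (\<lambda>t. f (X t)) (\<lambda>t. slope (X t) * x' t)"
    by (rule lip_deriv_chain[OF dX kinks(1) _ Mf]) (auto intro: f_deriv)
  have df': "lip_deriv (\<lambda>t. f (- X t)) (\<lambda>t. slope (- X t) * (- x' t))"
    by (rule lip_deriv_chain[OF dmX kinks(1) _ Mf]) (auto intro: f_deriv)
  define p where "p t = 1 / fst (act (X t)) * x' t" for t
  define q where "q t = 1 / fst (act (- X t)) * (- x' t)" for t
  have actpos: "fst (act z) > 0" for z by (rule Sp_pos[OF act(1)])
  have lower: "AE t in lborel. t \<in> {0..tm} \<longrightarrow> p t \<le> L \<and> (p t = L \<longrightarrow> y' t - slope (X t) * x' t = 0)"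
    using eqAE sp lip_deriv_level_set[OF dX kinks(1)]
  proof eventually_elim
    case (elim t)
    show ?case
    proof
      assume t: "t \<in> {0..tm}"
      then have t01: "t \<in> {0..1}" using tm01 by auto
      have n: "N (x' t, y' t) = L" using elim t01 by (simp add: L_def)
      show "p t \<le> L \<and> (p t = L \<longrightarrow> y' t - slope (X t) * x' t = 0)"
      proof (cases "X t \<in> kinks")
        case True
        then have "x' t = 0" using elim t01 by blast
        then show ?thesis using L0 by (simp add: p_def)
      next
        case False
        then have "- a < X t" "X t < a" using Xa[OF t01] kinks(2,3) by (auto simp: less_le)
        moreover have "X t * snd (x' t, y' t) - f (X t) * fst (x' t, y' t) = N (x' t, y' t)" using elim t by simp
        ultimately have "(x' t, y' t) = N (x' t, y' t) *\<^sub>R act (X t)" using False n L0 by (intro cal_equality) auto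
        then have "x' t = L * fst (act (X t))" "y' t = L * snd (act (X t))" unfolding n by (auto simp: prod_eq_iff)
        then show ?thesis using actpos[of "X t"] by (simp add: p_def slope_def)
      qed
    qed
  qed
  have upper: "AE t in lborel. t \<in> {tm..1} \<longrightarrow> q t \<le> L \<and> (q t = L \<longrightarrow> y' t + slope (- X t) * (- x' t) = 0)"
    using eqAE sp lip_deriv_level_set[OF dX kinks(1)]
  proof eventually_elim
    case (elim t)
    show ?case
    proof
      assume t: "t \<in> {tm..1}"
      then have t01: "t \<in> {0..1}" using tm01 by auto
      have n: "N (x' t, y' t) = L" using elim t01 by (simp add: L_def)
      show "q t \<le> L \<and> (q t = L \<longrightarrow> y' t + slope (- X t) * (- x' t) = 0)"
      proof (cases "X t \<in> kinks")
        case True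
        then have "x' t = 0" using elim t01 by blast
        then show ?thesis using L0 by (simp add: q_def)
      next
        case False
        then have "- a < X t" "X t < a" using Xa[OF t01] kinks(2,3) by (auto simp: less_le)
        moreover have "X t * snd (x' t, y' t) + f (- X t) * fst (x' t, y' t) = N (x' t, y' t)"
          using elim t by (simp add: upper_f_def)
        ultimately have "(x' t, y' t) = - N (x' t, y' t) *\<^sub>R act (- X t)"
          using False n L0 by (intro cal_equality_upper) auto
        then have "x' t = - L * fst (act (- X t))" "y' t = - L * snd (act (- X t))" unfolding n by (auto simp: prod_eq_iff)
        then show ?thesis using actpos[of "- X t"] by (simp add: q_def slope_def)
      qed
    qed
  qed
  have Ip: "((\<lambda>t. L - p t) has_integral (L * (v - u) - (Phi (X v) - Phi (X u)))) {u..v}"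
    if "0 \<le> u" "u \<le> v" "v \<le> 1" for u v
    using has_integral_diff[OF has_integral_const_real[of L u v] lip_deriv_FTC[OF dPhi that]] that
    by (simp add: p_def mult.commute)
  have Iq: "((\<lambda>t. L - q t) has_integral (L * (v - u) - (Phi (- X v) - Phi (- X u)))) {u..v}"
    if "0 \<le> u" "u \<le> v" "v \<le> 1" for u v
    using has_integral_diff[OF has_integral_const_real[of L u v] lip_deriv_FTC[OF dPhi' that]] that
    by (simp add: q_def mult.commute)
  have nonneg: "0 \<le> i" if I: "(g has_integral i) {u..v}" and "AE t in lborel. t \<in> {u..v} \<longrightarrow> 0 \<le> g t"
    for g :: "real \<Rightarrow> real" and i u v
  proof -
    have "((\<lambda>t. max 0 (g t)) has_integral i) {u..v}"
      by (rule has_integral_spike[OF _ _ I, of "{t. \<not> (t \<in> {u..v} \<longrightarrow> 0 \<le> g t)}"])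
         (use that in \<open>auto simp: AE_lborel_iff_negligible\<close>)
    then show ?thesis by (rule has_integral_nonneg) simp
  qed
  have nnp: "0 \<le> L * (v - u) - (Phi (X v) - Phi (X u))" if "0 \<le> u" "u \<le> v" "v \<le> tm" for u v
  proof (rule nonneg[OF Ip])
    show "AE t in lborel. t \<in> {u..v} \<longrightarrow> 0 \<le> L - p t" using lower by eventually_elim (use that in auto)
  qed (use that tm01 in auto)
  have nnq: "0 \<le> L * (v - u) - (Phi (- X v) - Phi (- X u))" if "tm \<le> u" "u \<le> v" "v \<le> 1" for u v
  proof (rule nonneg[OF Iq])
    show "AE t in lborel. t \<in> {u..v} \<longrightarrow> 0 \<le> L - q t" using upper by eventually_elim (use that in auto)
  qed (use that tm01 in auto)
  have tot: "(L * (tm - 0) - (Phi (X tm) - Phi (X 0))) + (L * (1 - tm) - (Phi (- X 1) - Phi (- X tm))) = 0"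
    unfolding tm(2) X01 by (simp add: L_def arc_len_eq algebra_simps)
  have zp: "L * (tm - 0) - (Phi (X tm) - Phi (X 0)) = 0" and zq: "L * (1 - tm) - (Phi (- X 1) - Phi (- X tm)) = 0"
    using tot nnp[of 0 tm] nnq[of tm 1] tm01 by linarith+
  have pL: "AE t in lborel. t \<in> {0..tm} \<longrightarrow> L - p t = 0"
  proof (rule nonneg_has_integral_0_AE)
    show "((\<lambda>t. L - p t) has_integral 0) {0..tm}" using Ip[of 0 tm] zp tm01 by simp
    show "AE t in lborel. t \<in> {0..tm} \<longrightarrow> 0 \<le> L - p t" using lower by eventually_elim auto
  qed
  have qL: "AE t in lborel. t \<in> {tm..1} \<longrightarrow> L - q t = 0"
  proof (rule nonneg_has_integral_0_AE)
    show "((\<lambda>t. L - q t) has_integral 0) {tm..1}" using Iq[of tm 1] zq tm01 by simp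
    show "AE t in lborel. t \<in> {tm..1} \<longrightarrow> 0 \<le> L - q t" using upper by eventually_elim auto
  qed
  \<comment> \<open>The instant of touching came from an existence statement; the growth of
    \<open>Phi\<close> from \<open>h\<close> to \<open>a\<close> at speed \<open>L\<close>
    determines it.\<close>
  have tt: "tm = t2" using zp L0 unfolding tm(2) X01 t2_def by (simp add: field_simps)
  show "0 \<le> t2" "t2 \<le> 1" using tm01 tt by auto
  have low: "Phi (X t) = Phi h + L * t \<and> y t = f (X t) - f h" if t: "t \<in> {0..t2}" for t
  proof
    show "Phi (X t) = Phi h + L * t"
      using nnp[of 0 t] nnp[of t tm] zp t tt tm01 X01 by (simp add: algebra_simps)
    have "y t - f (X t) = y 0 - f (X 0)"
    proof (rule lip_deriv_zero_const[OF lip_deriv_diff[OF y df]])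
      show "AE s in lborel. s \<in> {0..t} \<longrightarrow> y' s - slope (X s) * x' s = 0"
        using lower pL by eventually_elim (use t tt in auto)
    qed (use t tt tm01 in auto)
    then show "y t = f (X t) - f h" using ends X01 by simp
  qed
  then show "t \<in> {0..t2} \<Longrightarrow> Phi (x t + h) = Phi h + L * t \<and> y t = f (x t + h) - f h" by (simp add: X_def)
  have "Phi (- X t) = Phi (- a) + L * (t - t2) \<and> y t = - f (- X t) - f h" if t: "t \<in> {t2..1}" for t
  proof
    show "Phi (- X t) = Phi (- a) + L * (t - t2)"
      using nnq[of tm t] nnq[of t 1] zq t tt tm01 tm(2) by (simp add: algebra_simps)
    have "y t + f (- X t) = y tm + f (- X tm)"
    proof (rule lip_deriv_zero_const[OF lip_deriv_add[OF y df']])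
      show "AE s in lborel. s \<in> {tm..t} \<longrightarrow> y' s + slope (- X s) * (- x' s) = 0"
        using upper qL by eventually_elim (use t tt in auto)
    qed (use t tt tm01 in auto)
    moreover have "y tm = f a - f h" using low[of tm] tm01 tt tm(2) by simp
    ultimately show "y t = - f (- X t) - f h" using tm(2) f_neg_a by simp
  qed
  then show "t \<in> {t2..1} \<Longrightarrow> Phi (- x t - h) = Phi (- a) + L * (t - t2) \<and> y t = - f (- x t - h) - f h"
    by (simp add: X_def)
qed

end

section \<open>Arcs of the isoperimetrix\<close>

lemma lip_deriv_component:
  assumes l: "bounded_linear l" and g: "admissible \<gamma>"
  shows "lip_deriv (\<lambda>t. l (\<gamma> t)) (\<lambda>t. l (vector_derivative \<gamma> (at t)))"
proof -
  obtain C where C: "C-lipschitz_on {0..1} \<gamma>" using g by (auto simp: admissible_iff)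
  obtain B where B: "B-lipschitz_on (\<gamma> ` {0..1}) l"
    using bounded_linear.lipschitz_boundE[OF l] by blast
  have "AE t in lborel. t \<in> {0..1} \<longrightarrow> ((\<lambda>t. l (\<gamma> t)) has_real_derivative l (vector_derivative \<gamma> (at t))) (at t)"
    using admissible_differentiable[OF g]
  proof eventually_elim
    case (elim t)
    then show ?case
      using bounded_linear.has_vector_derivative[OF l, of \<gamma> _ "at t"]
      by (auto simp: has_real_derivative_iff_has_vector_derivative vector_derivative_works)
  qed
  then show ?thesis using lipschitz_on_compose2[OF C B] unfolding lip_deriv_def by blast
qed

lemma bounded_linear_coords:
  "bounded_linear (fst :: heis \<Rightarrow> real)" "bounded_linear (\<lambda>p::heis. fst (snd p))"
  "bounded_linear (\<lambda>p::heis. snd (snd p))"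
  using bounded_linear_fst bounded_linear_snd bounded_linear_fst_comp bounded_linear_snd_comp by blast+

lemma admissible_height:
  assumes g: "admissible \<gamma>"
  shows "AE t in lborel. t \<in> {0..1} \<longrightarrow> snd (snd (vector_derivative \<gamma> (at t))) =
    1/2 * (fst (\<gamma> t) * fst (snd (vector_derivative \<gamma> (at t))) - fst (snd (\<gamma> t)) * fst (vector_derivative \<gamma> (at t)))"
proof -
  have "AE t in lborel. t \<in> {0..1} \<longrightarrow> horizontal_at \<gamma> t" using g by (simp add: admissible_iff)
  then show ?thesis by eventually_elim (simp add: horizontal_at_def)
qed

text \<open>Continuity and a bounded derivative off a finite set give the Lipschitz bound by
  integration.\<close>

lemma admissible_piecewise:
  fixes \<gamma> D :: "real \<Rightarrow> heis"
  assumes cont: "continuous_on {0..1} \<gamma>" and E: "finite E"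
    and D: "\<And>t. t \<in> {0<..<1} - E \<Longrightarrow> (\<gamma> has_vector_derivative D t) (at t)"
    and B: "\<And>t. t \<in> {0..1} \<Longrightarrow> norm (D t) \<le> B"
    and hor: "\<And>t. t \<in> {0<..<1} - E \<Longrightarrow>
      snd (snd (D t)) = 1/2 * (fst (\<gamma> t) * fst (snd (D t)) - fst (snd (\<gamma> t)) * fst (D t))"
  shows "admissible \<gamma>"
  unfolding admissible_iff
proof
  have B0: "B \<ge> 0" using order_trans[OF norm_ge_zero B[of 0]] by simp
  have "B-lipschitz_on {0..1} \<gamma>"
  proof (rule lipschitz_on_leI[OF _ B0])
    fix s t :: real assume st: "s \<in> {0..1}" "t \<in> {0..1}" "s \<le> t"
    have I: "(D has_integral (\<gamma> t - \<gamma> s)) {s..t}"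
      by (rule fundamental_theorem_of_calculus_interior_strong[OF E st(3)])
         (use st D in \<open>auto intro!: continuous_on_subset[OF cont]\<close>)
    have "norm (\<gamma> t - \<gamma> s) \<le> B * (t - s)"
      using has_integral_bound_real[OF B0 finite.emptyI I] B st by auto
    then show "dist (\<gamma> s) (\<gamma> t) \<le> B * dist s t"
      using st by (simp add: dist_norm norm_minus_commute dist_real_def)
  qed
  then show "\<exists>C. C-lipschitz_on {0..1} \<gamma>" by blast
  have "AE t in lborel. t \<notin> insert 0 (insert 1 E)"
    unfolding AE_lborel_iff_negligible using E by (intro negligible_finite) auto
  then show "AE t in lborel. t \<in> {0..1} \<longrightarrow> horizontal_at \<gamma> t"
  proof eventually_elim
    case (elim t)
    show ?case
    proof
      assume "t \<in> {0..1}"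
      then have t: "t \<in> {0<..<1} - E" using elim by auto
      show "horizontal_at \<gamma> t"
        unfolding horizontal_at_def vector_derivative_at[OF D[OF t]]
        using hor[OF t] differentiableI_vector[OF D[OF t]] by blast
    qed
  qed
qed

context vertical_polygon begin

text \<open>Adding half the derivative of \<open>x * y\<close> turns the height rate
  \<open>1/2 * (x * y' - y * x')\<close> into \<open>x * y'\<close>. The product vanishes at both
  ends because the endpoint lies over the \<open>y\<close>-axis.\<close>

lemma planar_projection:
  assumes g: "admissible \<gamma>" "\<gamma> 0 = hzero" "\<gamma> 1 = (0, P, z)"
  shows "planar_curve S Q (\<lambda>t. fst (\<gamma> t)) (\<lambda>t. fst (vector_derivative \<gamma> (at t)))
     (\<lambda>t. fst (snd (\<gamma> t))) (\<lambda>t. fst (snd (vector_derivative \<gamma> (at t)))) P"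
    and "planar_curve.ar (\<lambda>t. fst (\<gamma> t)) (\<lambda>t. fst (snd (vector_derivative \<gamma> (at t)))) = z"
    and "planar_curve.len Q (\<lambda>t. fst (vector_derivative \<gamma> (at t)))
      (\<lambda>t. fst (snd (vector_derivative \<gamma> (at t)))) = cc_length Q \<gamma>"
proof -
  let ?x = "\<lambda>t. fst (\<gamma> t)" and ?x' = "\<lambda>t. fst (vector_derivative \<gamma> (at t))"
    and ?y = "\<lambda>t. fst (snd (\<gamma> t))" and ?y' = "\<lambda>t. fst (snd (vector_derivative \<gamma> (at t)))"
  have x: "lip_deriv ?x ?x'" and y: "lip_deriv ?y ?y'" and z: "lip_deriv (\<lambda>t. snd (snd (\<gamma> t))) (\<lambda>t. snd (snd (vector_derivative \<gamma> (at t))))"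
    using lip_deriv_component[OF _ g(1)] bounded_linear_coords by auto
  show pc: "planar_curve S Q ?x ?x' ?y ?y' P"
    by unfold_locales (use x y g in \<open>auto simp: hzero_def\<close>)
  interpret planar_curve S Q ?x ?x' ?y ?y' P by (rule pc)
  show "len = cc_length Q \<gamma>" by (simp add: len_def cc_length_def hproj_def)
  have "((\<lambda>t. snd (snd (vector_derivative \<gamma> (at t))) + 1/2 * (?x t * ?y' t + ?x' t * ?y t)) has_integral z + 1/2 * 0) {0..1}"
    by (intro has_integral_add has_integral_mult_right)
       (use lip_deriv_FTC[OF z, of 0 1] lip_deriv_FTC[OF lip_deriv_mult[OF x y], of 0 1] g in \<open>simp_all add: hzero_def\<close>)
  then have I: "((\<lambda>t. snd (snd (vector_derivative \<gamma> (at t))) + 1/2 * (?x t * ?y' t + ?x' t * ?y t)) has_integral z) {0..1}" by simp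
  let ?P = "\<lambda>t. t \<in> {0..1} \<longrightarrow> snd (snd (vector_derivative \<gamma> (at t))) = 1/2 * (?x t * ?y' t - ?y t * ?x' t)"
  have "negligible {t. \<not> ?P t}" using admissible_height[OF g(1)] by (simp only: AE_lborel_iff_negligible)
  then have "((\<lambda>t. ?x t * ?y' t) has_integral z) {0..1}"
    by (rule has_integral_spike[OF _ _ I]) (simp add: field_simps)
  then show "ar = z" unfolding ar_def by (rule integral_unique)
qed

section \<open>Arc length parametrization by the inverse of \<open>Phi\<close>\<close>

definition "Xi s = (SOME x. Phi x = s)"

lemma Phi_Xi: "Phi (Xi s) = s"
proof -
  obtain m M where m: "m > 0" "\<And>x y. x \<le> y \<Longrightarrow> m * (y - x) \<le> Phi y - Phi x" by (rule Phi_bounds) blast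
  define b where "b = \<bar>s - Phi 0\<bar> / m"
  have b: "b \<ge> 0" "m * b = \<bar>s - Phi 0\<bar>" using m(1) by (auto simp: b_def)
  have "Phi (- b) \<le> s" "s \<le> Phi b" using m(2)[of 0 b] m(2)[of "- b" 0] b by auto
  then have "\<exists>x. Phi x = s" using IVT'[of Phi "- b" s b] b(1) Phi_continuous by auto
  then show ?thesis unfolding Xi_def by (rule someI_ex)
qed

lemma Xi_Phi: "Xi (Phi x) = x"
  using Phi_Xi[of "Phi x"] by (simp add: Phi_inj)

lemma Xi_le_iff: "Xi s \<le> Xi t \<longleftrightarrow> s \<le> t"
  using Phi_le_iff[of "Xi s" "Xi t"] by (simp add: Phi_Xi)

lemma Xi_continuous: "continuous_on UNIV Xi"
proof -
  obtain m M where m: "m > 0" "\<And>x y. x \<le> y \<Longrightarrow> m * (y - x) \<le> Phi y - Phi x" by (rule Phi_bounds) blast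
  have "(1 / m)-lipschitz_on UNIV Xi"
  proof (rule lipschitz_on_leI)
    fix s t :: real assume st: "s \<le> t"
    then have "Xi s \<le> Xi t" by (simp add: Xi_le_iff)
    from m(2)[OF this] show "dist (Xi s) (Xi t) \<le> 1 / m * dist s t"
      using m(1) st Xi_le_iff[of s t] by (simp add: Phi_Xi dist_real_def field_simps)
  qed (use m in simp)
  then show ?thesis by (rule lipschitz_on_continuous_on)
qed

lemma Xi_deriv:
  assumes "Xi s \<notin> kinks" shows "(Xi has_real_derivative fst (act (Xi s))) (at s)"
proof -
  have p: "fst (act (Xi s)) > 0" by (rule Sp_pos[OF act(1)])
  have "(Xi has_real_derivative inverse (1 / fst (act (Xi s)))) (at s)"
    by (rule DERIV_inverse_function[where f = Phi and a = "s - 1" and b = "s + 1"])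
       (use Phi_deriv[OF assms] p Phi_Xi Xi_continuous in \<open>auto simp: continuous_on_eq_continuous_at\<close>)
  then show ?thesis by simp
qed

lemma Xi_comp_deriv:
  assumes "Xi (c + L * t) \<notin> kinks"
  shows "((\<lambda>t. Xi (c + L * t)) has_real_derivative L * fst (act (Xi (c + L * t)))) (at t)"
proof -
  have "((\<lambda>t. c + L * t) has_real_derivative L) (at t)" by (auto intro!: derivative_eq_intros)
  from DERIV_chain2[OF Xi_deriv[OF assms] this] show ?thesis by (simp add: mult.commute)
qed

text \<open>\<open>lower_pt h u\<close> is the horizontal lift of the planar point \<open>(u - h, f u - f h)\<close> of the lower
  boundary, the lift being primitive in \<open>u\<close>; \<open>upper_pt\<close> continues it along the upper boundary,
  which is the point reflection of the lower one.\<close>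
definition lower_pt :: "real \<Rightarrow> real \<Rightarrow> heis" where
  "lower_pt h u = (u - h, f u - f h, 1/2 * ((u - h) * f u - 2 * F u + 2 * F h + f h * (u - h)))"

definition upper_pt :: "real \<Rightarrow> real \<Rightarrow> heis" where
  "upper_pt h v = (- v - h, - f v - f h,
     1/2 * ((a - h) * f a - 2 * F a + 2 * F h + f h * (a - h))
     + 1/2 * (((v + h) * f v - 2 * F v - f h * v) - ((h - a) * f (- a) - 2 * F (- a) + f h * a)))"

lemma lower_pt_deriv:
  assumes u: "(u has_real_derivative L * fst (act (u t))) (at t)" and k: "u t \<notin> kinks"
  defines "s \<equiv> act (u t)"
  shows "((\<lambda>t. lower_pt h (u t)) has_vector_derivative
     (L * fst s, L * snd s, 1/2 * ((u t - h) * (L * snd s) - (f (u t) - f h) * (L * fst s)))) (at t)"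
proof -
  have p: "fst s > 0" unfolding s_def by (rule Sp_pos[OF act(1)])
  have fu: "((\<lambda>t. f (u t)) has_real_derivative L * snd s) (at t)"
    using DERIV_chain2[OF f_deriv[OF k] u] p by (simp add: slope_def s_def mult.commute)
  have Fu: "((\<lambda>t. F (u t)) has_real_derivative f (u t) * (L * fst s)) (at t)"
    using DERIV_chain2[OF F_deriv u] by (simp add: s_def)
  note [derivative_intros] = u[folded s_def] fu Fu
  have 1: "((\<lambda>t. u t - h) has_real_derivative L * fst s) (at t)"
   and 2: "((\<lambda>t. f (u t) - f h) has_real_derivative L * snd s) (at t)"
   and 3: "((\<lambda>t. 1/2 * ((u t - h) * f (u t) - 2 * F (u t) + 2 * F h + f h * (u t - h))) has_real_derivative
       1/2 * ((u t - h) * (L * snd s) - (f (u t) - f h) * (L * fst s))) (at t)"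
    by (auto intro!: derivative_eq_intros simp: algebra_simps)
  show ?thesis unfolding lower_pt_def
    by (intro has_vector_derivative_Pair; use 1 2 3 in \<open>simp add: has_real_derivative_iff_has_vector_derivative\<close>)
qed

lemma upper_pt_deriv:
  assumes u: "(u has_real_derivative L * fst (act (u t))) (at t)" and k: "u t \<notin> kinks"
  defines "s \<equiv> act (u t)"
  shows "((\<lambda>t. upper_pt h (u t)) has_vector_derivative
     (- L * fst s, - L * snd s, 1/2 * ((- u t - h) * (- L * snd s) - (- f (u t) - f h) * (- L * fst s)))) (at t)"
proof -
  have p: "fst s > 0" unfolding s_def by (rule Sp_pos[OF act(1)])
  have fu: "((\<lambda>t. f (u t)) has_real_derivative L * snd s) (at t)"
    using DERIV_chain2[OF f_deriv[OF k] u] p by (simp add: slope_def s_def mult.commute)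
  have Fu: "((\<lambda>t. F (u t)) has_real_derivative f (u t) * (L * fst s)) (at t)"
    using DERIV_chain2[OF F_deriv u] by (simp add: s_def)
  note [derivative_intros] = u[folded s_def] fu Fu
  have 1: "((\<lambda>t. - u t - h) has_real_derivative - L * fst s) (at t)"
   and 2: "((\<lambda>t. - f (u t) - f h) has_real_derivative - L * snd s) (at t)"
   and 3: "((\<lambda>t. 1/2 * ((a - h) * f a - 2 * F a + 2 * F h + f h * (a - h))
     + 1/2 * (((u t + h) * f (u t) - 2 * F (u t) - f h * u t) - ((h - a) * f (- a) - 2 * F (- a) + f h * a))) has_real_derivative
       1/2 * ((- u t - h) * (- L * snd s) - (- f (u t) - f h) * (- L * fst s))) (at t)"
    by (auto intro!: derivative_eq_intros simp: algebra_simps)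
  show ?thesis unfolding upper_pt_def
    by (intro has_vector_derivative_Pair; use 1 2 3 in \<open>simp add: has_real_derivative_iff_has_vector_derivative\<close>)
qed

text \<open>The planar curve runs counterclockwise from the chord to the right corner and back, with
  constant speed. On the way back the parameter of the reflected lower graph rises from
  \<open>- a\<close> to \<open>- h\<close>.\<close>

definition iso_arc :: "real \<Rightarrow> real \<Rightarrow> heis" where
  "iso_arc h t = (let L = arc_len h; t2 = (Phi a - Phi h) / L in
     if t \<le> t2 then lower_pt h (Xi (Phi h + L * t))
     else upper_pt h (Xi (Phi (- a) + L * (t - t2))))"

lemma iso_arc_geodesic:
  assumes h: "- a < h" "h < a"
  shows "admissible (iso_arc h)" "iso_arc h 0 = hzero" "iso_arc h 1 = (0, w h, area h)"
    and "AE t in lborel. t \<in> {0..1} \<longrightarrow> N (hproj (vector_derivative (iso_arc h) (at t))) = arc_len h"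
proof -
  define L where "L = arc_len h"
  define t2 where "t2 = (Phi a - Phi h) / L"
  define u where "u t = Xi (Phi h + L * t)" for t
  define c where "c = Phi (- a) - L * t2"
  define v where "v t = Xi (c + L * t)" for t
  have L0: "L > 0" unfolding L_def by (rule arc_len_pos[OF h])
  have t2L: "L * t2 = Phi a - Phi h" using L0 by (simp add: t2_def)
  have Lt2: "L * (1 - t2) = Phi (- h) - Phi (- a)"
    using t2L by (simp add: L_def arc_len_eq right_diff_distrib)
  have t2: "0 \<le> t2" "t2 \<le> 1"
    using h Phi_le_iff[of h a] Phi_le_iff[of "- a" "- h"] L0
    by (simp_all add: t2_def L_def arc_len_eq divide_le_eq)
  have arc: "iso_arc h t = (if t \<le> t2 then lower_pt h (u t) else upper_pt h (v t))" for t
    by (simp add: iso_arc_def Let_def L_def[symmetric] t2_def[symmetric] u_def v_def c_def algebra_simps)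
  have u2: "u t2 = a" by (simp add: u_def t2L Xi_Phi)
  have v2: "v t2 = - a" by (simp add: v_def c_def Xi_Phi)
  have u0: "u 0 = h" by (simp add: u_def Xi_Phi)
  have v1: "v 1 = - h"
  proof -
    have "c + L * 1 = Phi (- h)" using Lt2 by (simp add: c_def algebra_simps)
    then show ?thesis by (simp only: v_def Xi_Phi)
  qed
  \<comment> \<open>The constant in the height of \<open>upper_pt\<close> is the height of
    \<open>lower_pt h a\<close>, so the lifts agree at the right corner.\<close>
  have glue: "lower_pt h a = upper_pt h (- a)"
    by (simp add: lower_pt_def upper_pt_def f_neg_a)
  show "iso_arc h 0 = hzero" unfolding arc using t2 u0 by (simp add: lower_pt_def hzero_def)
  have up1: "upper_pt h (- h) = (0, w h, area h)"
    by (simp add: upper_pt_def w_def area_def f_neg_a algebra_simps add_divide_distrib diff_divide_distrib)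
  show "iso_arc h 1 = (0, w h, area h)"
  proof (cases "t2 = 1")
    case True
    have "upper_pt h (- a) = (0, w h, area h)" using v1 v2 True up1 by simp
    then show ?thesis unfolding arc using True u2 glue by simp
  next
    case False
    then show ?thesis unfolding arc using t2 v1 up1 by simp
  qed
  have contu: "continuous_on A u" for A unfolding u_def
    by (rule continuous_on_compose2[OF Xi_continuous]) (auto intro!: continuous_intros)
  have contv: "continuous_on A v" for A unfolding v_def
    by (rule continuous_on_compose2[OF Xi_continuous]) (auto intro!: continuous_intros)
  have cf: "continuous_on A (\<lambda>t. f (g t))" "continuous_on A (\<lambda>t. F (g t))" if "continuous_on A g" for A and g :: "real \<Rightarrow> real"
    using that continuous_on_compose2[OF f_continuous[of UNIV]] continuous_on_compose2[OF F_continuous[of UNIV]] by auto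
  have cl: "continuous_on {..t2} (\<lambda>t. lower_pt h (u t))" unfolding lower_pt_def
    by (intro continuous_intros cf contu)
  have cu: "continuous_on {t2..} (\<lambda>t. upper_pt h (v t))" unfolding upper_pt_def
    by (intro continuous_intros cf contv)
  have "continuous_on ({..t2} \<union> {t2..}) (\<lambda>t. if t \<le> t2 then lower_pt h (u t) else upper_pt h (v t))"
    by (rule continuous_on_If) (use cl cu u2 v2 glue in auto)
  then have cont: "continuous_on A (iso_arc h)" for A
    unfolding arc[abs_def] by (rule continuous_on_subset) auto
  \<comment> \<open>The turning time and all times at which either parameter meets a kink; elsewhere
    both velocity formulas apply.\<close>
  define E where "E = insert t2 ((\<lambda>k. (Phi k - Phi h) / L) ` kinks \<union> (\<lambda>k. (Phi k - c) / L) ` kinks)"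
  have E: "finite E" using kinks(1) by (simp add: E_def)
  have uk: "u t \<notin> kinks" if "t \<notin> E" for t
  proof
    assume "u t \<in> kinks"
    moreover have "t = (Phi (u t) - Phi h) / L" using L0 by (simp add: u_def Phi_Xi)
    ultimately show False using that by (auto simp: E_def)
  qed
  have vk: "v t \<notin> kinks" if "t \<notin> E" for t
  proof
    assume "v t \<in> kinks"
    moreover have "t = (Phi (v t) - c) / L" using L0 by (simp add: v_def Phi_Xi)
    ultimately show False using that by (auto simp: E_def)
  qed
  define D1 where "D1 t = (if t \<le> t2 then L *\<^sub>R act (u t) else - L *\<^sub>R act (v t))" for t
  define D where "D t = (fst (D1 t), snd (D1 t),
    1/2 * (fst (iso_arc h t) * snd (D1 t) - fst (snd (iso_arc h t)) * fst (D1 t)))" for t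
  have der: "(iso_arc h has_vector_derivative D t) (at t)" if "t \<notin> E" for t
  proof (cases "t < t2")
    case True
    have "((\<lambda>t. lower_pt h (u t)) has_vector_derivative D t) (at t)"
      using lower_pt_deriv[OF Xi_comp_deriv[of "Phi h" L t, folded u_def] , of h] uk[OF that] True
      by (simp add: D_def D1_def arc lower_pt_def u_def)
    then show ?thesis
      by (rule has_vector_derivative_transform_within_open[of _ _ _ "{..<t2}"]) (use True arc in auto)
  next
    case False
    then have t: "t > t2" using that by (auto simp: E_def)
    have "((\<lambda>t. upper_pt h (v t)) has_vector_derivative D t) (at t)"
      using upper_pt_deriv[OF Xi_comp_deriv[of c L t, folded v_def], of h] vk[OF that] t
      by (simp add: D_def D1_def arc upper_pt_def v_def)
    then show ?thesis
      by (rule has_vector_derivative_transform_within_open[of _ _ _ "{t2<..}"]) (use t arc in auto)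
  qed
  have "compact (iso_arc h ` {0..1})" using cont by (intro compact_continuous_image) auto
  then have "bounded (iso_arc h ` {0..1})" by (rule compact_imp_bounded)
  then obtain B where "\<forall>p\<in>iso_arc h ` {0..1}. norm p \<le> B" unfolding bounded_iff by (elim exE)
  then have B: "norm (iso_arc h t) \<le> B" if "t \<in> {0..1}" for t using that by blast
  define C where "C = Max (norm ` Sp)"
  have C: "norm s \<le> C" if "s \<in> Sp" for s unfolding C_def using that finSp by (intro Max_ge) auto
  have D1C: "norm (D1 t) \<le> L * C" for t
    using C[OF act(1)] L0 by (auto simp: D1_def)
  have bound: "norm (D t) \<le> L * C + (L * C + 1/2 * (B * (L * C) + B * (L * C)))" if t: "t \<in> {0..1}" for t
  proof -
    have n1: "\<bar>fst (D1 t)\<bar> \<le> L * C" "\<bar>snd (D1 t)\<bar> \<le> L * C"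
      using D1C[of t] norm_fst_le[of "fst (D1 t)" "snd (D1 t)"] norm_snd_le[of "snd (D1 t)" "fst (D1 t)"] by auto
    have n2: "\<bar>fst (iso_arc h t)\<bar> \<le> B" "\<bar>fst (snd (iso_arc h t))\<bar> \<le> B"
    proof -
      obtain p q r where pqr: "iso_arc h t = (p, q, r)" by (cases "iso_arc h t")
      have "norm (p, q, r) \<le> B" using B[OF t] pqr by simp
      moreover have "\<bar>p\<bar> \<le> norm (p, q, r)" using norm_fst_le[of p "(q, r)"] by simp
      moreover have "\<bar>q\<bar> \<le> norm (p, q, r)"
        using norm_snd_le[of "(q, r)" p] norm_fst_le[of q r] by simp
      ultimately show "\<bar>fst (iso_arc h t)\<bar> \<le> B" "\<bar>fst (snd (iso_arc h t))\<bar> \<le> B" using pqr by auto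
    qed
    have B0: "0 \<le> B" "0 \<le> L * C" using n1(1) n2(1) by auto
    have "\<bar>fst (iso_arc h t) * snd (D1 t) - fst (snd (iso_arc h t)) * fst (D1 t)\<bar>
      \<le> \<bar>fst (iso_arc h t)\<bar> * \<bar>snd (D1 t)\<bar> + \<bar>fst (snd (iso_arc h t))\<bar> * \<bar>fst (D1 t)\<bar>"
      by (simp only: abs_mult[symmetric] abs_triangle_ineq4)
    also have "\<dots> \<le> B * (L * C) + B * (L * C)"
      using n1 n2 B0 by (intro add_mono mult_mono) auto
    finally have n3: "\<bar>1/2 * (fst (iso_arc h t) * snd (D1 t) - fst (snd (iso_arc h t)) * fst (D1 t))\<bar> \<le> 1/2 * (B * (L * C) + B * (L * C))"
      by simp
    show ?thesis unfolding D_def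
      by (intro norm_Pair_le[THEN order_trans] add_mono) (use n1 n3 in simp_all)
  qed
  show "admissible (iso_arc h)"
    by (rule admissible_piecewise[OF cont E der bound]) (auto simp: D_def)
  have "AE t in lborel. t \<notin> E"
    unfolding AE_lborel_iff_negligible using E by (intro negligible_finite) auto
  then show "AE t in lborel. t \<in> {0..1} \<longrightarrow> N (hproj (vector_derivative (iso_arc h) (at t))) = arc_len h"
  proof eventually_elim
    case (elim t)
    show ?case
    proof
      assume t: "t \<in> {0..1}"
      have "hproj (D t) = D1 t" by (simp add: hproj_def D_def)
      moreover have "N (D1 t) = L"
      proof (cases "t \<le> t2")
        case True
        have "u t \<le> u t2" using True L0 by (simp add: u_def Xi_le_iff)
        moreover have "u 0 \<le> u t" using t L0 by (simp add: u_def Xi_le_iff)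
        ultimately have "N (act (u t)) = 1" using u2 u0 h by (intro N_act) auto
        then show ?thesis using True L0 Lnorm_scale[OF Q, of L "act (u t)"] by (simp add: D1_def)
      next
        case False
        have "v t2 \<le> v t" using False L0 by (simp add: v_def Xi_le_iff)
        moreover have "v t \<le> v 1" using t L0 by (simp add: v_def Xi_le_iff)
        ultimately have "N (act (v t)) = 1" using v2 v1 h by (intro N_act) auto
        then show ?thesis using False L0 Lnorm_scale[OF Q, of L "act (v t)"]
          by (simp add: D1_def Lnorm_minus[OF Q])
      qed
      ultimately show "N (hproj (vector_derivative (iso_arc h) (at t))) = arc_len h"
        unfolding vector_derivative_at[OF der[OF elim]] by (simp add: L_def)
    qed
  qed
qed

end

section \<open>Unique and non-unique geodesics\<close>

lemma lip_deriv_unique: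
  assumes "lip_deriv g g'" "lip_deriv k k'" "\<And>t. t \<in> {0..1} \<Longrightarrow> g t = k t"
  shows "AE t in lborel. t \<in> {0..1} \<longrightarrow> g' t = k' t"
  using lip_deriv_AE[OF assms(1)] lip_deriv_AE[OF assms(2)] AE_interior_01
proof eventually_elim
  case (elim t)
  show ?case
  proof
    assume t: "t \<in> {0..1}"
    have "(k has_real_derivative g' t) (at t)"
      by (rule has_field_derivative_transform_within_open[of g _ _ "{0<..<1}"]) (use elim t assms(3) in auto)
    then show "g' t = k' t" using elim t DERIV_unique by blast
  qed
qed

text \<open>Equal planar projections have equal velocities almost everywhere, hence equal height
  rates, and the heights agree at time 0.\<close>

lemma admissible_eq_if_planar_eq:
  assumes g: "admissible \<gamma>" and e: "admissible \<eta>" and "\<gamma> 0 = \<eta> 0"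
    and x: "\<And>t. t \<in> {0..1} \<Longrightarrow> fst (\<gamma> t) = fst (\<eta> t)"
    and y: "\<And>t. t \<in> {0..1} \<Longrightarrow> fst (snd (\<gamma> t)) = fst (snd (\<eta> t))"
    and t: "t \<in> {0..1}"
  shows "\<gamma> t = \<eta> t"
proof -
  note lg = lip_deriv_component[OF _ g] and le = lip_deriv_component[OF _ e]
  let ?z = "\<lambda>\<gamma> t. snd (snd (vector_derivative \<gamma> (at t))) :: real"
  have x': "AE t in lborel. t \<in> {0..1} \<longrightarrow> fst (vector_derivative \<gamma> (at t)) = fst (vector_derivative \<eta> (at t))"
    by (rule lip_deriv_unique[OF lg[OF bounded_linear_coords(1)] le[OF bounded_linear_coords(1)]]) (rule x)
  have y': "AE t in lborel. t \<in> {0..1} \<longrightarrow> fst (snd (vector_derivative \<gamma> (at t))) = fst (snd (vector_derivative \<eta> (at t)))"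
    by (rule lip_deriv_unique[OF lg[OF bounded_linear_coords(2)] le[OF bounded_linear_coords(2)]]) (rule y)
  have "AE t in lborel. t \<in> {0..1} \<longrightarrow> ?z \<gamma> t - ?z \<eta> t = 0"
    using admissible_height[OF g] admissible_height[OF e] x' y'
    by eventually_elim (auto simp: x y)
  then have "AE s in lborel. s \<in> {0..t} \<longrightarrow> ?z \<gamma> s - ?z \<eta> s = 0"
    by eventually_elim (use t in auto)
  then have "snd (snd (\<gamma> t)) - snd (snd (\<eta> t)) = snd (snd (\<gamma> 0)) - snd (snd (\<eta> 0))"
    using t by (intro lip_deriv_zero_const[OF lip_deriv_diff[OF lg[OF bounded_linear_coords(3)] le[OF bounded_linear_coords(3)]]]) auto
  then show ?thesis using x[OF t] y[OF t] assms(3) by (simp add: prod_eq_iff)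
qed

context vertical_polygon begin

text \<open>Replacing \<open>area h + \<mu>\<^sup>2 * area h\<close> by its lower bound
  \<open>2 * \<mu> * area h\<close> cancels \<open>\<mu>\<close> and leaves exactly
  \<open>arc_len h\<close>.\<close>

lemma cc_length_ge_arc_len:
  assumes h: "- a < h" "h < a" and g: "admissible \<gamma>" "\<gamma> 0 = hzero" "\<gamma> 1 = (0, w h, area h)"
  shows "arc_len h \<le> cc_length Q \<gamma>"
proof -
  interpret planar_curve S Q "\<lambda>t. fst (\<gamma> t)" "\<lambda>t. fst (vector_derivative \<gamma> (at t))"
    "\<lambda>t. fst (snd (\<gamma> t))" "\<lambda>t. fst (snd (vector_derivative \<gamma> (at t)))" "w h"
    using planar_projection(1)[OF g] .
  have ar: "ar = area h" and len: "len = cc_length Q \<gamma>"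
    using planar_projection(2,3)[OF g] .
  obtain \<mu> where mu: "\<mu> > 0" and iso: "ar + \<mu>\<^sup>2 * area h \<le> \<mu> * (len - h * w h)"
    by (rule isoperimetric[OF h]) (use w_pos[OF h] area_pos[of h] h ar in auto)
  have "\<mu> * (len - arc_len h) = \<mu> * (len - h * w h) - (ar + \<mu>\<^sup>2 * area h) + area h * (1 - \<mu>)\<^sup>2"
    unfolding ar by (simp add: arc_len_def power2_eq_square algebra_simps)
  then have "\<mu> * (len - arc_len h) \<ge> 0" using iso area_pos[of h] h by simp
  then show ?thesis using mu len by (simp add: zero_le_mult_iff)
qed

lemma dCC_arc:
  assumes h: "- a < h" "h < a"
  shows "dCC Q hzero (0, w h, area h) = arc_len h"
proof (rule antisym)
  show "dCC Q hzero (0, w h, area h) \<le> arc_len h"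
    using dCC_le[OF Q iso_arc_geodesic(1-3)[OF h]] cc_length_const_speed[OF iso_arc_geodesic(4)[OF h]] by simp
  show "arc_len h \<le> dCC Q hzero (0, w h, area h)"
    by (rule dCC_ge) (rule cc_length_ge_arc_len[OF h])
qed

lemma geodesic_arc:
  assumes h: "- a < h" "h < a" shows "cc_geodesic Q hzero (0, w h, area h) (iso_arc h)"
  using iso_arc_geodesic[OF h] cc_length_const_speed[OF iso_arc_geodesic(4)[OF h]] dCC_arc[OF h]
  by (simp add: cc_geodesic_def)

lemma geodesic_structure:
  assumes h: "- a < h" "h < a" and "cc_geodesic Q hzero (0, w h, area h) \<gamma>"
  defines "t2 \<equiv> (Phi a - Phi h) / arc_len h"
  shows "t \<in> {0..t2} \<Longrightarrow> Phi (fst (\<gamma> t) + h) = Phi h + arc_len h * t \<and> fst (snd (\<gamma> t)) = f (fst (\<gamma> t) + h) - f h"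
    and "t \<in> {t2..1} \<Longrightarrow> Phi (- fst (\<gamma> t) - h) = Phi (- a) + arc_len h * (t - t2) \<and> fst (snd (\<gamma> t)) = - f (- fst (\<gamma> t) - h) - f h"
proof -
  have g: "admissible \<gamma>" "\<gamma> 0 = hzero" "\<gamma> 1 = (0, w h, area h)"
    and sp: "AE t in lborel. t \<in> {0..1} \<longrightarrow> N (hproj (vector_derivative \<gamma> (at t))) = arc_len h"
    using assms(3) dCC_arc[OF h] by (auto simp: cc_geodesic_def)
  interpret planar_curve S Q "\<lambda>t. fst (\<gamma> t)" "\<lambda>t. fst (vector_derivative \<gamma> (at t))"
    "\<lambda>t. fst (snd (\<gamma> t))" "\<lambda>t. fst (snd (vector_derivative \<gamma> (at t)))" "w h"
    using planar_projection(1)[OF g] .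
  note ts = tight_structure[OF h refl planar_projection(2)[OF g] sp[unfolded hproj_def]]
  show "t \<in> {0..t2} \<Longrightarrow> Phi (fst (\<gamma> t) + h) = Phi h + arc_len h * t \<and> fst (snd (\<gamma> t)) = f (fst (\<gamma> t) + h) - f h"
    unfolding t2_def by (rule ts(3))
  show "t \<in> {t2..1} \<Longrightarrow> Phi (- fst (\<gamma> t) - h) = Phi (- a) + arc_len h * (t - t2) \<and> fst (snd (\<gamma> t)) = - f (- fst (\<gamma> t) - h) - f h"
    unfolding t2_def by (rule ts(4))
qed

text \<open>Every geodesic, and in particular \<open>iso_arc h\<close>, satisfies the equations of
  \<open>geodesic_structure\<close>. As \<open>Phi\<close> is injective, these determine the planar
  curve.\<close>

lemma unique_geodesic_arc:
  assumes h: "- a < h" "h < a" shows "unique_geodesic Q hzero (0, w h, area h)"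
  unfolding unique_geodesic_def
proof (intro exI conjI allI impI ballI)
  show G: "cc_geodesic Q hzero (0, w h, area h) (iso_arc h)" by (rule geodesic_arc[OF h])
  fix \<eta> and t :: real
  assume e: "cc_geodesic Q hzero (0, w h, area h) \<eta>" and t: "t \<in> {0..1}"
  have "fst (\<eta> t) = fst (iso_arc h t) \<and> fst (snd (\<eta> t)) = fst (snd (iso_arc h t))" if "t \<in> {0..1}" for t
  proof (cases "t \<le> (Phi a - Phi h) / arc_len h")
    case True
    then have t: "t \<in> {0..(Phi a - Phi h) / arc_len h}" using that by auto
    have "Phi (fst (\<eta> t) + h) = Phi (fst (iso_arc h t) + h)"
      using geodesic_structure(1)[OF h e t] geodesic_structure(1)[OF h G t] by simp
    then have "fst (\<eta> t) = fst (iso_arc h t)" by (simp add: Phi_inj)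
    then show ?thesis using geodesic_structure(1)[OF h e t] geodesic_structure(1)[OF h G t] by simp
  next
    case False
    then have t: "t \<in> {(Phi a - Phi h) / arc_len h..1}" using that by auto
    have "Phi (- fst (\<eta> t) - h) = Phi (- fst (iso_arc h t) - h)"
      using geodesic_structure(2)[OF h e t] geodesic_structure(2)[OF h G t] by simp
    then have "fst (\<eta> t) = fst (iso_arc h t)" by (simp add: Phi_inj)
    then show ?thesis using geodesic_structure(2)[OF h e t] geodesic_structure(2)[OF h G t] by simp
  qed
  then have planar: "fst (\<eta> s) = fst (iso_arc h s)" "fst (snd (\<eta> s)) = fst (snd (iso_arc h s))" if "s \<in> {0..1}" for s
    using that by blast+
  have ad: "admissible \<eta>" "admissible (iso_arc h)" "\<eta> 0 = iso_arc h 0" using G e by (simp_all add: cc_geodesic_def)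
  show "\<eta> t = iso_arc h t"
    by (rule admissible_eq_if_planar_eq[OF ad planar t])
qed

end

text \<open>The segment along \<open>u\<close> is cut in the proportion \<open>\<theta>\<close> and
  the whole segment along \<open>v\<close> is inserted at the cut. The planar endpoint and the
  length do not change, while the height is affine in \<open>\<theta>\<close> and sweeps the
  interval between the two orders of the edges. The last property serves to tell two such curves
  apart.\<close>

lemma two_edge_curve:
  assumes Q: "sym_polygon Q" and ab: "\<alpha> > 0" "\<beta> > 0" and th: "0 < \<theta>" "\<theta> < 1"
    and N: "Lnorm Q u = 1" "Lnorm Q v = 1"
  obtains \<gamma> where "admissible \<gamma>" "\<gamma> 0 = hzero"
    "\<gamma> 1 = (\<alpha> * fst u + \<beta> * fst v, \<alpha> * snd u + \<beta> * snd v, 1/2 * (\<alpha> * \<beta> * cross2 u v * (2 * \<theta> - 1)))"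
    "AE t in lborel. t \<in> {0..1} \<longrightarrow> Lnorm Q (hproj (vector_derivative \<gamma> (at t))) = \<alpha> + \<beta>"
    "\<And>t. t \<le> \<theta> * \<alpha> / (\<alpha> + \<beta>) \<Longrightarrow> hproj (\<gamma> t) = (t * (\<alpha> + \<beta>)) *\<^sub>R u"
proof -
  define T where "T = \<alpha> + \<beta>"
  have T: "T > 0" using ab by (simp add: T_def)
  define t1 where "t1 = \<theta> * \<alpha> / T"
  define t2 where "t2 = (\<theta> * \<alpha> + \<beta>) / T"
  let ?u = "T *\<^sub>R u" and ?v = "T *\<^sub>R v"
  define V1 :: heis where "V1 = (fst ?u, snd ?u, 0)"
  define V2 :: heis where "V2 = (fst ?v, snd ?v, t1 / 2 * cross2 ?u ?v)"
  define V3 :: heis where "V3 = (fst ?u, snd ?u, t1 / 2 * cross2 ?u ?u + (t2 - t1) / 2 * cross2 ?v ?u)"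
  define \<gamma> where "\<gamma> = three_seg t1 t2 V1 V2 V3"
  have t1T: "t1 * T = \<theta> * \<alpha>" "(t2 - t1) * T = \<beta>" "(1 - t2) * T = (1 - \<theta>) * \<alpha>"
    using T by (simp_all add: t1_def t2_def field_simps) (simp add: T_def algebra_simps)
  have t: "0 \<le> t1" "t1 \<le> t2" using ab th T by (auto simp: t1_def t2_def divide_right_mono)
  have "(1 - \<theta>) * \<alpha> > 0" using ab th by simp
  then have t21: "t2 \<le> 1" using t1T(3) T by (smt (verit) mult_neg_pos)
  show ?thesis
  proof
    show "admissible \<gamma>" unfolding \<gamma>_def
      by (rule three_seg_admissible[OF t V1_def V2_def V3_def])
    show "\<gamma> 0 = hzero" using t by (simp add: \<gamma>_def three_seg_def hzero_def V1_def V2_def V3_def zero_prod_def)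
    have e: "\<gamma> 1 = t1 *\<^sub>R V1 + (t2 - t1) *\<^sub>R V2 + (1 - t2) *\<^sub>R V3"
      using t t21 by (simp add: \<gamma>_def three_seg_def max_absorb1 max_absorb2 min_absorb2)
    have p: "fst (\<gamma> 1) = (t1 * T) * fst u + ((t2 - t1) * T) * fst v + ((1 - t2) * T) * fst u"
      "fst (snd (\<gamma> 1)) = (t1 * T) * snd u + ((t2 - t1) * T) * snd v + ((1 - t2) * T) * snd u"
      unfolding e V1_def V2_def V3_def by (simp_all add: algebra_simps)
    have "snd (snd (\<gamma> 1)) = 1/2 * ((t1 * T) * ((t2 - t1) * T) * cross2 u v - ((t2 - t1) * T) * ((1 - t2) * T) * cross2 u v)"
      unfolding e V1_def V2_def V3_def by (simp add: cross2_def) algebra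
    then have q: "snd (snd (\<gamma> 1)) = 1/2 * (\<alpha> * \<beta> * cross2 u v * (2 * \<theta> - 1))"
      unfolding t1T by (simp add: algebra_simps)
    show "\<gamma> 1 = (\<alpha> * fst u + \<beta> * fst v, \<alpha> * snd u + \<beta> * snd v, 1/2 * (\<alpha> * \<beta> * cross2 u v * (2 * \<theta> - 1)))"
      using p[unfolded t1T] q by (simp add: prod_eq_iff algebra_simps)
    have "Lnorm Q (T *\<^sub>R u) = T" "Lnorm Q (T *\<^sub>R v) = T" using Lnorm_scale[OF Q, of T] T N by auto
    then show "AE t in lborel. t \<in> {0..1} \<longrightarrow> Lnorm Q (hproj (vector_derivative \<gamma> (at t))) = \<alpha> + \<beta>"
      unfolding \<gamma>_def T_def[symmetric]
      by (intro three_seg_speed t) (simp_all add: hproj_def V1_def V2_def V3_def scaleR_prod_def)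
    show "hproj (\<gamma> s) = (s * (\<alpha> + \<beta>)) *\<^sub>R u" if "s \<le> \<theta> * \<alpha> / (\<alpha> + \<beta>)" for s
    proof -
      have "s \<le> t1" using that by (simp add: t1_def T_def)
      then show ?thesis using t
        by (simp add: \<gamma>_def three_seg_def V1_def hproj_def T_def scaleR_prod_def max_absorb1 max_absorb2 min_absorb1)
    qed
  qed
qed

section \<open>Heights below and above the threshold\<close>

context vertical_polygon begin

text \<open>Calibration by the fixed corner \<open>(a, f a)\<close>: a constant functional
  integrates to its value on the chord.\<close>

lemma cc_length_ge_norm:
  assumes g: "admissible \<gamma>" "\<gamma> 0 = hzero" "\<gamma> 1 = (0, P, z)"
  shows "a * P \<le> cc_length Q \<gamma>"
proof -
  interpret planar_curve S Q "\<lambda>t. fst (\<gamma> t)" "\<lambda>t. fst (vector_derivative \<gamma> (at t))"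
    "\<lambda>t. fst (snd (\<gamma> t))" "\<lambda>t. fst (snd (vector_derivative \<gamma> (at t)))" P
    using planar_projection(1)[OF g] .
  let ?x' = "\<lambda>t. fst (vector_derivative \<gamma> (at t))" and ?y' = "\<lambda>t. fst (snd (vector_derivative \<gamma> (at t)))"
  have "((\<lambda>t. a * ?y' t - f a * ?x' t) has_integral (a * (P - 0) - f a * (0 - 0))) {0..1}"
    using lip_deriv_FTC[OF x, of 0 1] lip_deriv_FTC[OF y, of 0 1] ends
    by (intro has_integral_diff has_integral_mult_right) simp_all
  moreover have "((\<lambda>t. N (?x' t, ?y' t)) has_integral len) {0..1}"
    unfolding len_def using speed_integrable[OF x y] by (rule integrable_integral)
  ultimately have "a * (P - 0) - f a * (0 - 0) \<le> len"
    by (rule has_integral_le) (use cal_lower[of a "(p, q)" for p q] a(1) in auto)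
  then show ?thesis using planar_projection(3)[OF g] by simp
qed

text \<open>For \<open>p = (0, 1)\<close> the threshold \<open>z = 1 / (2 k)\<close> is half the area of the parallelogram with
  diagonal \<open>p\<close> spanned by the two edges adjacent to the direction \<open>p\<close>.\<close>
lemma extreme_edges:
  obtains h1 u v k where "0 \<le> h1" "h1 < a" "k > 0" "w h1 = k * (a - h1)" "area h1 = k / 2 * (a - h1)\<^sup>2"
    "u \<in> S" "v \<in> S" "N u = 1" "N v = 1" "fst u > 0" "fst v < 0"
    "cross2 u v = - k * fst u * fst v" "a = 1 / k * (1 / fst u - 1 / fst v)"
proof -
  obtain h1 s1 s2 where h1: "0 \<le> h1" "h1 < a" and s: "s1 \<in> Sp" "s2 \<in> Sp"
    and f1: "\<And>x. h1 \<le> x \<Longrightarrow> x \<le> a \<Longrightarrow> f x = line s1 x"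
    and f2: "\<And>x. - a \<le> x \<Longrightarrow> x \<le> - h1 \<Longrightarrow> f x = line s2 x" by (rule extreme_pieces) blast
  have p: "fst s1 > 0" "fst s2 > 0" using s Sp_pos by auto
  \<comment> \<open>The difference of the slopes of the two edges meeting at the right corner. For
    \<open>h1 \<le> h < a\<close> the cut leaves a triangle with \<open>w h = k * (a - h)\<close>,
    so \<open>area h / (w h)\<^sup>2\<close> has the constant value
    \<open>1 / (2 * k)\<close>.\<close>
  define k where "k = snd s1 / fst s1 - snd s2 / fst s2"
  have w1: "w x = 1 / fst s1 + 1 / fst s2 - k * x" if "h1 \<le> x" "x \<le> a" for x
    unfolding w_def f1[OF that] using f2[of "- x"] that
    by (simp add: line_def k_def diff_divide_distrib add_divide_distrib algebra_simps)
  have ka: "k * a = 1 / fst s1 + 1 / fst s2" using w1[of a] h1 a(2) by simp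
  have wk: "w x = k * (a - x)" if "h1 \<le> x" "x \<le> a" for x
    unfolding w1[OF that] ka[symmetric] by (simp add: algebra_simps)
  have k0: "k > 0"
  proof -
    have "k * a > 0" unfolding ka using p by (simp add: add_pos_pos)
    then show ?thesis using a(1) by (simp add: zero_less_mult_iff)
  qed
  have "area h1 - k / 2 * (a - h1)\<^sup>2 = area a - k / 2 * (a - a)\<^sup>2"
  proof (rule DERIV_isconst_end[OF h1(2), symmetric])
    show "continuous_on {h1..a} (\<lambda>x. area x - k / 2 * (a - x)\<^sup>2)"
      by (intro continuous_intros area_continuous)
    show "((\<lambda>x. area x - k / 2 * (a - x)\<^sup>2) has_real_derivative 0) (at x)" if "h1 < x" "x < a" for x
    proof -
      have "((\<lambda>x. k / 2 * (a - x)\<^sup>2) has_real_derivative - k * (a - x)) (at x)"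
        by (auto intro!: derivative_eq_intros simp: field_simps)
      from DERIV_diff[OF area_deriv this] show ?thesis using wk[of x] that by simp
    qed
  qed
  then have ar: "area h1 = k / 2 * (a - h1)\<^sup>2" by (simp add: area_a)
  have N1: "N s1 = 1"
  proof -
    have "a * snd s1 - f a * fst s1 = 1" using f1[of a] h1 p by (simp add: line_def)
    then have "1 \<le> N s1" using cal_lower[of a s1] a(1) by simp
    moreover have "N (1 *\<^sub>R s1) \<le> 1" by (intro Lnorm_scaleR_le Q S_subset Sp_S s) simp
    ultimately show ?thesis by simp
  qed
  have N2: "N s2 = 1"
  proof -
    have "- a * snd s2 - f (- a) * fst s2 = 1" using f2[of "- a"] h1 p by (simp add: line_def)
    then have "1 \<le> N s2" using cal_lower[of "- a" s2] a(1) by simp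
    moreover have "N (1 *\<^sub>R s2) \<le> 1" by (intro Lnorm_scaleR_le Q S_subset Sp_S s) simp
    ultimately show ?thesis by simp
  qed
  show ?thesis
  proof
    show "w h1 = k * (a - h1)" using wk h1 by simp
    \<comment> \<open>The edge at the left end, parallel to \<open>s2\<close>, reappears by point
      reflection as the upper edge at the right corner; traversed counterclockwise it has direction
      \<open>- s2\<close>.\<close>
    show "s1 \<in> S" "- s2 \<in> S" using s Sp_S Ssym by auto
    show "N (- s2) = 1" using N2 by (simp add: Lnorm_minus[OF Q])
    show "cross2 s1 (- s2) = - k * fst s1 * fst (- s2)"
      using p by (simp add: cross2_def k_def field_simps)
    show "a = 1 / k * (1 / fst s1 - 1 / fst (- s2))" using ka k0 by (simp add: field_simps)
  qed (use h1 k0 ar N1 p in auto)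
qed

text \<open>With \<open>(0, 1) = \<alpha> u + \<beta> v\<close>, one may cut the \<open>u\<close>
  edge around \<open>v\<close> or the \<open>v\<close> edge around \<open>u\<close>. Either choice
  reaches every height below the threshold at the minimal length \<open>a\<close>.\<close>

lemma not_unique_near:
  assumes k: "k > 0" and S: "N u = 1" "N v = 1" "fst u > 0" "fst v < 0"
    and c: "cross2 u v = - k * fst u * fst v" and a_eq: "a = 1 / k * (1 / fst u - 1 / fst v)"
    and z: "\<bar>z\<bar> < 1 / (2 * k)"
  shows "N (0, 1) = a" "dCC Q hzero (0, 1, z) = N (0, 1)" "\<not> unique_geodesic Q hzero (0, 1, z)"
proof -
  define \<alpha> where "\<alpha> = 1 / (k * fst u)"
  define \<beta> where "\<beta> = - 1 / (k * fst v)"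
  have ab: "\<alpha> > 0" "\<beta> > 0" using k S by (auto simp: \<alpha>_def \<beta>_def mult_pos_neg divide_pos_pos divide_neg_neg)
  have sum: "\<alpha> + \<beta> = a" using k S by (simp add: a_eq \<alpha>_def \<beta>_def field_simps)
  have p1: "\<alpha> * fst u + \<beta> * fst v = 0" using k S by (simp add: \<alpha>_def \<beta>_def)
  have p2: "\<alpha> * snd u + \<beta> * snd v = 1"
  proof -
    have "\<alpha> * snd u + \<beta> * snd v = - cross2 u v / (k * fst u * fst v)"
      using k S by (simp add: \<alpha>_def \<beta>_def cross2_def field_simps)
    then show ?thesis using k S by (simp add: c)
  qed
  have abc: "\<alpha> * \<beta> * cross2 u v = 1 / k" using k S by (simp add: \<alpha>_def \<beta>_def c)
  \<comment> \<open>Solves \<open>1 / (2 * k) * (2 * \<theta> - 1) = z\<close>; the bound on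
    \<open>z\<close> is exactly \<open>0 < \<theta> < 1\<close>.\<close>
  define \<theta> where "\<theta> = (1 + 2 * k * z) / 2"
  have kz: "\<bar>2 * k * z\<bar> < 1" using z k by (simp add: abs_mult field_simps)
  then have th: "0 < \<theta>" "\<theta> < 1" by (auto simp: \<theta>_def)
  obtain \<gamma> where g: "admissible \<gamma>" "\<gamma> 0 = hzero"
    "\<gamma> 1 = (\<alpha> * fst u + \<beta> * fst v, \<alpha> * snd u + \<beta> * snd v, 1/2 * (\<alpha> * \<beta> * cross2 u v * (2 * \<theta> - 1)))"
    "AE t in lborel. t \<in> {0..1} \<longrightarrow> N (hproj (vector_derivative \<gamma> (at t))) = \<alpha> + \<beta>"
    "\<And>t. t \<le> \<theta> * \<alpha> / (\<alpha> + \<beta>) \<Longrightarrow> hproj (\<gamma> t) = (t * (\<alpha> + \<beta>)) *\<^sub>R u"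
    by (rule two_edge_curve[OF Q ab th S(1,2)]) blast
  obtain \<eta> where e: "admissible \<eta>" "\<eta> 0 = hzero"
    "\<eta> 1 = (\<beta> * fst v + \<alpha> * fst u, \<beta> * snd v + \<alpha> * snd u, 1/2 * (\<beta> * \<alpha> * cross2 v u * (2 * (1 - \<theta>) - 1)))"
    "AE t in lborel. t \<in> {0..1} \<longrightarrow> N (hproj (vector_derivative \<eta> (at t))) = \<beta> + \<alpha>"
    "\<And>t. t \<le> (1 - \<theta>) * \<beta> / (\<beta> + \<alpha>) \<Longrightarrow> hproj (\<eta> t) = (t * (\<beta> + \<alpha>)) *\<^sub>R v"
    by (rule two_edge_curve[OF Q ab(2,1) _ _ S(2,1), of "1 - \<theta>"]) (use th in auto)
  have cvu: "cross2 v u = - cross2 u v" by (simp add: cross2_def)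
  have g1: "\<gamma> 1 = (0, 1, z)" unfolding g(3) p1 p2 abc using k by (simp add: \<theta>_def field_simps)
  have "\<beta> * \<alpha> * cross2 v u = - (1 / k)" unfolding cvu abc[symmetric] by simp
  then have "1/2 * (\<beta> * \<alpha> * cross2 v u * (2 * (1 - \<theta>) - 1)) = z"
    using k by (simp only:) (simp add: \<theta>_def field_simps)
  then have e1: "\<eta> 1 = (0, 1, z)" using e(3) p1 p2 by (simp add: add.commute)
  have lg: "cc_length Q \<gamma> = a" using cc_length_const_speed[OF g(4)] sum by simp
  have le: "cc_length Q \<eta> = a" using cc_length_const_speed[OF e(4)] sum by simp
  have d: "dCC Q hzero (0, 1, z) = a"
  proof (rule antisym)
    show "dCC Q hzero (0, 1, z) \<le> a" using dCC_le[OF Q g(1,2) g1] lg by simp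
    show "a \<le> dCC Q hzero (0, 1, z)" by (rule dCC_ge) (use cc_length_ge_norm[of _ 1 z] in simp)
  qed
  have "N (0, 1) \<le> a"
  proof -
    have "(0, 1) = \<alpha> *\<^sub>R u + \<beta> *\<^sub>R v" using p1 p2 by (simp add: prod_eq_iff)
    then have "N (0, 1) \<le> N (\<alpha> *\<^sub>R u) + N (\<beta> *\<^sub>R v)" using Lnorm_triangle[OF Q] by metis
    then show ?thesis using Lnorm_scale[OF Q, of \<alpha> u] Lnorm_scale[OF Q, of \<beta> v] ab S sum by simp
  qed
  moreover have "a \<le> N (0, 1)" using cal_lower[of a "(0, 1)"] a(1) by simp
  ultimately show "N (0, 1) = a" by simp
  then show "dCC Q hzero (0, 1, z) = N (0, 1)" using d by simp
  have Gg: "cc_geodesic Q hzero (0, 1, z) \<gamma>" unfolding cc_geodesic_def using g g1 lg d sum by simp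
  have Ge: "cc_geodesic Q hzero (0, 1, z) \<eta>" unfolding cc_geodesic_def using e e1 le d sum by (simp add: add.commute)
  \<comment> \<open>No later than the first turn of either curve: they are still on their initial
    segments, on opposite sides of the vertical axis.\<close>
  define t where "t = min (\<theta> * \<alpha> / a) ((1 - \<theta>) * \<beta> / a)"
  have t0: "t > 0" using th ab a(1) by (simp add: t_def)
  have "\<theta> * \<alpha> \<le> 1 * a" using th ab sum by (intro mult_mono) auto
  then have t1: "t \<le> 1" using a(1) by (simp add: t_def min_le_iff_disj divide_le_eq)
  have "hproj (\<gamma> t) = (t * a) *\<^sub>R u" using g(5)[of t] sum by (simp add: t_def)
  moreover have "hproj (\<eta> t) = (t * a) *\<^sub>R v" using e(5)[of t] sum by (simp add: t_def add.commute)
  ultimately have "fst (hproj (\<gamma> t)) > 0" "fst (hproj (\<eta> t)) < 0"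
    using t0 a(1) S by (auto simp: mult_pos_neg)
  then have ne: "\<gamma> t \<noteq> \<eta> t" by auto
  show "\<not> unique_geodesic Q hzero (0, 1, z)"
    using Gg Ge ne t0 t1 unfolding unique_geodesic_def by (metis atLeastAtMost_iff less_imp_le)
qed

text \<open>The dilation by \<open>w h\<close> carries \<open>(0, 1, z)\<close> to the endpoint of
  the arc cut at \<open>h\<close> as soon as \<open>area h = z * (w h)\<^sup>2\<close>, so the task
  is to find such an \<open>h\<close>.\<close>

lemma unique_far:
  assumes h1: "0 \<le> h1" "h1 < a" and k: "k > 0" and w1: "w h1 = k * (a - h1)" and a1: "area h1 = k / 2 * (a - h1)\<^sup>2"
    and z: "z > 1 / (2 * k)"
  shows "a < dCC Q hzero (0, 1, z)" "unique_geodesic Q hzero (0, 1, z)"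
proof -
  \<comment> \<open>In this form without a quotient the left end is included: there \<open>w\<close>
    vanishes and the difference is positive. At \<open>h1\<close> the quotient is the threshold
    \<open>1 / (2 * k)\<close>, below \<open>z\<close>.\<close>
  have "\<exists>h\<ge>- a. h \<le> h1 \<and> area h - z * (w h)\<^sup>2 = 0"
  proof (rule IVT2')
    have "area h1 - z * (w h1)\<^sup>2 = k / 2 * (a - h1)\<^sup>2 - z * (k\<^sup>2 * (a - h1)\<^sup>2)"
      by (simp only: w1 a1 power_mult_distrib)
    also have "\<dots> = (k / 2 - z * k\<^sup>2) * (a - h1)\<^sup>2" by (simp add: left_diff_distrib)
    also have "\<dots> \<le> 0"
    proof -
      have "k / 2 \<le> z * k\<^sup>2" using z k by (simp add: power2_eq_square field_simps)
      then show ?thesis by (simp add: mult_nonpos_nonneg)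
    qed
    finally show "area h1 - z * (w h1)\<^sup>2 \<le> 0" .
    show "0 \<le> area (- a) - z * (w (- a))\<^sup>2" using area_pos[of "- a"] a by simp
    show "- a \<le> h1" using h1 a(1) by simp
    show "continuous_on {- a..h1} (\<lambda>h. area h - z * (w h)\<^sup>2)"
      by (intro continuous_intros area_continuous w_continuous)
  qed
  then obtain h where h: "- a \<le> h" "h \<le> h1" "area h = z * (w h)\<^sup>2" by auto
  have "h \<noteq> - a" using h(3) area_pos[of "- a"] a by auto
  then have ha: "- a < h" "h < a" using h h1 by auto
  define t where "t = w h"
  have t: "t > 0" unfolding t_def by (rule w_pos[OF ha])
  interpret dil: heis_equiv t 0 0 t t Q Q by (rule heis_equiv_dilation[OF Q t])
  have pt: "hlin t 0 0 t (0, 1, z) = (0, w h, area h)"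
    by (simp add: hlin_def t_def h(3) power2_eq_square)
  show "unique_geodesic Q hzero (0, 1, z)"
    using dil.unique_geodesic_equiv[of "(0, 1, z)"] unique_geodesic_arc[OF ha] unfolding pt by simp
  \<comment> \<open>Schmidt's inequality is applied to the arc at the cut \<open>h1\<close>, the
    base of the tip triangle. Length at most \<open>a * t\<close> would bound the area by
    \<open>t\<^sup>2 / (2 * k)\<close>, less than the area \<open>z * t\<^sup>2\<close> that the arc
    has.\<close>
  have "t * a < arc_len h"
  proof (rule ccontr)
    assume "\<not> t * a < arc_len h"
    then have small: "arc_len h \<le> a * t" by (simp add: mult.commute)
    note g = iso_arc_geodesic(1-3)[OF ha]
    interpret planar_curve S Q "\<lambda>t. fst (iso_arc h t)" "\<lambda>t. fst (vector_derivative (iso_arc h) (at t))"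
      "\<lambda>t. fst (snd (iso_arc h t))" "\<lambda>t. fst (snd (vector_derivative (iso_arc h) (at t)))" "w h"
      using planar_projection(1)[OF g] .
    have ar: "ar = area h" and len: "len = arc_len h"
      using planar_projection(2,3)[OF g] cc_length_const_speed[OF iso_arc_geodesic(4)[OF ha]] by auto
    have "- a < h1" using h1 a(1) by simp
    then obtain \<mu> where mu: "\<mu> > 0" and iso: "ar + \<mu>\<^sup>2 * area h1 \<le> \<mu> * (len - h1 * w h)"
      using isoperimetric[of h1] h1(2) w_pos[OF ha] area_pos[of h] ha ar by (metis less_imp_le)
    define n where "n = \<mu> * (a - h1)"
    have "\<mu> * (len - h1 * w h) \<le> \<mu> * (a * t - h1 * t)"
      using small mu len by (intro mult_left_mono) (auto simp: t_def)
    moreover have "\<mu>\<^sup>2 * area h1 = k / 2 * n\<^sup>2" by (simp add: a1 n_def power_mult_distrib)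
    moreover have "\<mu> * (a * t - h1 * t) = n * t" by (simp add: n_def algebra_simps)
    ultimately have "area h + k / 2 * n\<^sup>2 \<le> n * t" using iso ar by linarith
    moreover have "n * t \<le> k / 2 * n\<^sup>2 + t\<^sup>2 / (2 * k)"
    proof -
      have "0 \<le> (k * n - t)\<^sup>2 / (2 * k)" using k by simp
      also have "(k * n - t)\<^sup>2 / (2 * k) = k / 2 * n\<^sup>2 + t\<^sup>2 / (2 * k) - n * t"
        using k by (simp add: power2_eq_square field_simps)
      finally show ?thesis by simp
    qed
    moreover have "t\<^sup>2 / (2 * k) < z * t\<^sup>2" using mult_strict_right_mono[OF z, of "t\<^sup>2"] t by simp
    ultimately show False using h(3) by (simp add: t_def)
  qed
  then show "a < dCC Q hzero (0, 1, z)"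
    using dil.dCC_equiv[of "(0, 1, z)"] t unfolding pt dCC_arc[OF ha] by simp
qed

text \<open>The assumption on all pairs of generators avoids naming the adjacent pair. For the pair
  from \<open>extreme_edges\<close> it says \<open>2 * z * k \<noteq> 1\<close>, that is,
  \<open>z\<close> is not the threshold.\<close>

lemma unique_iff_vertical:
  assumes z: "0 \<le> z"
    and gen: "\<And>u v. u \<in> S \<Longrightarrow> v \<in> S \<Longrightarrow> cross2 u v \<noteq> 0 \<Longrightarrow> 2 * z * cross2 u v \<noteq> cross2 (0, 1) v * cross2 u (0, 1)"
  shows "unique_geodesic Q hzero (0, 1, z) \<longleftrightarrow> N (0, 1) < dCC Q hzero (0, 1, z)"
proof -
  obtain h1 u v k where h1: "0 \<le> h1" "h1 < a" and k: "k > 0" and w1: "w h1 = k * (a - h1)" "area h1 = k / 2 * (a - h1)\<^sup>2"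
    and uv: "u \<in> S" "v \<in> S" and N: "N u = 1" "N v = 1" "fst u > 0" "fst v < 0"
    and c: "cross2 u v = - k * fst u * fst v" and aeq: "a = 1 / k * (1 / fst u - 1 / fst v)"
    by (rule extreme_edges) blast
  have "2 * z * cross2 u v \<noteq> cross2 (0, 1) v * cross2 u (0, 1)"
    using gen[OF uv] c k N by simp
  then have "2 * z * k \<noteq> 1" unfolding c by (auto simp: cross2_def)
  then have "z \<noteq> 1 / (2 * k)" using k by auto
  then consider "z < 1 / (2 * k)" | "z > 1 / (2 * k)" by linarith
  then show ?thesis
  proof cases
    case 1
    then have "\<bar>z\<bar> < 1 / (2 * k)" using z by simp
    from not_unique_near[OF k N c aeq this] show ?thesis by simp
  next
    case 2
    have "N (0, 1) = a" using not_unique_near(1)[OF k N c aeq, of 0] k by simp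
    then show ?thesis using unique_far[OF h1 k w1 2] by simp
  qed
qed

end

section \<open>Generic points and volumes\<close>

lemma cross2_plin: "cross2 (plin a b c d u) (plin a b c d v) = (a * d - b * c) * cross2 u v"
  by (simp add: cross2_def plin_def algebra_simps)

lemma unique_iff_generic:
  assumes finS: "finite S" and QS: "Q = convex hull S" and Q: "sym_polygon Q"
    and Ssym: "\<And>s. s \<in> S \<Longrightarrow> - s \<in> S"
    and gen1: "\<And>s. s \<in> S \<Longrightarrow> s \<noteq> 0 \<Longrightarrow> cross2 s p \<noteq> 0"
    and gen2: "\<And>u v. u \<in> S \<Longrightarrow> v \<in> S \<Longrightarrow> cross2 u v \<noteq> 0 \<Longrightarrow> 2 * z * cross2 u v \<noteq> cross2 p v * cross2 u p"
  shows "unique_geodesic Q hzero (fst p, snd p, z) \<longleftrightarrow> Lnorm Q p < dCC Q hzero (fst p, snd p, z)"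
proof -
  obtain p1 p2 where p: "p = (p1, p2)" by (cases p)
  have "\<exists>s\<in>S. s \<noteq> 0"
  proof (rule ccontr)
    assume "\<not> ?thesis"
    then have "S \<subseteq> {0}" by auto
    then have "Q \<subseteq> {0}" unfolding QS by (intro hull_minimal) auto
    then have "interior Q \<subseteq> interior {0}" by (rule interior_mono)
    then show False using sym_polygonD(3)[OF Q] by auto
  qed
  then have p0: "p \<noteq> 0" using gen1 by (force simp: cross2_def)
  define n where "n = p1\<^sup>2 + p2\<^sup>2"
  have n: "n > 0" using p0 unfolding p n_def by (simp add: sum_power2_gt_zero_iff zero_prod_def)
  have nn: "(p1\<^sup>2 + p2\<^sup>2) / n = 1" unfolding n_def[symmetric] using n by simp
  \<comment> \<open>The sign of \<open>z\<close>; as determinant of \<open>T\<close> it multiplies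
    the height and makes it nonnegative.\<close>
  define c :: real where "c = (if z \<ge> 0 then 1 else - 1)"
  have cc: "c * c = 1" "c \<noteq> 0" "c * z \<ge> 0" by (auto simp: c_def)
  \<comment> \<open>The first row annihilates \<open>p\<close>, the second sends it to 1; the
    division by \<open>n\<close> normalizes the determinant to \<open>c\<close>.\<close>
  define T where "T = plin (c * p2) (- c * p1) (p1 / n) (p2 / n)"
  have det: "(c * p2) * (p2 / n) - (- c * p1) * (p1 / n) = c"
  proof -
    have "(c * p2) * (p2 / n) - (- c * p1) * (p1 / n) = c * ((p1\<^sup>2 + p2\<^sup>2) / n)"
      by (simp add: power2_eq_square add_divide_distrib algebra_simps)
    then show ?thesis by (simp only: nn mult_1_right)
  qed
  have lin: "linear T" unfolding T_def by (rule linear_plin)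
  have inj: "inj T" unfolding T_def
    by (rule inj_on_inverseI[where g = "plin _ _ _ _"]) (rule plin_inverse(1)[OF det cc(2)])
  have Tp: "T p = (0, 1)"
  proof -
    have "p1 / n * p1 + p2 / n * p2 = (p1\<^sup>2 + p2\<^sup>2) / n" by (simp add: power2_eq_square add_divide_distrib)
    also have "\<dots> = 1" by (rule nn)
    finally show ?thesis by (simp add: T_def plin_def p)
  qed
  have crossT: "cross2 (T u) (T v) = c * cross2 u v" for u v
    unfolding T_def cross2_plin det ..
  interpret V: vertical_polygon "T ` S" "T ` Q"
  proof
    show "finite (T ` S)" using finS by simp
    show "T ` Q = convex hull (T ` S)" using QS convex_hull_linear_image[OF lin, of S] by simp
    show "sym_polygon (T ` Q)" by (rule sym_polygon_linear_image[OF lin inj Q])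
    show "- s \<in> T ` S" if "s \<in> T ` S" for s
    proof -
      obtain u where u: "u \<in> S" "s = T u" using \<open>s \<in> T ` S\<close> by blast
      then have "- s = T (- u)" using linear_neg[OF lin] by simp
      then show ?thesis using Ssym[OF u(1)] by blast
    qed
    show "fst s \<noteq> 0" if "s \<in> T ` S" "s \<noteq> 0" for s
    proof -
      obtain u where u: "u \<in> S" "s = T u" using \<open>s \<in> T ` S\<close> by blast
      then have "u \<noteq> 0" using that(2) linear_0[OF lin] by auto
      then have "cross2 u p \<noteq> 0" by (rule gen1[OF u(1)])
      then have "cross2 s (0, 1) \<noteq> 0" unfolding u(2) Tp[symmetric] crossT using cc by simp
      then show ?thesis by (simp add: cross2_def)
    qed
  qed
  interpret H: heis_equiv "c * p2" "- c * p1" "p1 / n" "p2 / n" 1 Q "T ` Q"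
  proof
    show "Lnorm (T ` Q) (plin (c * p2) (- c * p1) (p1 / n) (p2 / n) v) = 1 * Lnorm Q v" for v
      using Lnorm_linear_image[OF lin inj, of Q v] by (simp add: T_def)
  qed (use det cc V.Q Q in simp_all)
  have pt: "hlin (c * p2) (- c * p1) (p1 / n) (p2 / n) (fst p, snd p, z) = (0, 1, c * z)"
    using Tp unfolding hlin_def det by (simp add: T_def plin_def)
  have "unique_geodesic (T ` Q) hzero (0, 1, c * z) \<longleftrightarrow> Lnorm (T ` Q) (0, 1) < dCC (T ` Q) hzero (0, 1, c * z)"
  proof (rule V.unique_iff_vertical[OF cc(3)])
    fix u v assume "u \<in> T ` S" "v \<in> T ` S" and ne: "cross2 u v \<noteq> 0"
    then obtain u' v' where uv: "u' \<in> S" "v' \<in> S" "u = T u'" "v = T v'" by blast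
    have "2 * z * cross2 u' v' \<noteq> cross2 p v' * cross2 u' p"
      using gen2[OF uv(1,2)] ne unfolding uv crossT by simp
    then have "(c * c) * (2 * z * cross2 u' v') \<noteq> (c * c) * (cross2 p v' * cross2 u' p)" using cc by simp
    then show "2 * (c * z) * cross2 u v \<noteq> cross2 (0, 1) v * cross2 u (0, 1)"
      unfolding uv Tp[symmetric] crossT by (simp only: mult_ac not_False_eq_True)
  qed
  moreover have "Lnorm (T ` Q) (0, 1) = Lnorm Q p"
    using Lnorm_linear_image[OF lin inj, of Q p] Tp by simp
  ultimately show ?thesis
    using H.unique_geodesic_equiv[of "(fst p, snd p, z)"] H.dCC_equiv[of "(fst p, snd p, z)"]
    unfolding pt by simp
qed

section \<open>Exceptional points form a null set\<close>

lemma AE_not_on_line: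
  assumes "s \<noteq> (0 :: real \<times> real)"
  shows "AE x in lborel. cross2 s (hproj x) \<noteq> 0"
proof -
  have "negligible {x :: heis. (- snd s, fst s, 0) \<bullet> x = 0}"
    using assms by (intro negligible_hyperplane) (auto simp: zero_prod_def prod_eq_iff)
  moreover have "{x :: heis. (- snd s, fst s, 0) \<bullet> x = 0} = {x. \<not> cross2 s (hproj x) \<noteq> 0}"
    by (auto simp: cross2_def hproj_def inner_prod_def algebra_simps)
  ultimately show ?thesis by (simp add: AE_lborel_iff_negligible)
qed

text \<open>By Fubini: over each planar point at most one height is excluded. The complement is
  open, which settles measurability.\<close>

lemma AE_not_on_graph:
  fixes g :: "real \<times> real \<Rightarrow> real"
  assumes g: "continuous_on UNIV g" and c: "c \<noteq> 0"
  shows "AE x :: heis in lborel. snd (snd x) * c \<noteq> g (hproj x)"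
proof -
  let ?P = "\<lambda>x :: heis. snd (snd x) * c \<noteq> g (hproj x)"
  have cont: "continuous_on UNIV (\<lambda>x :: heis. g (hproj x))" unfolding hproj_def
    by (rule continuous_on_compose2[OF g]) (auto intro!: continuous_intros)
  have "open {x. ?P x}" by (intro open_Collect_neq continuous_intros cont)
  then have meas: "{x. ?P x} \<in> sets borel" by simp
  have 1: "AE w in lborel. ?P (x, w)" for x
  proof -
    have "open {w. ?P (x, w)}"
      by (intro open_Collect_neq continuous_intros continuous_on_compose2[OF cont]) auto
    then have m: "{w. ?P (x, w)} \<in> sets borel" by simp
    have "AE z in lborel. ?P (x, y, z)" for y
    proof -
      have "AE z in lborel. z \<noteq> g (x, y) / c" by (rule AE_lborel_singleton)
      then show ?thesis by eventually_elim (use c in \<open>simp add: hproj_def field_simps\<close>)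
    qed
    moreover have "{w \<in> space (lborel \<Otimes>\<^sub>M lborel). ?P (x, w)} \<in> sets (lborel \<Otimes>\<^sub>M lborel)"
      unfolding lborel_prod using m by simp
    ultimately have "AE w in lborel \<Otimes>\<^sub>M lborel. ?P (x, w)"
      by (intro lborel_pair.AE_pair_measure) simp_all
    then show ?thesis by (simp only: lborel_prod)
  qed
  have "{x \<in> space (lborel \<Otimes>\<^sub>M lborel). ?P x} \<in> sets (lborel \<Otimes>\<^sub>M lborel)"
    unfolding lborel_prod using meas by simp
  then have "AE x in lborel \<Otimes>\<^sub>M lborel. ?P x"
    by (rule lborel_pair.AE_pair_measure) (use 1 in simp)
  then show ?thesis by (simp only: lborel_prod)
qed

lemma AE_unique_iff:
  assumes Q: "sym_polygon Q"
  shows "AE x in lborel. unique_geodesic Q hzero x \<longleftrightarrow> Lnorm Q (hproj x) < dCC Q hzero x"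
proof -
  obtain S0 where S0: "finite S0" "Q = convex hull S0" using Q by (auto simp: sym_polygon_def)
  define S where "S = S0 \<union> uminus ` S0"
  have fin: "finite S" using S0 by (simp add: S_def)
  have sym: "- s \<in> S" if "s \<in> S" for s using that by (auto simp: S_def)
  have "S \<subseteq> Q" using S0(2) sym_polygonD(4)[OF Q] hull_inc[of _ S0 convex] by (auto simp: S_def)
  then have "convex hull S \<subseteq> Q" using sym_polygonD(2)[OF Q] by (intro hull_minimal)
  moreover have "Q \<subseteq> convex hull S" unfolding S0(2) by (rule hull_mono) (simp add: S_def)
  ultimately have QS: "Q = convex hull S" by blast
  have "AE x in lborel. \<forall>s\<in>S - {0}. cross2 s (hproj x) \<noteq> 0"
    by (intro eventually_ball_finite ballI AE_not_on_line) (use fin in auto)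
  moreover have "AE x in lborel. \<forall>u\<in>S. \<forall>v\<in>S. cross2 u v \<noteq> 0 \<longrightarrow>
     snd (snd x) * (2 * cross2 u v) \<noteq> cross2 (hproj x) v * cross2 u (hproj x)"
  proof (intro eventually_ball_finite ballI fin)
    fix u v :: "real \<times> real"
    show "AE x in lborel. cross2 u v \<noteq> 0 \<longrightarrow> snd (snd x) * (2 * cross2 u v) \<noteq> cross2 (hproj x) v * cross2 u (hproj x)"
    proof (cases "cross2 u v = 0")
      case False
      have "continuous_on UNIV (\<lambda>p. cross2 p v * cross2 u p)"
        unfolding cross2_def by (intro continuous_intros)
      from AE_not_on_graph[OF this, of "2 * cross2 u v"] False show ?thesis by simp
    qed simp
  qed
  ultimately show ?thesis
  proof eventually_elim
    case (elim x)
    have x: "x = (fst (hproj x), snd (hproj x), snd (snd x))" by (simp add: hproj_def)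
    have "unique_geodesic Q hzero (fst (hproj x), snd (hproj x), snd (snd x)) \<longleftrightarrow>
       Lnorm Q (hproj x) < dCC Q hzero (fst (hproj x), snd (hproj x), snd (snd x))"
    proof (rule unique_iff_generic[OF fin QS Q sym])
      show "cross2 s (hproj x) \<noteq> 0" if "s \<in> S" "s \<noteq> 0" for s using elim(1) that by blast
      show "2 * snd (snd x) * cross2 u v \<noteq> cross2 (hproj x) v * cross2 u (hproj x)"
        if "u \<in> S" "v \<in> S" "cross2 u v \<noteq> 0" for u v
        using elim(2) that by (metis mult.assoc mult.left_commute)
    qed
    then show ?case using x by simp
  qed
qed

text \<open>Stated for arbitrary sets: completeness of Lebesgue measure makes \<open>A\<close> and
  \<open>B\<close> measurable together, and on nonmeasurable sets \<open>measure\<close> is 0 by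
  convention.\<close>

lemma measure_lebesgue_AE_cong:
  fixes A B :: "'a::euclidean_space set"
  assumes "AE x in lborel. x \<in> A \<longleftrightarrow> x \<in> B"
  shows "measure lebesgue A = measure lebesgue B"
proof -
  let ?N = "{x. \<not> (x \<in> A \<longleftrightarrow> x \<in> B)}"
  have N: "negligible ?N" using assms by (simp add: AE_lborel_iff_negligible)
  have sub: "C \<in> sets lebesgue" if "C \<subseteq> ?N" for C
    using negligible_subset[OF N that] by (simp add: negligible_iff_null_sets null_setsD2)
  have AB: "A = (B - ?N) \<union> (A \<inter> ?N)" and BA: "B = (A - ?N) \<union> (B \<inter> ?N)" by auto
  have iff: "A \<in> sets lebesgue \<longleftrightarrow> B \<in> sets lebesgue"
  proof
    assume "B \<in> sets lebesgue"
    then have "(B - ?N) \<union> (A \<inter> ?N) \<in> sets lebesgue"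
      by (rule sets.Un[OF sets.Diff[OF _ sub[OF order_refl]] sub[OF Int_lower2]])
    then show "A \<in> sets lebesgue" using AB by simp
  next
    assume "A \<in> sets lebesgue"
    then have "(A - ?N) \<union> (B \<inter> ?N) \<in> sets lebesgue"
      by (rule sets.Un[OF sets.Diff[OF _ sub[OF order_refl]] sub[OF Int_lower2]])
    then show "B \<in> sets lebesgue" using BA by simp
  qed
  show ?thesis
  proof (cases "A \<in> sets lebesgue")
    case True
    have "AE x in lebesgue. x \<in> A \<longleftrightarrow> x \<in> B" using assms by (rule AE_completion)
    then show ?thesis using True iff by (intro measure_eq_AE) auto
  next
    case False
    then show ?thesis using iff by (simp add: measure_notin_sets)
  qed
qed

section \<open>Dilations, balls and the regular part\<close>

lemma hdil_hdil: "hdil s (hdil t x) = hdil (s * t) x"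
  by (simp add: hdil_def power_mult_distrib)

lemma hdil_1: "hdil 1 x = x" by (simp add: hdil_def)

lemma hdil_image_vimage:
  assumes "r > 0" shows "hdil r ` A = hdil (1 / r) -` A"
proof
  show "hdil r ` A \<subseteq> hdil (1 / r) -` A" using assms by (auto simp: hdil_hdil hdil_1)
  show "hdil (1 / r) -` A \<subseteq> hdil r ` A"
  proof
    fix x assume "x \<in> hdil (1 / r) -` A"
    then have "hdil (1 / r) x \<in> A" "x = hdil r (hdil (1 / r) x)" using assms by (auto simp: hdil_hdil hdil_1)
    then show "x \<in> hdil r ` A" by blast
  qed
qed

lemma hdil_vimage_image:
  assumes "r > 0" shows "hdil r -` (hdil r ` A) = A"
proof (rule inj_vimage_image_eq)
  have "hdil (1 / r) (hdil r x) = x" for x using assms by (simp add: hdil_hdil hdil_1)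
  then show "inj (hdil r)" by (rule inj_on_inverseI)
qed

text \<open>The factor is \<open>r ^ 4\<close> and cancels in the ratio. Nonmeasurable sets are
  covered because dilations preserve measurability in both directions.\<close>

lemma measure_hdil:
  assumes r: "r > 0"
  obtains K where "K > 0" "\<And>A. measure lebesgue (hdil r ` A) = K * measure lebesgue A"
proof -
  have B: "(Basis :: heis set) = {(1, 0, 0), (0, 1, 0), (0, 0, 1)}"
    unfolding Basis_prod_def Basis_real_def by (auto simp: zero_prod_def)
  define c :: "real \<Rightarrow> heis \<Rightarrow> real" where "c s j = (if j = (0, 0, 1) then s\<^sup>2 else s)" for s j
  have T: "hdil s = (\<lambda>x. 0 + (\<Sum>j\<in>Basis. (c s j * (x \<bullet> j)) *\<^sub>R j))" for s
  proof
    fix x :: heis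
    obtain p q z where x: "x = (p, q, z)" by (cases x)
    show "hdil s x = 0 + (\<Sum>j\<in>Basis. (c s j * (x \<bullet> j)) *\<^sub>R j)"
      unfolding B x by (simp add: c_def hdil_def zero_prod_def)
  qed
  have c0: "c s j \<noteq> 0" if "s > 0" for s j using that by (simp add: c_def)
  have meas: "hdil s \<in> lebesgue \<rightarrow>\<^sub>M lebesgue" if "s > 0" for s
    unfolding T by (rule lebesgue_affine_measurable) (rule c0[OF that])
  define K where "K = (\<Prod>j\<in>(Basis :: heis set). \<bar>c r j\<bar>)"
  have K: "K > 0" unfolding K_def by (rule prod_pos) (use c0[OF r] in simp)
  have dens: "lebesgue = density (distr lebesgue lebesgue (hdil r)) (\<lambda>_. ennreal K)"
    using lebesgue_affine_euclidean[of "c r" 0] c0[OF r] unfolding T[symmetric] K_def by simp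
  have "measure lebesgue (hdil r ` A) = K * measure lebesgue A" for A
  proof (cases "A \<in> sets lebesgue")
    case True
    have "hdil r ` A \<in> sets lebesgue"
      using measurable_sets[OF meas[of "1 / r"] True] r by (simp add: hdil_image_vimage)
    moreover have "hdil r -` (hdil r ` A) = A" by (rule hdil_vimage_image[OF r])
    ultimately have "emeasure lebesgue (hdil r ` A) = ennreal K * emeasure lebesgue A"
      by (subst dens) (simp add: emeasure_density_const emeasure_distr meas[OF r])
    then show ?thesis using K by (simp add: measure_def enn2real_mult)
  next
    case False
    have "hdil r ` A \<notin> sets lebesgue"
    proof
      assume "hdil r ` A \<in> sets lebesgue"
      then have "hdil r -` (hdil r ` A) \<in> sets lebesgue"
        using measurable_sets[OF meas[OF r]] by fastforce
      then show False using False by (simp only: hdil_vimage_image[OF r])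
    qed
    then show ?thesis using False by (simp add: measure_notin_sets)
  qed
  then show ?thesis using that K by blast
qed

lemma hlin_dilation: "hlin t 0 0 t x = hdil t x"
  by (simp add: hlin_def hdil_def power2_eq_square)

lemma hproj_hdil: "hproj (hdil t x) = t *\<^sub>R hproj x"
  by (simp add: hproj_def hdil_def)

lemma dCC_hdil:
  assumes "sym_polygon Q" "t > 0" shows "dCC Q hzero (hdil t x) = t * dCC Q hzero x"
  using heis_equiv.dCC_equiv[OF heis_equiv_dilation[OF assms], of x] by (simp add: hlin_dilation)

lemma unique_geodesic_hdil:
  assumes "sym_polygon Q" "t > 0" shows "unique_geodesic Q hzero (hdil t x) \<longleftrightarrow> unique_geodesic Q hzero x"
  using heis_equiv.unique_geodesic_equiv[OF heis_equiv_dilation[OF assms], of x] by (simp add: hlin_dilation)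

lemma cc_ball_hdil:
  assumes Q: "sym_polygon Q" and r: "r > 0"
  shows "cc_ball Q r = hdil r ` cc_ball Q 1"
    and "{x \<in> cc_ball Q r. unique_geodesic Q hzero x} = hdil r ` {x \<in> cc_ball Q 1. unique_geodesic Q hzero x}"
proof -
  have ball: "x \<in> cc_ball Q r \<longleftrightarrow> hdil (1 / r) x \<in> cc_ball Q 1" for x
    using dCC_hdil[OF Q, of "1 / r" x] r by (simp add: cc_ball_def divide_le_eq)
  have uniq: "unique_geodesic Q hzero (hdil (1 / r) x) \<longleftrightarrow> unique_geodesic Q hzero x" for x
    using unique_geodesic_hdil[OF Q, of "1 / r"] r by simp
  show "cc_ball Q r = hdil r ` cc_ball Q 1"
    by (rule set_eqI) (simp only: hdil_image_vimage[OF r] vimage_eq ball)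
  show "{x \<in> cc_ball Q r. unique_geodesic Q hzero x} = hdil r ` {x \<in> cc_ball Q 1. unique_geodesic Q hzero x}"
    by (rule set_eqI) (simp only: hdil_image_vimage[OF r] vimage_eq mem_Collect_eq ball uniq)
qed

text \<open>Both conditions scale with the dilation, so \<open>x\<close> is compared with its
  projection \<open>hdil (1 / t) x\<close> to the unit sphere, where \<open>t\<close> is its
  distance. The origin is set apart: \<open>t = 0\<close> puts it into the cone, although its norm
  is not smaller than its distance.\<close>

lemma regular_set_eq:
  assumes Q: "sym_polygon Q" and x: "x \<noteq> hzero"
  shows "x \<in> {hdil t p | t p. p \<in> cc_sphere Q \<and> hproj p \<in> interior Q \<and> 0 \<le> t \<and> t \<le> 1}
     \<longleftrightarrow> x \<in> cc_ball Q 1 \<and> Lnorm Q (hproj x) < dCC Q hzero x"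
proof
  assume "x \<in> {hdil t p | t p. p \<in> cc_sphere Q \<and> hproj p \<in> interior Q \<and> 0 \<le> t \<and> t \<le> 1}"
  then obtain t p where tp: "x = hdil t p" "dCC Q hzero p = 1" "Lnorm Q (hproj p) < 1" "0 \<le> t" "t \<le> 1"
    by (auto simp: cc_sphere_def Lnorm_less_1_iff[OF Q])
  have "t \<noteq> 0" using x tp(1) by (auto simp: hdil_def hzero_def)
  then have t: "t > 0" using tp by simp
  have d: "dCC Q hzero x = t" using dCC_hdil[OF Q t, of p] tp by simp
  have "Lnorm Q (hproj x) = t * Lnorm Q (hproj p)" using Lnorm_scale[OF Q] t tp(1) by (simp add: hproj_hdil)
  also have "\<dots> < t * 1" using tp(3) t by (intro mult_strict_left_mono)
  finally show "x \<in> cc_ball Q 1 \<and> Lnorm Q (hproj x) < dCC Q hzero x" using d tp by (simp add: cc_ball_def)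
next
  assume H: "x \<in> cc_ball Q 1 \<and> Lnorm Q (hproj x) < dCC Q hzero x"
  define t where "t = dCC Q hzero x"
  have t: "t > 0" "t \<le> 1" using H Lnorm_attained(1)[OF Q, of "hproj x"] by (auto simp: t_def cc_ball_def)
  let ?p = "hdil (1 / t) x"
  have "dCC Q hzero ?p = 1" using dCC_hdil[OF Q, of "1 / t" x] t by (simp add: t_def)
  moreover have "Lnorm Q (hproj ?p) < 1"
    using H t Lnorm_scale[OF Q, of "1 / t" "hproj x"] by (simp add: hproj_hdil t_def)
  moreover have "x = hdil t ?p" using t by (simp add: hdil_hdil hdil_1)
  ultimately show "x \<in> {hdil t p | t p. p \<in> cc_sphere Q \<and> hproj p \<in> interior Q \<and> 0 \<le> t \<and> t \<le> 1}"
    using t by (intro CollectI exI[of _ t] exI[of _ ?p]) (simp add: cc_sphere_def Lnorm_less_1_iff[OF Q])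
qed

theorem mainTheorem8:
  fixes Q :: "(real \<times> real) set"
  assumes "sym_polygon Q"
  shows "(\<forall>r>0. uniq_ratio Q r = Vreg Q / Vtot Q)
         \<and> (uniq_ratio Q \<longlongrightarrow> Vreg Q / Vtot Q) at_top"
proof -
  note Q = assms
  let ?U = "{x \<in> cc_ball Q 1. unique_geodesic Q hzero x}"
  have "AE x in lborel. x \<noteq> hzero"
    by (simp add: AE_lborel_iff_negligible)
  then have "AE x in lborel. x \<in> ?U \<longleftrightarrow> x \<in> {hdil t p | t p. p \<in> cc_sphere Q \<and> hproj p \<in> interior Q \<and> 0 \<le> t \<and> t \<le> 1}"
    using AE_unique_iff[OF Q]
  proof eventually_elim
    case (elim x)
    show ?case unfolding regular_set_eq[OF Q elim(1)] using elim(2) by simp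
  qed
  then have U: "measure lebesgue ?U = Vreg Q" unfolding Vreg_def by (rule measure_lebesgue_AE_cong)
  have ratio: "uniq_ratio Q r = Vreg Q / Vtot Q" if r: "r > 0" for r
  proof -
    obtain K where K: "K > 0" "\<And>A. measure lebesgue (hdil r ` A) = K * measure lebesgue A"
      using measure_hdil[OF r] by blast
    have "uniq_ratio Q r = (K * Vreg Q) / (K * Vtot Q)"
      unfolding uniq_ratio_def cc_ball_hdil(2)[OF Q r] unfolding cc_ball_hdil(1)[OF Q r] K(2) U Vtot_def ..
    then show ?thesis using K(1) by simp
  qed
  moreover have "(uniq_ratio Q \<longlongrightarrow> Vreg Q / Vtot Q) at_top"
    by (rule tendsto_eventually, rule eventually_mono[OF eventually_gt_at_top[of 0]]) (rule ratio)
  ultimately show ?thesis by blast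
qed

end
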